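(* Let $\mathcal{G}$ be a (finite, formal) linear combination of finite bipartite graphs such that $$\left(\partial_x^k - (-\partial_y)^k\right)\partial_z \mathcal{G} = 0$$ for every integer $k>0$. Then the function $\lambda \mapsto N_{\mathcal{G}}(\lambda)$ is a polynomial function on the set $\mathbb{Y}$ of Young diagrams.
   Context: A bipartite graph $G$ has vertex set $V = V_1 \sqcup V_2$; vertices in $V_1$ are called white and those in $V_2$ black, and every edge joins a white vertex to a black vertex. Numbers of colorings. For a Young diagram $\lambda$, the box in the $i$-th column and $j$-th row is denoted $(i,j)$. A coloring $h: V_1 \sqcup V_2 \to \{1,2,3,\dots\}$ is compatible with $\lambda$ if $(h(v_1),h(v_2)) \in \lambda$ for every edge $(v_1,v_2)$ of $G$ with $v_1 \in V_1$, $v_2 \in V_2$. Equivalently, white vertices are colored by columns and black vertices by rows of $\lambda$. $N_G(\lambda)$ denotes the number of colorings of $G$ compatible with $\lambda$, and $N_{\mathcal{G}} = \sum_G \alpha_G N_G$ for $\mathcal{G} = \sum_G \alpha_G G$. Polynomial functions on Young diagrams. For $k \ge 2$ let $$S_k(\lambda) = (k-1)\iint_{(x,y)\in\lambda} (x-y)^{k-2}\,dx\,dy,$$ where $\lambda$ is viewed, in French convention, as the union of unit squares $[i-1,i]\times[j-1,j]$ over its boxes $(i,j)$. The algebra $\mathcal{P}$ of polynomial functions on $\mathbb{Y}$ (in the sense of Kerov and Olshanski) is the algebra of functions on Young diagrams generated by $(S_k)_{k\ge 2}$. Graph derivatives. For a bipartite graph $G$, $$\partial_z G = \sum_e (G,e),$$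 where the sum runs over all edges $e$ of $G$ and $(G,e)$ denotes $G$ with the edge $e$ decorated by the symbol $z$. For a bipartite graph $G$ with one edge decorated by $z$, $$\partial_x G = \sum_f G_{f\equiv z},$$ where the sum runs over all edges $f \ne z$ sharing a common black vertex with the edge $z$. Here $G_{f\equiv z}$ is the graph obtained by gluing the edges $f$ and $z$ together: their white endpoints are identified, multiple edges in the result are replaced by single edges, and the resulting glued edge is decorated by $z$. Similarly, $\partial_y G = \sum_f G_{f\equiv z}$, with the sum over all edges $f \ne z$ sharing a common white vertex with the edge $z$. All these operators are extended linearly to formal linear combinations, and $\partial_x^k, \partial_y^k$ denote their $k$-fold iterates. The equality to $0$ is an equality of formal linear combinations of (decorated) bipartite graphs. *)

theory Defs
  imports "HOL-Analysis.Analysis" "HOL-Library.Poly_Mapping"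
begin

section \<open>Bipartite graphs\<close>

text \<open>
  White and black vertices have separate types, so the two vertex classes are always disjoint.
  Graphs are simple: edges form a set of pairs (white vertex, black vertex).
\<close>

datatype ('w, 'b) bigraph =
  Bigraph (white: "'w set") (black: "'b set") (edges: "('w \<times> 'b) set")

definition finite_bigraph :: "('w, 'b) bigraph \<Rightarrow> bool" where
  "finite_bigraph G \<longleftrightarrow> finite (white G) \<and> finite (black G) \<and> edges G \<subseteq> white G \<times> black G"

text \<open>A graph with one edge decorated by \<open>z\<close>: the second component is the decorated edge.\<close>

type_synonym ('w, 'b) decorated = "('w, 'b) bigraph \<times> ('w \<times> 'b)"

definition decorated_iso :: "('w, 'b) decorated \<Rightarrow> ('w, 'b) decorated \<Rightarrow> bool" where
  "decorated_iso D D' \<longleftrightarrow>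
     (\<exists>f g. bij_betw f (white (fst D)) (white (fst D')) \<and>
            bij_betw g (black (fst D)) (black (fst D')) \<and>
            map_prod f g ` edges (fst D) = edges (fst D') \<and>
            map_prod f g (snd D) = snd D')"


section \<open>Formal linear combinations\<close>

definition lin_extend :: "('a \<Rightarrow> ('c \<Rightarrow>\<^sub>0 real)) \<Rightarrow> ('a \<Rightarrow>\<^sub>0 real) \<Rightarrow> ('c \<Rightarrow>\<^sub>0 real)" where
  "lin_extend f X =
     (\<Sum>a \<in> Poly_Mapping.keys X. Poly_Mapping.map ((*) (Poly_Mapping.lookup X a)) (f a))"

text \<open>
  The operators below act on combinations of concrete (labelled) graphs. As elements of the space
  of formal linear combinations of graphs, these are considered up to isomorphism: the following
  map sends a combination of labelled decorated graphs to the induced combination of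
  isomorphism classes.
\<close>

definition unlabelled ::
    "(('w, 'b) decorated \<Rightarrow>\<^sub>0 real) \<Rightarrow> (('w, 'b) decorated set \<Rightarrow>\<^sub>0 real)" where
  "unlabelled = lin_extend (\<lambda>D. Poly_Mapping.single {D'. decorated_iso D D'} 1)"


section \<open>Graph derivatives\<close>

definition deriv_z :: "(('w, 'b) bigraph \<Rightarrow>\<^sub>0 real) \<Rightarrow> (('w, 'b) decorated \<Rightarrow>\<^sub>0 real)" where
  "deriv_z = lin_extend (\<lambda>G. \<Sum>e \<in> edges G. Poly_Mapping.single (G, e) 1)"

text \<open>
  Identify the vertex \<open>v'\<close> with \<open>v\<close>, keeping the label \<open>v\<close>. Multiple edges are merged because
  edges form a set.
\<close>

definition glue_white :: "'w \<Rightarrow> 'w \<Rightarrow> ('w, 'b) bigraph \<Rightarrow> ('w, 'b) bigraph" where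
  "glue_white v' v G =
     Bigraph (id(v' := v) ` white G) (black G) (map_prod (id(v' := v)) id ` edges G)"

definition glue_black :: "'b \<Rightarrow> 'b \<Rightarrow> ('w, 'b) bigraph \<Rightarrow> ('w, 'b) bigraph" where
  "glue_black v' v G =
     Bigraph (white G) (id(v' := v) ` black G) (map_prod id (id(v' := v)) ` edges G)"

definition deriv_x :: "(('w, 'b) decorated \<Rightarrow>\<^sub>0 real) \<Rightarrow> (('w, 'b) decorated \<Rightarrow>\<^sub>0 real)" where
  "deriv_x = lin_extend (\<lambda>(G, z). \<Sum>f \<in> {f \<in> edges G. f \<noteq> z \<and> snd f = snd z}.
      Poly_Mapping.single (glue_white (fst f) (fst z) G, z) 1)"

definition deriv_y :: "(('w, 'b) decorated \<Rightarrow>\<^sub>0 real) \<Rightarrow> (('w, 'b) decorated \<Rightarrow>\<^sub>0 real)" where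
  "deriv_y = lin_extend (\<lambda>(G, z). \<Sum>f \<in> {f \<in> edges G. f \<noteq> z \<and> fst f = fst z}.
      Poly_Mapping.single (glue_black (snd f) (snd z) G, z) 1)"


section \<open>Young diagrams\<close>

text \<open>The box \<open>(i, j)\<close> lies in the \<open>i\<close>-th column and the \<open>j\<close>-th row, counted from 1.\<close>

typedef young =
  "{B :: (nat \<times> nat) set. finite B \<and> B \<subseteq> {1..} \<times> {1..} \<and>
      (\<forall>(i, j) \<in> B. {1..i} \<times> {1..j} \<subseteq> B)}"
  morphisms boxes Young
  by (rule exI[of _ "{}"]) simp

definition region :: "young \<Rightarrow> (real \<times> real) set" where
  "region \<nu> = (\<Union>(i, j) \<in> boxes \<nu>. {real i - 1..real i} \<times> {real j - 1..real j})"

definition S :: "nat \<Rightarrow> young \<Rightarrow> real" where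
  "S k \<nu> = (real k - 1) * integral (region \<nu>) (\<lambda>(x, y). (x - y) ^ (k - 2))"

text \<open>The unital real algebra of functions generated by the \<open>S k\<close> with \<open>k \<ge> 2\<close>.\<close>

inductive_set polynomial_functions :: "(young \<Rightarrow> real) set" where
  const: "(\<lambda>_. c) \<in> polynomial_functions"
| gen: "k \<ge> 2 \<Longrightarrow> S k \<in> polynomial_functions"
| add: "F \<in> polynomial_functions \<Longrightarrow> H \<in> polynomial_functions
          \<Longrightarrow> (\<lambda>\<nu>. F \<nu> + H \<nu>) \<in> polynomial_functions"
| mult: "F \<in> polynomial_functions \<Longrightarrow> H \<in> polynomial_functions
          \<Longrightarrow> (\<lambda>\<nu>. F \<nu> * H \<nu>) \<in> polynomial_functions"


section \<open>Numbers of colorings\<close>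

definition compatible_colorings :: "('w, 'b) bigraph \<Rightarrow> young \<Rightarrow> ('w + 'b \<Rightarrow> nat) set" where
  "compatible_colorings G \<nu> =
     {h \<in> (white G <+> black G) \<rightarrow>\<^sub>E {1..}.
        \<forall>(v1, v2) \<in> edges G. (h (Inl v1), h (Inr v2)) \<in> boxes \<nu>}"

text \<open>
  If \<open>G\<close> has an isolated vertex, the set of compatible colorings is empty or infinite, and the
  number below is 0 by the convention for \<open>card\<close>. For finite graphs without isolated vertices
  the set is finite.
\<close>

definition N :: "('w, 'b) bigraph \<Rightarrow> young \<Rightarrow> nat" where
  "N G \<nu> = card (compatible_colorings G \<nu>)"

definition N_comb :: "(('w, 'b) bigraph \<Rightarrow>\<^sub>0 real) \<Rightarrow> young \<Rightarrow> real" where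
  "N_comb \<G> \<nu> = (\<Sum>G \<in> Poly_Mapping.keys \<G>. Poly_Mapping.lookup \<G> G * real (N G \<nu>))"

end

(*
  Let Phi(x, y) be the number of colorings of d_z G whose decorated edge is placed at the boundary
  point (x, y) of the diagram, where the diagram is a planar region and colors are real numbers.
  Along a horizontal piece of the boundary, d/dx acts on Phi as the graph derivative d_x, and along
  a vertical piece d/dy acts as d_y. By the hypothesis all derivatives of Phi with respect to the
  content z = x - y therefore match at the corners, so Phi is one polynomial Q(z) along the whole
  boundary. Far to the right on the x-axis its coefficients can be read off: the coefficient of z^k
  is the number of colorings of R_k G, where R_k removes in all possible ways a black vertex with
  exactly k + 1 leaves together with these leaves, with the factor k + 1.

  If every graph in G has n vertices, then n N_G is the derivative of N_G under dilation of the
  diagram, i.e. the integral of Q(x - y) (y dx - x dy) over the boundary. By Green's formula this is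
  the sum of (k + 2) / (k + 1) N_{R_k G} S_{k+2} over k. Since R_k commutes with d_x, d_y and d_z,
  the combination R_k G satisfies the hypothesis again, and induction on n applies. Graphs with
  isolated vertices contribute nothing to N_G.
*)

theory Submission
  imports Defs
begin

section \<open>Transposing the graph derivatives to functionals on graphs\<close>

section \<open>Evaluating formal linear combinations\<close>

text \<open>The hypothesis concerns isomorphism classes, whereas colorings are counted on labelled
  graphs. So the graph operators are transposed to functionals, and the hypothesis is used only by
  testing it on isomorphism-invariant functionals such as the weighted counts \<open>psi\<close>.

  Real colors never appear: colorings stay discrete, and a real boundary point enters only through
  the weight \<open>t\<close> of the one cut column or row. A derivative in \<open>t\<close> is a
  gluing because the product rule singles out another neighbour of the decorated vertex and forces
  it into the cut column, where the decorated white vertex already lies. Each gluing loses a vertex,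
  so Taylor's formula is exact and matching derivatives at a lattice point match whole polynomials.

  Dilation too is replaced by counting: a black vertex has as many colors as the height of the
  column of its largest neighbour color, and averaging over \<open>t\<close> turns this into an
  integral over the horizontal boundary. White vertices follow by transposition.

  Colors run up to \<open>M + 1\<close> for a diagram of side \<open>M\<close>, so that an empty
  column is available for the evaluation far to the right.\<close>

definition pairing :: "('a \<Rightarrow>\<^sub>0 real) \<Rightarrow> ('a \<Rightarrow> real) \<Rightarrow> real" where
  "pairing X \<phi> = (\<Sum>a \<in> Poly_Mapping.keys X. Poly_Mapping.lookup X a * \<phi> a)"

lemma pairing_superset:
  assumes "finite A" "Poly_Mapping.keys X \<subseteq> A"
  shows "pairing X \<phi> = (\<Sum>a \<in> A. Poly_Mapping.lookup X a * \<phi> a)"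
  unfolding pairing_def
  by (rule sum.mono_neutral_left) (use assms in \<open>auto simp: in_keys_iff\<close>)

lemma pairing_zero [simp]: "pairing 0 \<phi> = 0"
  by (simp add: pairing_def)

lemma pairing_add: "pairing (X + Y) \<phi> = pairing X \<phi> + pairing Y \<phi>"
proof -
  let ?A = "Poly_Mapping.keys X \<union> Poly_Mapping.keys Y"
  have "Poly_Mapping.keys (X + Y) \<subseteq> ?A" by (rule keys_add)
  then show ?thesis
    by (simp add: pairing_superset[of ?A] lookup_add distrib_right sum.distrib)
qed

lemma pairing_minus: "pairing (X - Y) \<phi> = pairing X \<phi> - pairing Y \<phi>"
  using pairing_add[of "X - Y" Y \<phi>] by simp

lemma pairing_uminus: "pairing (- X) \<phi> = - pairing X \<phi>"
  using pairing_minus[of 0 X \<phi>] by simp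

lemma pairing_sum: "pairing (sum f A) \<phi> = (\<Sum>a \<in> A. pairing (f a) \<phi>)"
  by (induction A rule: infinite_finite_induct) (simp_all add: pairing_add)

lemma pairing_single [simp]: "pairing (Poly_Mapping.single a c) \<phi> = c * \<phi> a"
  by (simp add: pairing_def)

lemma keys_map_mult: "Poly_Mapping.keys (Poly_Mapping.map ((*) c) X) \<subseteq> Poly_Mapping.keys X"
  by (auto simp: in_keys_iff map.rep_eq when_def)

lemma pairing_map_mult: "pairing (Poly_Mapping.map ((*) c) X) \<phi> = c * pairing X \<phi>"
  using keys_map_mult[of c X]
  by (subst pairing_superset[of "Poly_Mapping.keys X"])
    (auto simp: pairing_def map.rep_eq when_def sum_distrib_left in_keys_iff intro!: sum.cong)

lemma pairing_lin_extend: "pairing (lin_extend f X) \<phi> = pairing X (\<lambda>a. pairing (f a) \<phi>)"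
  by (simp add: lin_extend_def pairing_sum pairing_map_mult) (simp add: pairing_def)

lemma keys_lin_extend:
  "Poly_Mapping.keys (lin_extend f X) \<subseteq> (\<Union>a \<in> Poly_Mapping.keys X. Poly_Mapping.keys (f a))"
  using keys_sum keys_map_mult unfolding lin_extend_def by fastforce

lemma pairing_cong:
  "(\<And>a. a \<in> Poly_Mapping.keys X \<Longrightarrow> \<phi> a = \<psi> a) \<Longrightarrow> pairing X \<phi> = pairing X \<psi>"
  by (simp add: pairing_def)

lemma pairing_fun_add: "pairing X (\<lambda>a. \<phi> a + \<psi> a) = pairing X \<phi> + pairing X \<psi>"
  by (simp add: pairing_def distrib_left sum.distrib)

lemma pairing_fun_scale: "pairing X (\<lambda>a. c * \<phi> a) = c * pairing X \<phi>"
  by (simp add: pairing_def sum_distrib_left mult.left_commute)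

lemma pairing_fun_sum: "pairing X (\<lambda>a. \<Sum>i\<in>I. \<phi> i a) = (\<Sum>i\<in>I. pairing X (\<phi> i))"
  unfolding pairing_def sum_distrib_left by (rule sum.swap)

lemma N_comb_eq_pairing: "N_comb \<G> \<nu> = pairing \<G> (\<lambda>G. real (N G \<nu>))"
  by (simp add: N_comb_def pairing_def)


section \<open>Dual graph derivatives\<close>

definition wf_decorated :: "('w, 'b) decorated \<Rightarrow> bool" where
  "wf_decorated D \<longleftrightarrow> finite_bigraph (fst D) \<and> snd D \<in> edges (fst D)"

text \<open>Invariance is required only at well-formed \<open>D\<close>: a relabelling that is
  injective on the vertex sets controls the edges only if these join vertices of the graph.\<close>

definition iso_invariant :: "(('w, 'b) decorated \<Rightarrow> real) \<Rightarrow> bool" where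
  "iso_invariant \<psi> \<longleftrightarrow> (\<forall>D D'. wf_decorated D \<longrightarrow> decorated_iso D D' \<longrightarrow> \<psi> D = \<psi> D')"

text \<open>\<open>zop\<close>, \<open>xop\<close> and \<open>yop\<close> are the transposes of
  \<open>deriv_z\<close>, \<open>deriv_x\<close> and \<open>- deriv_y\<close> with respect to
  \<open>pairing\<close>.\<close>

definition zop :: "(('w, 'b) decorated \<Rightarrow> real) \<Rightarrow> ('w, 'b) bigraph \<Rightarrow> real" where
  "zop \<psi> G = (\<Sum>e \<in> edges G. \<psi> (G, e))"

definition xop :: "(('w, 'b) decorated \<Rightarrow> real) \<Rightarrow> ('w, 'b) decorated \<Rightarrow> real" where
  "xop \<psi> = (\<lambda>(G, z). \<Sum>f \<in> {f \<in> edges G. f \<noteq> z \<and> snd f = snd z}.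
      \<psi> (glue_white (fst f) (fst z) G, z))"

text \<open>The sign of \<open>- deriv_y\<close> is part of \<open>yop\<close>.\<close>

definition yop :: "(('w, 'b) decorated \<Rightarrow> real) \<Rightarrow> ('w, 'b) decorated \<Rightarrow> real" where
  "yop \<psi> = (\<lambda>(G, z). - (\<Sum>f \<in> {f \<in> edges G. f \<noteq> z \<and> fst f = fst z}.
      \<psi> (glue_black (snd f) (snd z) G, z)))"

text \<open>The hypothesis of the theorem, tested against invariants of decorated graphs.\<close>

definition xy_balanced :: "(('w, 'b) bigraph \<Rightarrow>\<^sub>0 real) \<Rightarrow> bool" where
  "xy_balanced \<G> \<longleftrightarrow> (\<forall>\<psi> k. iso_invariant \<psi> \<longrightarrow>
     pairing \<G> (zop ((xop ^^ k) \<psi>)) = pairing \<G> (zop ((yop ^^ k) \<psi>)))"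

lemma finite_edges: "finite_bigraph G \<Longrightarrow> finite (edges G)"
  unfolding finite_bigraph_def by (meson finite_SigmaI finite_subset)

lemma glue_white_sel [simp]:
  "white (glue_white v' v G) = id(v' := v) ` white G"
  "black (glue_white v' v G) = black G"
  "edges (glue_white v' v G) = map_prod (id(v' := v)) id ` edges G"
  by (simp_all add: glue_white_def)

lemma glue_black_sel [simp]:
  "white (glue_black v' v G) = white G"
  "black (glue_black v' v G) = id(v' := v) ` black G"
  "edges (glue_black v' v G) = map_prod id (id(v' := v)) ` edges G"
  by (simp_all add: glue_black_def)

lemma map_prod_image_subset: "E \<subseteq> A \<times> B \<Longrightarrow> map_prod f g ` E \<subseteq> f ` A \<times> g ` B"
  by auto

lemma wf_glue_white:
  assumes "wf_decorated (G, z)" "f \<in> edges G" "f \<noteq> z" "snd f = snd z"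
  shows "wf_decorated (glue_white (fst f) (fst z) G, z)"
proof -
  have "z = map_prod (id(fst f := fst z)) id z"
    using assms(3,4) by (cases z) auto
  moreover have "z \<in> edges G" using assms(1) by (simp add: wf_decorated_def)
  ultimately have "z \<in> map_prod (id(fst f := fst z)) id ` edges G" by (rule image_eqI)
  moreover have "map_prod (id(fst f := fst z)) id ` edges G \<subseteq> (id(fst f := fst z) ` white G) \<times> black G"
    using map_prod_image_subset[of "edges G" "white G" "black G" "id(fst f := fst z)" id] assms(1)
    by (simp add: wf_decorated_def finite_bigraph_def)
  ultimately show ?thesis
    using assms(1) by (simp add: wf_decorated_def finite_bigraph_def)
qed

lemma wf_glue_black:
  assumes "wf_decorated (G, z)" "f \<in> edges G" "f \<noteq> z" "fst f = fst z"
  shows "wf_decorated (glue_black (snd f) (snd z) G, z)"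
proof -
  have "z = map_prod id (id(snd f := snd z)) z"
    using assms(3,4) by (cases z) auto
  moreover have "z \<in> edges G" using assms(1) by (simp add: wf_decorated_def)
  ultimately have "z \<in> map_prod id (id(snd f := snd z)) ` edges G" by (rule image_eqI)
  moreover have "map_prod id (id(snd f := snd z)) ` edges G \<subseteq> white G \<times> (id(snd f := snd z) ` black G)"
    using map_prod_image_subset[of "edges G" "white G" "black G" id "id(snd f := snd z)"] assms(1)
    by (simp add: wf_decorated_def finite_bigraph_def)
  ultimately show ?thesis
    using assms(1) by (simp add: wf_decorated_def finite_bigraph_def)
qed

text \<open>Gluing preserves well-formedness, so agreement on well-formed graphs suffices. The
  invariance of test functionals and the commutation rules below are known only there.\<close>

lemma xop_cong:
  assumes "\<And>D. wf_decorated D \<Longrightarrow> \<phi> D = \<psi> D" "wf_decorated D"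
  shows "xop \<phi> D = xop \<psi> D"
  using assms(2) by (cases D) (auto simp: xop_def intro!: sum.cong assms(1) dest: wf_glue_white)

lemma yop_cong:
  assumes "\<And>D. wf_decorated D \<Longrightarrow> \<phi> D = \<psi> D" "wf_decorated D"
  shows "yop \<phi> D = yop \<psi> D"
  using assms(2) by (cases D) (auto simp: yop_def intro!: sum.cong assms(1) dest: wf_glue_black)

lemma xop_pow_cong:
  assumes "\<And>D. wf_decorated D \<Longrightarrow> \<phi> D = \<psi> D" "wf_decorated D"
  shows "(xop ^^ k) \<phi> D = (xop ^^ k) \<psi> D"
  using assms(2) by (induction k arbitrary: D) (auto intro: assms(1) xop_cong)

lemma yop_pow_cong:
  assumes "\<And>D. wf_decorated D \<Longrightarrow> \<phi> D = \<psi> D" "wf_decorated D"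
  shows "(yop ^^ k) \<phi> D = (yop ^^ k) \<psi> D"
  using assms(2) by (induction k arbitrary: D) (auto intro: assms(1) yop_cong)

lemma zop_cong:
  assumes "\<And>D. wf_decorated D \<Longrightarrow> \<phi> D = \<psi> D" "finite_bigraph G"
  shows "zop \<phi> G = zop \<psi> G"
  unfolding zop_def using assms by (auto intro!: sum.cong simp: wf_decorated_def)

lemma pairing_deriv_z: "pairing (deriv_z X) \<psi> = pairing X (zop \<psi>)"
  by (simp add: deriv_z_def pairing_lin_extend pairing_sum zop_def[abs_def])

lemma pairing_deriv_x: "pairing (deriv_x X) \<psi> = pairing X (xop \<psi>)"
  by (simp add: deriv_x_def pairing_lin_extend xop_def split_def pairing_sum)

lemma pairing_deriv_y: "pairing (- deriv_y X) \<psi> = pairing X (yop \<psi>)"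
  by (simp add: deriv_y_def pairing_uminus pairing_lin_extend yop_def split_def pairing_sum)
    (simp add: pairing_def sum_negf)

lemma pairing_deriv_x_pow: "pairing ((deriv_x ^^ k) X) \<psi> = pairing X ((xop ^^ k) \<psi>)"
  by (induction k arbitrary: \<psi>) (simp_all add: pairing_deriv_x funpow_swap1[of xop])

lemma pairing_deriv_y_pow:
  "pairing (((\<lambda>X. - deriv_y X) ^^ k) X) \<psi> = pairing X ((yop ^^ k) \<psi>)"
  by (induction k arbitrary: \<psi>) (simp_all add: pairing_deriv_y funpow_swap1[of yop])

lemma decorated_iso_refl: "decorated_iso D D"
  unfolding decorated_iso_def
  by (intro exI[of _ id]) (auto simp: map_prod.id)

text \<open>An invariant descends to isomorphism classes by evaluation at a representative.\<close>

lemma xy_balancedI: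
  fixes \<G> :: "('w, 'b) bigraph \<Rightarrow>\<^sub>0 real"
  assumes graphs: "\<And>G. G \<in> Poly_Mapping.keys \<G> \<Longrightarrow> finite_bigraph G"
    and deriv: "\<And>k :: nat. k > 0 \<Longrightarrow>
      unlabelled ((deriv_x ^^ k) (deriv_z \<G>) - ((\<lambda>X. - deriv_y X) ^^ k) (deriv_z \<G>)) = 0"
  shows "xy_balanced \<G>"
  unfolding xy_balanced_def
proof (intro allI impI)
  fix \<psi> :: "('w, 'b) decorated \<Rightarrow> real" and k :: nat
  assume inv: "iso_invariant \<psi>"
  define rep where "rep = (\<lambda>D :: ('w, 'b) decorated. SOME D'. D' \<in> {D'. decorated_iso D D'})"
  define \<psi>' where "\<psi>' = (\<lambda>D. \<psi> (rep D))"
  have "decorated_iso D (rep D)" for D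
    unfolding rep_def using someI[of "\<lambda>D'. D' \<in> {D'. decorated_iso D D'}" D] decorated_iso_refl[of D]
    by simp
  \<comment> \<open>\<open>\<psi>'\<close> may differ from \<open>\<psi>\<close> on ill-formed
    graphs, but the iterated derivatives of \<open>\<G>\<close> never meet those.\<close>
  then have eq: "\<psi>' D = \<psi> D" if "wf_decorated D" for D
    using inv that unfolding \<psi>'_def iso_invariant_def by metis
  have un: "pairing (unlabelled X) (\<lambda>C. \<psi> (SOME D'. D' \<in> C)) = pairing X \<psi>'" for X
    by (simp add: unlabelled_def pairing_lin_extend \<psi>'_def rep_def)
  show "pairing \<G> (zop ((xop ^^ k) \<psi>)) = pairing \<G> (zop ((yop ^^ k) \<psi>))"
  proof (cases "k = 0")
    case False
    have "pairing ((deriv_x ^^ k) (deriv_z \<G>) - ((\<lambda>X. - deriv_y X) ^^ k) (deriv_z \<G>)) \<psi>' = 0"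
      using False by (simp add: un[symmetric] deriv del: funpow.simps)
    then have "pairing \<G> (zop ((xop ^^ k) \<psi>')) = pairing \<G> (zop ((yop ^^ k) \<psi>'))"
      by (simp add: pairing_minus pairing_deriv_x_pow pairing_deriv_y_pow pairing_deriv_z)
    moreover have "pairing \<G> (zop ((xop ^^ k) \<psi>')) = pairing \<G> (zop ((xop ^^ k) \<psi>))"
      by (intro pairing_cong zop_cong xop_pow_cong eq graphs)
    moreover have "pairing \<G> (zop ((yop ^^ k) \<psi>')) = pairing \<G> (zop ((yop ^^ k) \<psi>))"
      by (intro pairing_cong zop_cong yop_pow_cong eq graphs)
    ultimately show ?thesis by simp
  qed simp
qed


section \<open>Relabelling\<close>

definition relabel :: "('w \<Rightarrow> 'v) \<Rightarrow> ('b \<Rightarrow> 'c) \<Rightarrow> ('w, 'b) bigraph \<Rightarrow> ('v, 'c) bigraph" where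
  "relabel f g G = Bigraph (f ` white G) (g ` black G) (map_prod f g ` edges G)"

lemma relabel_sel [simp]:
  "white (relabel f g G) = f ` white G"
  "black (relabel f g G) = g ` black G"
  "edges (relabel f g G) = map_prod f g ` edges G"
  by (simp_all add: relabel_def)

lemma iso_invariantI:
  assumes "\<And>G z f g. wf_decorated (G, z) \<Longrightarrow> inj_on f (white G) \<Longrightarrow> inj_on g (black G)
    \<Longrightarrow> \<psi> (relabel f g G, map_prod f g z) = \<psi> (G, z)"
  shows "iso_invariant \<psi>"
  unfolding iso_invariant_def
proof (intro allI impI)
  fix D D' :: "('a, 'b) decorated"
  assume wf: "wf_decorated D" and "decorated_iso D D'"
  then obtain f g where fg: "bij_betw f (white (fst D)) (white (fst D'))"
    "bij_betw g (black (fst D)) (black (fst D'))"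
    "map_prod f g ` edges (fst D) = edges (fst D')" "map_prod f g (snd D) = snd D'"
    unfolding decorated_iso_def by blast
  obtain G z where D: "D = (G, z)" by (cases D)
  have "D' = (relabel f g G, map_prod f g z)"
    using fg unfolding D by (cases D', cases "fst D'") (auto simp: relabel_def bij_betw_def)
  then show "\<psi> D = \<psi> D'"
    using assms[of G z f g] wf fg by (simp add: D bij_betw_def)
qed

lemma iso_invariantD:
  assumes "iso_invariant \<psi>" "wf_decorated (G, z)" "inj_on f (white G)" "inj_on g (black G)"
  shows "\<psi> (relabel f g G, map_prod f g z) = \<psi> (G, z)"
proof -
  have "decorated_iso (G, z) (relabel f g G, map_prod f g z)"
    unfolding decorated_iso_def using assms(3,4)
    by (intro exI[of _ f] exI[of _ g]) (simp add: bij_betw_def)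
  then show ?thesis using assms(1,2) unfolding iso_invariant_def by metis
qed


section \<open>Reduction to graphs with a fixed number of vertices\<close>

section \<open>Gradings\<close>

text \<open>Absence of isolated vertices. Only such graphs enter the graded parts; all other finite
  graphs have \<open>N\<close> equal to 0.\<close>

definition spanned :: "('w, 'b) bigraph \<Rightarrow> bool" where
  "spanned G \<longleftrightarrow> white G = fst ` edges G \<and> black G = snd ` edges G"

definition vertex_count :: "('w, 'b) bigraph \<Rightarrow> nat" where
  "vertex_count G = card (white G) + card (black G)"

text \<open>Degrees are integers because \<open>k\<close>-fold gluing is dual to a shift of the degree by \<open>- k\<close>.\<close>

definition graded :: "int \<Rightarrow> ('w, 'b) bigraph \<Rightarrow> bool" where
  "graded m G \<longleftrightarrow> spanned G \<and> int (vertex_count G) = m"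

definition only_graded :: "int \<Rightarrow> (('w, 'b) decorated \<Rightarrow> real) \<Rightarrow> ('w, 'b) decorated \<Rightarrow> real" where
  "only_graded m \<psi> D = (if graded m (fst D) then \<psi> D else 0)"

lemma merge_image:
  assumes "a \<in> A" "a' \<in> A" "a \<noteq> a'"
  shows "id(a' := a) ` A = A - {a'}"
  using assms by auto

lemma merge_image_eq_iff:
  assumes "B \<subseteq> A" "a \<in> B" "a' \<in> B" "a \<noteq> a'"
  shows "id(a' := a) ` A = id(a' := a) ` B \<longleftrightarrow> A = B"
  using assms by (subst (1 2) merge_image) auto

text \<open>Gluing removes \<open>u\<close> both from the white vertices and from the white ends of
  edges. It therefore neither creates nor destroys isolated vertices, and the equivalence holds in
  both directions.\<close>

lemma graded_glue_white:
  assumes "finite_bigraph G" "(v, b) \<in> edges G" "(u, b) \<in> edges G" "u \<noteq> v"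
  shows "graded m (glue_white u v G) \<longleftrightarrow> graded (m + 1) G"
proof -
  have 1: "fst ` edges G \<subseteq> white G" "v \<in> fst ` edges G" "u \<in> fst ` edges G" "finite (white G)"
    using assms by (force simp: finite_bigraph_def)+
  have "spanned (glue_white u v G) \<longleftrightarrow> spanned G"
    using merge_image_eq_iff[OF 1(1-3)] assms(4)
    by (simp add: spanned_def image_image del: fun_upd_apply)
  moreover have "int (vertex_count (glue_white u v G)) = int (vertex_count G) - 1"
  proof -
    have "id(u := v) ` white G = white G - {u}"
      using 1 assms(4) by (intro merge_image) auto
    moreover have "card (white G) > 0" using 1 by (auto simp: card_gt_0_iff)
    moreover have "u \<in> white G" using 1 by blast
    ultimately show ?thesis
      by (simp add: vertex_count_def of_nat_diff Suc_leI del: fun_upd_apply)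
  qed
  ultimately show ?thesis by (auto simp: graded_def)
qed

lemma graded_glue_black:
  assumes "finite_bigraph G" "(v, b) \<in> edges G" "(v, c) \<in> edges G" "c \<noteq> b"
  shows "graded m (glue_black c b G) \<longleftrightarrow> graded (m + 1) G"
proof -
  have 1: "snd ` edges G \<subseteq> black G" "b \<in> snd ` edges G" "c \<in> snd ` edges G" "finite (black G)"
    using assms by (force simp: finite_bigraph_def)+
  have "spanned (glue_black c b G) \<longleftrightarrow> spanned G"
    using merge_image_eq_iff[OF 1(1-3)] assms(4)
    by (simp add: spanned_def image_image del: fun_upd_apply)
  moreover have "int (vertex_count (glue_black c b G)) = int (vertex_count G) - 1"
  proof -
    have "id(c := b) ` black G = black G - {c}"
      using 1 assms(4) by (intro merge_image) auto
    moreover have "card (black G) > 0" using 1 by (auto simp: card_gt_0_iff)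
    moreover have "c \<in> black G" using 1 by blast
    ultimately show ?thesis
      by (simp add: vertex_count_def of_nat_diff Suc_leI del: fun_upd_apply)
  qed
  ultimately show ?thesis by (auto simp: graded_def)
qed

lemma xop_only_graded:
  assumes "wf_decorated D"
  shows "xop (only_graded m \<psi>) D = only_graded (m + 1) (xop \<psi>) D"
proof -
  obtain G v b where D: "D = (G, (v, b))" by (metis prod.exhaust)
  have "graded m (glue_white (fst f) v G) \<longleftrightarrow> graded (m + 1) G"
    if "f \<in> {f \<in> edges G. f \<noteq> (v, b) \<and> snd f = b}" for f
    using assms that by (cases f, intro graded_glue_white[of G v b]) (auto simp: D wf_decorated_def)
  then have "xop (only_graded m \<psi>) D = (\<Sum>f \<in> {f \<in> edges G. f \<noteq> (v, b) \<and> snd f = b}.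
      if graded (m + 1) G then \<psi> (glue_white (fst f) v G, (v, b)) else 0)"
    unfolding D xop_def only_graded_def prod.case fst_conv snd_conv by (intro sum.cong) simp_all
  then show ?thesis
    by (simp add: D xop_def only_graded_def)
qed

lemma yop_only_graded:
  assumes "wf_decorated D"
  shows "yop (only_graded m \<psi>) D = only_graded (m + 1) (yop \<psi>) D"
proof -
  obtain G v b where D: "D = (G, (v, b))" by (metis prod.exhaust)
  have "graded m (glue_black (snd f) b G) \<longleftrightarrow> graded (m + 1) G"
    if "f \<in> {f \<in> edges G. f \<noteq> (v, b) \<and> fst f = v}" for f
    using assms that by (cases f, intro graded_glue_black[of G v b]) (auto simp: D wf_decorated_def)
  then have "yop (only_graded m \<psi>) D = - (\<Sum>f \<in> {f \<in> edges G. f \<noteq> (v, b) \<and> fst f = v}.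
      if graded (m + 1) G then \<psi> (glue_black (snd f) b G, (v, b)) else 0)"
    unfolding D yop_def only_graded_def prod.case fst_conv snd_conv
    by (intro arg_cong[of _ _ uminus] sum.cong) simp_all
  then show ?thesis
    by (simp add: D yop_def only_graded_def)
qed

lemma xop_pow_only_graded:
  assumes "wf_decorated D"
  shows "(xop ^^ k) (only_graded m \<psi>) D = only_graded (m + int k) ((xop ^^ k) \<psi>) D"
  using assms
proof (induction k arbitrary: D)
  case (Suc k)
  have "xop ((xop ^^ k) (only_graded m \<psi>)) D = xop (only_graded (m + int k) ((xop ^^ k) \<psi>)) D"
    by (intro xop_cong Suc)
  also have "\<dots> = only_graded (m + int k + 1) (xop ((xop ^^ k) \<psi>)) D"
    by (intro xop_only_graded Suc)
  finally show ?case by (simp add: ac_simps)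
qed simp

lemma yop_pow_only_graded:
  assumes "wf_decorated D"
  shows "(yop ^^ k) (only_graded m \<psi>) D = only_graded (m + int k) ((yop ^^ k) \<psi>) D"
  using assms
proof (induction k arbitrary: D)
  case (Suc k)
  have "yop ((yop ^^ k) (only_graded m \<psi>)) D = yop (only_graded (m + int k) ((yop ^^ k) \<psi>)) D"
    by (intro yop_cong Suc)
  also have "\<dots> = only_graded (m + int k + 1) (yop ((yop ^^ k) \<psi>)) D"
    by (intro yop_only_graded Suc)
  finally show ?case by (simp add: ac_simps)
qed simp

lemma graded_relabel:
  assumes "finite_bigraph G" "inj_on f (white G)" "inj_on g (black G)"
  shows "graded m (relabel f g G) \<longleftrightarrow> graded m G"
proof -
  have sub: "fst ` edges G \<subseteq> white G" "snd ` edges G \<subseteq> black G"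
    using assms(1) by (force simp: finite_bigraph_def)+
  have "spanned (relabel f g G) \<longleftrightarrow> f ` white G = f ` fst ` edges G \<and> g ` black G = g ` snd ` edges G"
    by (simp add: spanned_def image_image)
  also have "\<dots> \<longleftrightarrow> spanned G"
    unfolding spanned_def using sub assms(2,3) by (simp add: inj_on_image_eq_iff)
  finally show ?thesis
    using assms(2,3) by (simp add: graded_def vertex_count_def card_image)
qed

lemma iso_invariant_only_graded:
  assumes "iso_invariant \<psi>"
  shows "iso_invariant (only_graded m \<psi>)"
proof (rule iso_invariantI)
  fix G :: "('a, 'b) bigraph" and z and f :: "'a \<Rightarrow> 'a" and g :: "'b \<Rightarrow> 'b"
  assume *: "wf_decorated (G, z)" "inj_on f (white G)" "inj_on g (black G)"
  then show "only_graded m \<psi> (relabel f g G, map_prod f g z) = only_graded m \<psi> (G, z)"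
    using iso_invariantD[OF assms *] graded_relabel[of G f g m]
    by (simp add: only_graded_def wf_decorated_def)
qed

definition graded_part :: "int \<Rightarrow> (('w, 'b) bigraph \<Rightarrow>\<^sub>0 real) \<Rightarrow> (('w, 'b) bigraph \<Rightarrow>\<^sub>0 real)" where
  "graded_part m = lin_extend (\<lambda>G. if graded m G then Poly_Mapping.single G 1 else 0)"

lemma pairing_graded_part:
  "pairing (graded_part m X) \<phi> = pairing X (\<lambda>G. if graded m G then \<phi> G else 0)"
  by (simp add: graded_part_def pairing_lin_extend if_distribR cong: if_cong)
    (intro pairing_cong, simp)

lemma keys_graded_part: "G \<in> Poly_Mapping.keys (graded_part m X) \<Longrightarrow> G \<in> Poly_Mapping.keys X \<and> graded m G"
  using keys_lin_extend unfolding graded_part_def by (fastforce split: if_splits)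

lemma xy_balanced_graded_part:
  assumes graphs: "\<And>G. G \<in> Poly_Mapping.keys \<G> \<Longrightarrow> finite_bigraph G" and bal: "xy_balanced \<G>"
  shows "xy_balanced (graded_part m \<G>)"
  unfolding xy_balanced_def
proof (intro allI impI)
  fix \<psi> :: "('a, 'b) decorated \<Rightarrow> real" and k :: nat
  assume inv: "iso_invariant \<psi>"
  \<comment> \<open>\<open>k\<close> gluings take degree \<open>m\<close> to degree
    \<open>m - k\<close>, so restricting the test functional to that degree selects exactly the part
    that had degree \<open>m\<close> before gluing.\<close>
  let ?\<psi> = "only_graded (m - int k) \<psi>"
  have x: "pairing (graded_part m \<G>) (zop ((xop ^^ k) \<psi>)) = pairing \<G> (zop ((xop ^^ k) ?\<psi>))"
    unfolding pairing_graded_part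
  proof (rule pairing_cong)
    fix G assume "G \<in> Poly_Mapping.keys \<G>"
    then have "zop ((xop ^^ k) ?\<psi>) G = zop (only_graded m ((xop ^^ k) \<psi>)) G"
      by (intro zop_cong graphs) (auto simp: xop_pow_only_graded)
    then show "(if graded m G then zop ((xop ^^ k) \<psi>) G else 0) = zop ((xop ^^ k) ?\<psi>) G"
      by (simp add: zop_def only_graded_def)
  qed
  have y: "pairing (graded_part m \<G>) (zop ((yop ^^ k) \<psi>)) = pairing \<G> (zop ((yop ^^ k) ?\<psi>))"
    unfolding pairing_graded_part
  proof (rule pairing_cong)
    fix G assume "G \<in> Poly_Mapping.keys \<G>"
    then have "zop ((yop ^^ k) ?\<psi>) G = zop (only_graded m ((yop ^^ k) \<psi>)) G"
      by (intro zop_cong graphs) (auto simp: yop_pow_only_graded)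
    then show "(if graded m G then zop ((yop ^^ k) \<psi>) G else 0) = zop ((yop ^^ k) ?\<psi>) G"
      by (simp add: zop_def only_graded_def)
  qed
  show "pairing (graded_part m \<G>) (zop ((xop ^^ k) \<psi>)) = pairing (graded_part m \<G>) (zop ((yop ^^ k) \<psi>))"
    unfolding x y using bal iso_invariant_only_graded[OF inv] by (simp add: xy_balanced_def)
qed


section \<open>Stripping preserves the hypothesis\<close>

section \<open>Stripping a black vertex with its leaves\<close>

lemma edge_glue_white:
  assumes "u \<noteq> v"
  shows "(x, c) \<in> map_prod (id(u := v)) id ` E \<longleftrightarrow> x \<noteq> u \<and> ((x, c) \<in> E \<or> x = v \<and> (u, c) \<in> E)"
proof
  assume "(x, c) \<in> map_prod (id(u := v)) id ` E"
  then obtain y where "(y, c) \<in> E" "x = (id(u := v)) y" by auto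
  then show "x \<noteq> u \<and> ((x, c) \<in> E \<or> x = v \<and> (u, c) \<in> E)"
    using assms by (cases "y = u") auto
next
  assume "x \<noteq> u \<and> ((x, c) \<in> E \<or> x = v \<and> (u, c) \<in> E)"
  then have "(x, c) = map_prod (id(u := v)) id (x, c) \<and> (x, c) \<in> E \<or>
      (x, c) = map_prod (id(u := v)) id (u, c) \<and> (u, c) \<in> E"
    by auto
  then show "(x, c) \<in> map_prod (id(u := v)) id ` E" by (metis imageI)
qed

lemma edge_glue_black:
  assumes "c \<noteq> b"
  shows "(x, y) \<in> map_prod id (id(c := b)) ` E \<longleftrightarrow> y \<noteq> c \<and> ((x, y) \<in> E \<or> y = b \<and> (x, c) \<in> E)"
proof
  assume "(x, y) \<in> map_prod id (id(c := b)) ` E"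
  then obtain z where "(x, z) \<in> E" "y = (id(c := b)) z" by auto
  then show "y \<noteq> c \<and> ((x, y) \<in> E \<or> y = b \<and> (x, c) \<in> E)"
    using assms by (cases "z = c") auto
next
  assume "y \<noteq> c \<and> ((x, y) \<in> E \<or> y = b \<and> (x, c) \<in> E)"
  then have "(x, y) = map_prod id (id(c := b)) (x, y) \<and> (x, y) \<in> E \<or>
      (x, y) = map_prod id (id(c := b)) (x, c) \<and> (x, c) \<in> E"
    by auto
  then show "(x, y) \<in> map_prod id (id(c := b)) ` E" by (metis imageI)
qed

definition leaves :: "('w, 'b) bigraph \<Rightarrow> 'b \<Rightarrow> 'w set" where
  "leaves G w = {u. (u, w) \<in> edges G \<and> (\<forall>b. (u, b) \<in> edges G \<longrightarrow> b = w)}"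

definition strip :: "'b \<Rightarrow> ('w, 'b) bigraph \<Rightarrow> ('w, 'b) bigraph" where
  "strip w G = Bigraph (white G - leaves G w) (black G - {w}) {e \<in> edges G. snd e \<noteq> w}"

lemma strip_sel [simp]:
  "white (strip w G) = white G - leaves G w"
  "black (strip w G) = black G - {w}"
  "edges (strip w G) = {e \<in> edges G. snd e \<noteq> w}"
  by (simp_all add: strip_def)

text \<open>
  If \<open>x\<close> lies to the right of the whole diagram and \<open>z\<close> is an edge placed at the point \<open>(x, 0)\<close>,
  then the white end of \<open>z\<close> must be a leaf, and each other leaf at the black end \<open>w\<close> can be
  colored in \<open>x\<close> ways. Hence a vertex \<open>w\<close> with \<open>k + 1\<close> leaves contributes
  \<open>(k + 1) x ^ k\<close> times the number of colorings of the stripped graph.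
\<close>

definition strip_op :: "nat \<Rightarrow> (('w, 'b) bigraph \<Rightarrow> real) \<Rightarrow> ('w, 'b) bigraph \<Rightarrow> real" where
  "strip_op k \<phi> G =
     (\<Sum>w \<in> {w \<in> black G. card (leaves G w) = Suc k}. real (Suc k) * \<phi> (strip w G))"

definition strip_decorated_op ::
    "nat \<Rightarrow> (('w, 'b) decorated \<Rightarrow> real) \<Rightarrow> ('w, 'b) decorated \<Rightarrow> real" where
  "strip_decorated_op k \<psi> = (\<lambda>(G, z). \<Sum>w \<in> {w \<in> black G. w \<noteq> snd z \<and> card (leaves G w) = Suc k}.
     real (Suc k) * \<psi> (strip w G, z))"

definition strip_comb :: "nat \<Rightarrow> (('w, 'b) bigraph \<Rightarrow>\<^sub>0 real) \<Rightarrow> (('w, 'b) bigraph \<Rightarrow>\<^sub>0 real)" where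
  "strip_comb k = lin_extend (\<lambda>G. \<Sum>w \<in> {w \<in> black G. card (leaves G w) = Suc k}.
     Poly_Mapping.single (strip w G) (real (Suc k)))"

lemma pairing_strip_comb: "pairing (strip_comb k X) \<phi> = pairing X (strip_op k \<phi>)"
  by (simp add: strip_comb_def pairing_lin_extend pairing_sum strip_op_def[abs_def])

lemma leaves_subset: "finite_bigraph G \<Longrightarrow> leaves G w \<subseteq> white G"
  by (auto simp: leaves_def finite_bigraph_def)

lemma finite_strip: "finite_bigraph G \<Longrightarrow> finite_bigraph (strip w G)"
  by (auto simp: finite_bigraph_def leaves_def)

lemma wf_strip: "wf_decorated (G, z) \<Longrightarrow> w \<noteq> snd z \<Longrightarrow> wf_decorated (strip w G, z)"
  by (auto simp: wf_decorated_def finite_strip)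

text \<open>A neighbour of \<open>w\<close> that is no leaf keeps another edge, and black vertices
  other than \<open>w\<close> keep all their edges. So no isolated vertices arise; this is why the
  leaves are removed along with \<open>w\<close>.\<close>

lemma graded_strip:
  assumes "finite_bigraph G" "graded m G" "w \<in> black G"
  shows "graded (m - 1 - int (card (leaves G w))) (strip w G)"
proof -
  have sp: "white G = fst ` edges G" "black G = snd ` edges G"
    using assms(2) by (auto simp: graded_def spanned_def)
  have "spanned (strip w G)"
    unfolding spanned_def
  proof
    show "white (strip w G) = fst ` edges (strip w G)"
    proof (intro set_eqI)
      fix x
      have "x \<in> fst ` edges (strip w G) \<longleftrightarrow> (\<exists>b. (x, b) \<in> edges G \<and> b \<noteq> w)" by force
      moreover have "x \<in> white G \<longleftrightarrow> (\<exists>b. (x, b) \<in> edges G)" unfolding sp by force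
      ultimately show "x \<in> white (strip w G) \<longleftrightarrow> x \<in> fst ` edges (strip w G)"
        by (auto simp: leaves_def)
    qed
    show "black (strip w G) = snd ` edges (strip w G)"
      unfolding strip_sel sp(2) by force
  qed
  moreover have fin: "finite (white G)" "finite (black G)"
    using assms(1) by (auto simp: finite_bigraph_def)
  have "card (white G) = card (white (strip w G)) + card (leaves G w)"
    using leaves_subset[OF assms(1), of w] fin(1)
    by (simp add: card_Diff_subset card_mono finite_subset)
  moreover have "card (black G) = card (black (strip w G)) + 1"
    using fin(2) assms(3) card_gt_0_iff[of "black G"] by auto
  ultimately show ?thesis
    using assms(2) by (simp add: graded_def vertex_count_def)
qed

lemma keys_strip_comb:
  assumes "\<And>G. G \<in> Poly_Mapping.keys X \<Longrightarrow> finite_bigraph G \<and> graded m G"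
    and "G' \<in> Poly_Mapping.keys (strip_comb k X)"
  shows "finite_bigraph G' \<and> graded (m - 2 - int k) G'"
proof -
  let ?W = "\<lambda>G. {w \<in> black G. card (leaves G w) = Suc k}"
  obtain G where G: "G \<in> Poly_Mapping.keys X"
    "G' \<in> Poly_Mapping.keys (\<Sum>w \<in> ?W G. Poly_Mapping.single (strip w G) (real (Suc k)))"
    using assms(2) keys_lin_extend unfolding strip_comb_def by fast
  then obtain w where "w \<in> ?W G" "G' = strip w G"
    using keys_sum by (fastforce split: if_splits)
  then show ?thesis
    using assms(1)[OF G(1)] graded_strip[of G m w] finite_strip[of G w]
    by (auto simp: algebra_simps)
qed

text \<open>Both sides range over pairs of an edge and a strippable black vertex not on it. The
  exclusion of \<open>snd z\<close> in \<open>strip_decorated_op\<close> is made for this.\<close>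

lemma zop_strip:
  assumes "finite_bigraph G"
  shows "zop (strip_decorated_op k \<psi>) G = strip_op k (zop \<psi>) G"
proof -
  let ?W = "{w \<in> black G. card (leaves G w) = Suc k}"
  have fin: "finite (edges G)" "finite ?W"
    using assms finite_edges by (auto simp: finite_bigraph_def)
  have "zop (strip_decorated_op k \<psi>) G =
      (\<Sum>e\<in>edges G. \<Sum>w\<in>{w \<in> ?W. snd e \<noteq> w}. real (Suc k) * \<psi> (strip w G, e))"
    unfolding zop_def strip_decorated_op_def prod.case by (intro sum.cong) auto
  also have "\<dots> = (\<Sum>w\<in>?W. \<Sum>e\<in>{e \<in> edges G. snd e \<noteq> w}. real (Suc k) * \<psi> (strip w G, e))"
    by (rule sum.swap_restrict[OF fin])
  finally show ?thesis
    by (simp add: strip_op_def zop_def sum_distrib_left)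
qed

text \<open>Two glued white vertices are both joined to \<open>b\<close>, hence are leaves of no
  other black vertex. Gluing them leaves the leaves at such a vertex unchanged.\<close>

lemma xop_strip:
  assumes "wf_decorated D"
  shows "xop (strip_decorated_op k \<psi>) D = strip_decorated_op k (xop \<psi>) D"
proof -
  obtain G v b where D: "D = (G, (v, b))" by (metis prod.exhaust)
  have vb: "(v, b) \<in> edges G" using assms by (simp add: D wf_decorated_def)
  let ?F = "{f \<in> edges G. f \<noteq> (v, b) \<and> snd f = b}"
  let ?W = "{w \<in> black G. w \<noteq> b \<and> card (leaves G w) = Suc k}"
  have lv: "leaves (glue_white u v G) w = leaves G w" if "(u, b) \<in> edges G" "u \<noteq> v" "w \<noteq> b" for u w
    using that vb unfolding leaves_def glue_white_sel edge_glue_white[OF that(2)] by blast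
  have st: "strip w (glue_white u v G) = glue_white u v (strip w G)"
    if "(u, b) \<in> edges G" "u \<noteq> v" "w \<noteq> b" for u w
  proof -
    have "u \<notin> leaves G w" "v \<notin> leaves G w"
      using that vb by (auto simp: leaves_def)
    then have "id(u := v) ` (white G - leaves G w) = id(u := v) ` white G - leaves G w"
      by (auto simp: image_iff)
    moreover have "map_prod (id(u := v)) id ` {e \<in> edges G. snd e \<noteq> w} =
        {e \<in> map_prod (id(u := v)) id ` edges G. snd e \<noteq> w}"
      by (intro set_eqI) (auto simp: edge_glue_white[OF that(2)] simp del: fun_upd_apply)
    ultimately show ?thesis
      unfolding strip_def[of w "glue_white u v G"] lv[OF that] by (simp add: glue_white_def)
  qed
  have "xop (strip_decorated_op k \<psi>) D =
      (\<Sum>f\<in>?F. \<Sum>w\<in>?W. real (Suc k) * \<psi> (glue_white (fst f) v (strip w G), (v, b)))"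
    unfolding D xop_def strip_decorated_op_def prod.case fst_conv snd_conv
  proof (intro sum.cong)
    fix f w assume "f \<in> ?F"
    then have f: "(fst f, b) \<in> edges G" "fst f \<noteq> v" by (auto simp: prod_eq_iff)
    then show "{w \<in> black (glue_white (fst f) v G). w \<noteq> b \<and>
        card (leaves (glue_white (fst f) v G) w) = Suc k} = ?W"
      by (auto simp: lv)
    show "real (Suc k) * \<psi> (strip w (glue_white (fst f) v G), v, b) =
        real (Suc k) * \<psi> (glue_white (fst f) v (strip w G), v, b)" if "w \<in> ?W"
      using that by (simp add: st[OF f])
  qed simp
  also have "\<dots> = (\<Sum>w\<in>?W. \<Sum>f\<in>?F. real (Suc k) * \<psi> (glue_white (fst f) v (strip w G), (v, b)))"
    by (rule sum.swap)
  also have "\<dots> = strip_decorated_op k (xop \<psi>) D"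
    unfolding D xop_def strip_decorated_op_def prod.case sum_distrib_left
    by (intro sum.cong refl) auto
  finally show ?thesis .
qed

text \<open>Renaming \<open>c\<close> to \<open>b\<close> does not affect which edges end at a third
  vertex \<open>w\<close>, so the leaves at \<open>w\<close> are unchanged. The case
  \<open>w = c\<close> is absent from both orders: after gluing, \<open>c\<close> is gone; after
  stripping \<open>c\<close>, the edge to be glued is gone.\<close>

lemma yop_strip:
  assumes "wf_decorated D"
  shows "yop (strip_decorated_op k \<psi>) D = strip_decorated_op k (yop \<psi>) D"
proof -
  obtain G v b where D: "D = (G, (v, b))" by (metis prod.exhaust)
  have vb: "(v, b) \<in> edges G" and G: "finite_bigraph G"
    using assms by (simp_all add: D wf_decorated_def)
  let ?F = "{f \<in> edges G. f \<noteq> (v, b) \<and> fst f = v}"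
  let ?W = "{w \<in> black G. w \<noteq> b \<and> card (leaves G w) = Suc k}"
  have fin: "finite ?F" "finite ?W"
    using G finite_edges[OF G] by (auto simp: finite_bigraph_def)
  have lv: "leaves (glue_black c b G) w = leaves G w" if "w \<noteq> b" "w \<noteq> c" "c \<noteq> b" for c w
  proof -
    have "(x, y) \<in> edges (glue_black c b G) \<longrightarrow> y = w"
      if "\<forall>y. (x, y) \<in> edges G \<longrightarrow> y = w" for x y
      using that \<open>w \<noteq> c\<close> by (auto simp: edge_glue_black[OF \<open>c \<noteq> b\<close>] simp del: fun_upd_apply)
    moreover have "(x, y) \<in> edges G \<longrightarrow> y = w"
      if "\<forall>y. (x, y) \<in> edges (glue_black c b G) \<longrightarrow> y = w" for x y
      using that \<open>w \<noteq> b\<close> \<open>c \<noteq> b\<close> unfolding glue_black_sel edge_glue_black[OF \<open>c \<noteq> b\<close>] by metis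
    moreover have "(x, w) \<in> edges (glue_black c b G) \<longleftrightarrow> (x, w) \<in> edges G" for x
      using that(1,2) unfolding glue_black_sel edge_glue_black[OF \<open>c \<noteq> b\<close>] by simp
    ultimately show ?thesis unfolding leaves_def by (intro Collect_cong) metis
  qed
  have st: "strip w (glue_black c b G) = glue_black c b (strip w G)"
    if "w \<noteq> b" "w \<noteq> c" "c \<noteq> b" for c w
  proof -
    have "id(c := b) ` (black G - {w}) = id(c := b) ` black G - {w}"
      using that by auto
    moreover have "map_prod id (id(c := b)) ` {e \<in> edges G. snd e \<noteq> w} =
        {e \<in> map_prod id (id(c := b)) ` edges G. snd e \<noteq> w}"
    proof (intro set_eqI)
      fix e :: "'a \<times> 'b"
      obtain x y where e: "e = (x, y)" by (cases e)
      show "e \<in> map_prod id (id(c := b)) ` {e \<in> edges G. snd e \<noteq> w} \<longleftrightarrow>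
          e \<in> {e \<in> map_prod id (id(c := b)) ` edges G. snd e \<noteq> w}"
        unfolding e mem_Collect_eq edge_glue_black[OF that(3)] snd_conv using that by blast
    qed
    ultimately show ?thesis
      unfolding strip_def[of w "glue_black c b G"] lv[OF that] by (simp add: glue_black_def)
  qed
  have "yop (strip_decorated_op k \<psi>) D =
      - (\<Sum>f\<in>?F. \<Sum>w\<in>{w \<in> ?W. snd f \<noteq> w}.
          real (Suc k) * \<psi> (glue_black (snd f) b (strip w G), (v, b)))"
    unfolding D yop_def strip_decorated_op_def prod.case fst_conv snd_conv
  proof (intro arg_cong[of _ _ uminus] sum.cong)
    fix f w assume "f \<in> ?F"
    then have f: "snd f \<noteq> b" "snd f \<in> black G" "b \<in> black G"
      using G vb by (auto simp: prod_eq_iff finite_bigraph_def)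
    then have bl: "black (glue_black (snd f) b G) = black G - {snd f}"
      unfolding glue_black_sel by (intro merge_image) auto
    show "{w \<in> black (glue_black (snd f) b G). w \<noteq> b \<and>
        card (leaves (glue_black (snd f) b G) w) = Suc k} = {w \<in> ?W. snd f \<noteq> w}"
      unfolding bl mem_Collect_eq using lv[OF _ _ f(1)] by (intro Collect_cong) auto
    show "real (Suc k) * \<psi> (strip w (glue_black (snd f) b G), v, b) =
        real (Suc k) * \<psi> (glue_black (snd f) b (strip w G), v, b)" if "w \<in> {w \<in> ?W. snd f \<noteq> w}"
      using that st[OF _ _ f(1), of w] by auto
  qed simp
  also have "\<dots> = - (\<Sum>w\<in>?W. \<Sum>f\<in>{f \<in> ?F. snd f \<noteq> w}.
          real (Suc k) * \<psi> (glue_black (snd f) b (strip w G), (v, b)))"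
    by (subst sum.swap_restrict[OF fin]) simp
  also have "\<dots> = strip_decorated_op k (yop \<psi>) D"
    unfolding D yop_def strip_decorated_op_def prod.case sum_distrib_left sum_negf[symmetric]
      mult_minus_right
    by (intro sum.cong refl) auto
  finally show ?thesis .
qed

lemma xop_pow_strip:
  assumes "wf_decorated D"
  shows "(xop ^^ j) (strip_decorated_op k \<psi>) D = strip_decorated_op k ((xop ^^ j) \<psi>) D"
  using assms
proof (induction j arbitrary: D)
  case (Suc j)
  have "xop ((xop ^^ j) (strip_decorated_op k \<psi>)) D = xop (strip_decorated_op k ((xop ^^ j) \<psi>)) D"
    by (intro xop_cong Suc)
  then show ?case using Suc.prems by (simp add: xop_strip)
qed simp

lemma yop_pow_strip:
  assumes "wf_decorated D"
  shows "(yop ^^ j) (strip_decorated_op k \<psi>) D = strip_decorated_op k ((yop ^^ j) \<psi>) D"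
  using assms
proof (induction j arbitrary: D)
  case (Suc j)
  have "yop ((yop ^^ j) (strip_decorated_op k \<psi>)) D = yop (strip_decorated_op k ((yop ^^ j) \<psi>)) D"
    by (intro yop_cong Suc)
  then show ?case using Suc.prems by (simp add: yop_strip)
qed simp

lemma iso_invariant_strip:
  assumes "iso_invariant \<psi>"
  shows "iso_invariant (strip_decorated_op k \<psi>)"
proof (rule iso_invariantI)
  fix G :: "('a, 'b) bigraph" and z and f :: "'a \<Rightarrow> 'a" and g :: "'b \<Rightarrow> 'b"
  assume wf: "wf_decorated (G, z)" and inj: "inj_on f (white G)" "inj_on g (black G)"
  have G: "finite_bigraph G" and z: "z \<in> edges G" using wf by (auto simp: wf_decorated_def)
  have ed: "u \<in> white G" "b \<in> black G" if "(u, b) \<in> edges G" for u b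
    using G that by (auto simp: finite_bigraph_def)
  have lv: "leaves (relabel f g G) (g w) = f ` leaves G w" if "w \<in> black G" for w
  proof -
    have *: "(f u, g b) \<in> map_prod f g ` edges G \<longleftrightarrow> (u, b) \<in> edges G"
      if "u \<in> white G" "b \<in> black G" for u b
      using that ed inj by (auto simp: inj_on_eq_iff)
    show ?thesis
    proof (intro set_eqI iffI)
      fix x assume x: "x \<in> leaves (relabel f g G) (g w)"
      then obtain u b where ub: "(u, b) \<in> edges G" "x = f u" "g w = g b"
        by (auto simp: leaves_def)
      then have "(u, w) \<in> edges G"
        using ed that inj(2) by (metis inj_on_eq_iff)
      moreover have "c = w" if "(u, c) \<in> edges G" for c
      proof -
        have "(x, g c) \<in> edges (relabel f g G)" using that ub by force
        then have "g c = g w" using x by (auto simp: leaves_def)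
        then show "c = w" using inj(2) ed that \<open>w \<in> black G\<close> by (metis inj_on_eq_iff)
      qed
      ultimately show "x \<in> f ` leaves G w" using ub by (auto simp: leaves_def)
    next
      fix x assume "x \<in> f ` leaves G w"
      then obtain u where u: "x = f u" "(u, w) \<in> edges G" "\<And>b. (u, b) \<in> edges G \<Longrightarrow> b = w"
        by (auto simp: leaves_def)
      have "y = g w" if y: "(f u, y) \<in> map_prod f g ` edges G" for y
      proof -
        obtain u' b where "(u', b) \<in> edges G" "f u = f u'" "y = g b" using y by auto
        then show ?thesis using inj(1) ed u by (metis inj_on_eq_iff)
      qed
      moreover have "(f u, g w) \<in> map_prod f g ` edges G"
        using u(2) by (metis imageI map_prod_simp)
      ultimately show "x \<in> leaves (relabel f g G) (g w)"
        unfolding leaves_def relabel_sel u(1) by blast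
    qed
  qed
  have st: "strip (g w) (relabel f g G) = relabel f g (strip w G)" if "w \<in> black G" for w
  proof -
    have "f ` white G - f ` leaves G w = f ` (white G - leaves G w)"
      using leaves_subset[OF G, of w] inj(1) by (simp add: inj_on_image_set_diff[of f "white G"])
    moreover have "g ` black G - {g w} = g ` (black G - {w})"
      using that inj(2) by (auto simp: inj_on_eq_iff)
    moreover have "{e \<in> map_prod f g ` edges G. snd e \<noteq> g w} = map_prod f g ` {e \<in> edges G. snd e \<noteq> w}"
    proof -
      have "snd (map_prod f g e) \<noteq> g w \<longleftrightarrow> snd e \<noteq> w" if "e \<in> edges G" for e
        using that \<open>w \<in> black G\<close> inj(2) ed(2)[of "fst e" "snd e"] by (simp add: inj_on_eq_iff)
      then have "{e \<in> edges G. snd (map_prod f g e) \<noteq> g w} = {e \<in> edges G. snd e \<noteq> w}"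
        by (intro Collect_cong) metis
      then show ?thesis by (simp only: Compr_image_eq)
    qed
    ultimately show ?thesis
      unfolding strip_def[of "g w"] lv[OF that] relabel_sel
      by (simp add: relabel_def)
  qed
  have snd_z: "snd z \<in> black G" using z ed by (cases z) auto
  have cl: "card (f ` leaves G w) = card (leaves G w)" for w
    using leaves_subset[OF G, of w] inj(1) by (intro card_image) (rule inj_on_subset)
  let ?W = "{w \<in> black G. w \<noteq> snd z \<and> card (leaves G w) = Suc k}"
  have W: "{w \<in> black (relabel f g G). w \<noteq> g (snd z) \<and> card (leaves (relabel f g G) w) = Suc k} = g ` ?W"
    using inj(2) snd_z by (auto simp: lv cl inj_on_eq_iff)
  have "strip_decorated_op k \<psi> (relabel f g G, map_prod f g z) =
      (\<Sum>w\<in>g ` ?W. real (Suc k) * \<psi> (strip w (relabel f g G), map_prod f g z))"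
    unfolding strip_decorated_op_def prod.case W[symmetric] by simp
  also have "\<dots> = (\<Sum>w\<in>?W. real (Suc k) * \<psi> (strip (g w) (relabel f g G), map_prod f g z))"
    by (subst sum.reindex) (auto intro: inj_on_subset[OF inj(2)])
  also have "\<dots> = (\<Sum>w\<in>?W. real (Suc k) * \<psi> (strip w G, z))"
  proof (intro sum.cong refl, elim CollectE conjE)
    fix w assume w: "w \<in> black G" "w \<noteq> snd z"
    have "\<psi> (relabel f g (strip w G), map_prod f g z) = \<psi> (strip w G, z)"
      using inj by (intro iso_invariantD assms wf_strip wf w) (auto intro: inj_on_subset)
    then show "real (Suc k) * \<psi> (strip (g w) (relabel f g G), map_prod f g z) =
        real (Suc k) * \<psi> (strip w G, z)"
      by (simp add: st w)
  qed
  finally show "strip_decorated_op k \<psi> (relabel f g G, map_prod f g z) = strip_decorated_op k \<psi> (G, z)"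
    by (simp add: strip_decorated_op_def)
qed

text \<open>Testing the stripped combination against a functional amounts to testing
  \<open>\<G>\<close> against its image under \<open>strip_decorated_op\<close>, which is again
  invariant.\<close>

lemma xy_balanced_strip_comb:
  assumes graphs: "\<And>G. G \<in> Poly_Mapping.keys \<G> \<Longrightarrow> finite_bigraph G" and bal: "xy_balanced \<G>"
  shows "xy_balanced (strip_comb k \<G>)"
  unfolding xy_balanced_def
proof (intro allI impI)
  fix \<psi> :: "('a, 'b) decorated \<Rightarrow> real" and j :: nat
  assume inv: "iso_invariant \<psi>"
  have "pairing (strip_comb k \<G>) (zop ((xop ^^ j) \<psi>)) =
      pairing \<G> (zop (strip_decorated_op k ((xop ^^ j) \<psi>)))"
    unfolding pairing_strip_comb by (intro pairing_cong) (simp add: zop_strip graphs)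
  also have "\<dots> = pairing \<G> (zop ((xop ^^ j) (strip_decorated_op k \<psi>)))"
    by (intro pairing_cong zop_cong graphs) (simp_all add: xop_pow_strip)
  also have "\<dots> = pairing \<G> (zop ((yop ^^ j) (strip_decorated_op k \<psi>)))"
    using bal iso_invariant_strip[OF inv] by (simp add: xy_balanced_def)
  also have "\<dots> = pairing \<G> (zop (strip_decorated_op k ((yop ^^ j) \<psi>)))"
    by (intro pairing_cong zop_cong graphs) (simp_all add: yop_pow_strip)
  also have "\<dots> = pairing (strip_comb k \<G>) (zop ((yop ^^ j) \<psi>))"
    unfolding pairing_strip_comb by (intro pairing_cong) (simp add: zop_strip graphs)
  finally show "pairing (strip_comb k \<G>) (zop ((xop ^^ j) \<psi>)) =
      pairing (strip_comb k \<G>) (zop ((yop ^^ j) \<psi>))" .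
qed


section \<open>Taylor expansion of coloring counts along one edge of the boundary\<close>

section \<open>Sums over colorings\<close>

lemma sum_PiE_insert:
  assumes "x \<notin> A"
  shows "(\<Sum>f \<in> insert x A \<rightarrow>\<^sub>E C. \<phi> f) = (\<Sum>i\<in>C. \<Sum>f \<in> A \<rightarrow>\<^sub>E C. \<phi> (f(x := i)))"
proof -
  have "(\<Sum>f \<in> insert x A \<rightarrow>\<^sub>E C. \<phi> f) = (\<Sum>p \<in> C \<times> (A \<rightarrow>\<^sub>E C). \<phi> ((\<lambda>(i, f). f(x := i)) p))"
    unfolding PiE_insert_eq using inj_combinator[OF assms, of "\<lambda>_. C"]
    by (subst sum.reindex) (auto simp: split_def)
  then show ?thesis by (simp add: sum.cartesian_product split_def)
qed

lemma sum_PiE_reindex: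
  assumes "inj_on h A" and "\<And>f. f \<in> h ` A \<rightarrow>\<^sub>E C \<Longrightarrow> \<phi> f = \<phi>' (restrict (f \<circ> h) A)"
  shows "(\<Sum>f \<in> h ` A \<rightarrow>\<^sub>E C. \<phi> f) = (\<Sum>f \<in> A \<rightarrow>\<^sub>E C. \<phi>' f)"
proof (rule sum.reindex_bij_witness[where i = "\<lambda>f. restrict (f \<circ> inv_into A h) (h ` A)"
      and j = "\<lambda>f. restrict (f \<circ> h) A"])
  fix f assume f: "f \<in> h ` A \<rightarrow>\<^sub>E C"
  show "restrict (restrict (f \<circ> h) A \<circ> inv_into A h) (h ` A) = f"
    using f by (intro ext) (auto simp: restrict_def PiE_def extensional_def inv_into_f_f[OF assms(1)])
  show "restrict (f \<circ> h) A \<in> A \<rightarrow>\<^sub>E C" using f by auto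
  show "\<phi>' (restrict (f \<circ> h) A) = \<phi> f" using assms(2)[OF f] by simp
next
  fix f assume f: "f \<in> A \<rightarrow>\<^sub>E C"
  show "restrict (restrict (f \<circ> inv_into A h) (h ` A) \<circ> h) A = f"
    using f by (intro ext) (auto simp: restrict_def PiE_def extensional_def inv_into_f_f[OF assms(1)])
  show "restrict (f \<circ> inv_into A h) (h ` A) \<in> h ` A \<rightarrow>\<^sub>E C"
    using f by (auto simp: inv_into_f_f[OF assms(1)])
qed

text \<open>The coordinates in \<open>L\<close> are independent of each other and of
  \<open>\<phi>\<close>, so each contributes the total weight of \<open>C\<close>. The leaves far to
  the right will be such coordinates.\<close>

lemma sum_PiE_Un_prod:
  fixes \<kappa> :: "'c \<Rightarrow> real"
  assumes "finite L" "L \<inter> A = {}"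
  shows "(\<Sum>f \<in> (L \<union> A) \<rightarrow>\<^sub>E C. (\<Prod>u\<in>L. \<kappa> (f u)) * \<phi> (restrict f A)) =
    (\<Sum>i\<in>C. \<kappa> i) ^ card L * (\<Sum>f \<in> A \<rightarrow>\<^sub>E C. \<phi> f)"
  using assms
proof (induction L rule: finite_induct)
  case empty
  then show ?case by (auto intro!: sum.cong arg_cong[of _ _ \<phi>])
next
  case (insert x L)
  have "(\<Sum>f \<in> (insert x L \<union> A) \<rightarrow>\<^sub>E C. (\<Prod>u\<in>insert x L. \<kappa> (f u)) * \<phi> (restrict f A)) =
      (\<Sum>i\<in>C. \<Sum>f \<in> (L \<union> A) \<rightarrow>\<^sub>E C. \<kappa> i * ((\<Prod>u\<in>L. \<kappa> (f u)) * \<phi> (restrict f A)))"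
    unfolding Un_insert_left using insert
  proof (subst sum_PiE_insert)
    have "(\<Prod>u\<in>L. \<kappa> ((f(x := i)) u)) = (\<Prod>u\<in>L. \<kappa> (f u))" "restrict (f(x := i)) A = restrict f A" for f i
      using insert by (auto intro!: prod.cong simp: restrict_def)
    then show "(\<Sum>i\<in>C. \<Sum>f\<in>L \<union> A \<rightarrow>\<^sub>E C. (\<Prod>u\<in>insert x L. \<kappa> ((f(x := i)) u)) * \<phi> (restrict (f(x := i)) A)) =
      (\<Sum>i\<in>C. \<Sum>f \<in> (L \<union> A) \<rightarrow>\<^sub>E C. \<kappa> i * ((\<Prod>u\<in>L. \<kappa> (f u)) * \<phi> (restrict f A)))"
      using insert by (simp add: mult.assoc)
  qed auto
  also have "\<dots> = (\<Sum>i\<in>C. \<kappa> i) * ((\<Sum>i\<in>C. \<kappa> i) ^ card L * (\<Sum>f \<in> A \<rightarrow>\<^sub>E C. \<phi> f))"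
  proof -
    have "L \<inter> A = {}" using insert.prems by auto
    then show ?thesis
      by (simp only: sum_distrib_left[symmetric] sum_distrib_right[symmetric] insert.IH)
  qed
  finally show ?case
    by (simp only: card_insert_disjoint[OF insert.hyps] power_Suc mult.assoc)
qed

lemma prod_of_bool: "finite A \<Longrightarrow> (\<Prod>a\<in>A. of_bool (P a) :: real) = of_bool (\<forall>a\<in>A. P a)"
  by (induction A rule: finite_induct) auto


section \<open>Weighted colorings of decorated graphs\<close>

definition white_nbrs :: "('w, 'b) bigraph \<Rightarrow> 'b \<Rightarrow> 'w set" where
  "white_nbrs G b = {u. (u, b) \<in> edges G}"

definition black_nbrs :: "('w, 'b) bigraph \<Rightarrow> 'w \<Rightarrow> 'b set" where
  "black_nbrs G v = {b. (v, b) \<in> edges G}"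

text \<open>Capping the colors at \<open>C\<close> makes all sums finite. For graphs without
  isolated vertices nothing is lost once the diagram fits into the square of side
  \<open>C\<close>.\<close>

definition coloring_number :: "(nat \<times> nat) set \<Rightarrow> nat \<Rightarrow> ('w, 'b) bigraph \<Rightarrow> real" where
  "coloring_number B C G = (\<Sum>f \<in> white G \<rightarrow>\<^sub>E {1..C}. \<Sum>g \<in> black G \<rightarrow>\<^sub>E {1..C}.
     of_bool (\<forall>u b. (u, b) \<in> edges G \<longrightarrow> (f u, g b) \<in> B))"

text \<open>
  Colorings of a decorated graph whose decorated edge has been placed at a boundary point \<open>(x, y)\<close>
  of the diagram: the constraints from the other edges at its ends only compare colors with
  \<open>x\<close> and \<open>y\<close>, and are encoded by the weights \<open>\<kappa>\<close> and \<open>\<mu>\<close>. For a point \<open>(x + t, y)\<close> with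
  \<open>x\<close> integral, the column \<open>x + 1\<close> is cut at \<open>t\<close> and gets the weight \<open>t\<close>; see \<open>cutoff\<close>.
\<close>

definition psi :: "(nat \<times> nat) set \<Rightarrow> nat \<Rightarrow> (nat \<Rightarrow> real) \<Rightarrow> (nat \<Rightarrow> real)
    \<Rightarrow> ('w, 'b) decorated \<Rightarrow> real" where
  "psi B C \<kappa> \<mu> = (\<lambda>(G, (v, w)).
     \<Sum>f \<in> (white G - {v}) \<rightarrow>\<^sub>E {1..C}. \<Sum>g \<in> (black G - {w}) \<rightarrow>\<^sub>E {1..C}.
       of_bool (\<forall>u b. (u, b) \<in> edges G \<longrightarrow> u \<noteq> v \<longrightarrow> b \<noteq> w \<longrightarrow> (f u, g b) \<in> B)
       * (\<Prod>u \<in> white_nbrs G w - {v}. \<kappa> (f u)) * (\<Prod>b \<in> black_nbrs G v - {w}. \<mu> (g b)))"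

definition cutoff :: "nat \<Rightarrow> real \<Rightarrow> nat \<Rightarrow> real" where
  "cutoff x t i = (if i \<le> x then 1 else if i = Suc x then t else 0)"

lemma cutoff_0: "cutoff x 0 i = of_bool (i \<le> x)"
  by (simp add: cutoff_def)

lemma cutoff_1: "cutoff x 1 = cutoff (Suc x) 0"
  by (auto simp: cutoff_def)

lemma nbrs_subset:
  assumes "finite_bigraph G"
  shows "white_nbrs G b \<subseteq> white G" "black_nbrs G v \<subseteq> black G"
  using assms by (auto simp: finite_bigraph_def white_nbrs_def black_nbrs_def)

lemma finite_nbrs:
  assumes "finite_bigraph G"
  shows "finite (white_nbrs G b)" "finite (black_nbrs G v)"
  using nbrs_subset[OF assms] assms unfolding finite_bigraph_def by (metis finite_subset)+

lemma iso_invariant_psi: "iso_invariant (psi B C \<kappa> \<mu>)"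
proof (rule iso_invariantI)
  fix G :: "('a, 'b) bigraph" and z and p :: "'a \<Rightarrow> 'a" and q :: "'b \<Rightarrow> 'b"
  assume wf: "wf_decorated (G, z)" and inj: "inj_on p (white G)" "inj_on q (black G)"
  obtain v w where z: "z = (v, w)" by (cases z)
  have G: "finite_bigraph G" using wf by (simp add: wf_decorated_def)
  have ed: "u \<in> white G" "b \<in> black G" if "(u, b) \<in> edges G" for u b
    using G that by (auto simp: finite_bigraph_def)
  have vw: "v \<in> white G" "w \<in> black G" using wf ed by (auto simp: wf_decorated_def z)
  have p_eq: "p a = p b \<longleftrightarrow> a = b" if "a \<in> white G" "b \<in> white G" for a b
    using inj that by (simp add: inj_on_eq_iff)
  have q_eq: "q a = q b \<longleftrightarrow> a = b" if "a \<in> black G" "b \<in> black G" for a b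
    using inj that by (simp add: inj_on_eq_iff)
  have W: "p ` white G - {p v} = p ` (white G - {v})" using vw p_eq by auto
  have K: "q ` black G - {q w} = q ` (black G - {w})" using vw q_eq by auto
  have wn: "white_nbrs (relabel p q G) (q w) - {p v} = p ` (white_nbrs G w - {v})"
  proof (intro set_eqI iffI)
    fix x assume "x \<in> white_nbrs (relabel p q G) (q w) - {p v}"
    then obtain u b where "(u, b) \<in> edges G" "x = p u" "q b = q w" "x \<noteq> p v"
      by (auto simp: white_nbrs_def)
    then show "x \<in> p ` (white_nbrs G w - {v})"
      using ed vw q_eq by (auto simp: white_nbrs_def)
  next
    fix x assume "x \<in> p ` (white_nbrs G w - {v})"
    then obtain u where "(u, w) \<in> edges G" "u \<noteq> v" "x = p u" by (auto simp: white_nbrs_def)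
    moreover from this have "map_prod p q (u, w) \<in> map_prod p q ` edges G" by (rule_tac imageI)
    ultimately show "x \<in> white_nbrs (relabel p q G) (q w) - {p v}"
      using ed vw p_eq by (auto simp: white_nbrs_def)
  qed
  have bn: "black_nbrs (relabel p q G) (p v) - {q w} = q ` (black_nbrs G v - {w})"
  proof (intro set_eqI iffI)
    fix x assume "x \<in> black_nbrs (relabel p q G) (p v) - {q w}"
    then obtain u b where "(u, b) \<in> edges G" "x = q b" "p u = p v" "x \<noteq> q w"
      by (auto simp: black_nbrs_def)
    then show "x \<in> q ` (black_nbrs G v - {w})"
      using ed vw p_eq by (auto simp: black_nbrs_def)
  next
    fix x assume "x \<in> q ` (black_nbrs G v - {w})"
    then obtain b where "(v, b) \<in> edges G" "b \<noteq> w" "x = q b" by (auto simp: black_nbrs_def)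
    moreover from this have "map_prod p q (v, b) \<in> map_prod p q ` edges G" by (rule_tac imageI)
    ultimately show "x \<in> black_nbrs (relabel p q G) (p v) - {q w}"
      using ed vw q_eq by (auto simp: black_nbrs_def)
  qed
  have injs: "inj_on p (white G - {v})" "inj_on q (black G - {w})"
    "inj_on p (white_nbrs G w - {v})" "inj_on q (black_nbrs G v - {w})"
    by (rule inj_on_subset[OF inj(1)] inj_on_subset[OF inj(2)];
      use nbrs_subset[OF G] in blast)+
  show "psi B C \<kappa> \<mu> (relabel p q G, map_prod p q z) = psi B C \<kappa> \<mu> (G, z)"
    unfolding z map_prod_simp psi_def prod.case relabel_sel W K wn bn
  proof (intro sum_PiE_reindex injs)
    fix f g
    have "(\<forall>u b. (u, b) \<in> map_prod p q ` edges G \<longrightarrow> u \<noteq> p v \<longrightarrow> b \<noteq> q w \<longrightarrow> (f u, g b) \<in> B) \<longleftrightarrow>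
       (\<forall>u b. (u, b) \<in> edges G \<longrightarrow> u \<noteq> v \<longrightarrow> b \<noteq> w \<longrightarrow>
         (restrict (f \<circ> p) (white G - {v}) u, restrict (g \<circ> q) (black G - {w}) b) \<in> B)" (is "?l \<longleftrightarrow> ?r")
    proof
      assume ?l
      show ?r
      proof (intro allI impI)
        fix u b assume ub: "(u, b) \<in> edges G" "u \<noteq> v" "b \<noteq> w"
        then have "(p u, q b) \<in> map_prod p q ` edges G" by (metis imageI map_prod_simp)
        then show "(restrict (f \<circ> p) (white G - {v}) u, restrict (g \<circ> q) (black G - {w}) b) \<in> B"
          using \<open>?l\<close> ub ed[OF ub(1)] p_eq[OF _ vw(1)] q_eq[OF _ vw(2)] by simp
      qed
    next
      assume ?r
      show ?l
      proof (intro allI impI)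
        fix u' b' assume "(u', b') \<in> map_prod p q ` edges G" "u' \<noteq> p v" "b' \<noteq> q w"
        then obtain u b where "(u, b) \<in> edges G" "u' = p u" "b' = q b" "u \<noteq> v" "b \<noteq> w" by auto
        then show "(f u', g b') \<in> B" using \<open>?r\<close>[rule_format, of u b] ed[of u b] by simp
      qed
    qed
    moreover have "(\<Prod>u\<in>p ` (white_nbrs G w - {v}). \<kappa> (f u)) =
        (\<Prod>u\<in>white_nbrs G w - {v}. \<kappa> (restrict (f \<circ> p) (white G - {v}) u))"
      using nbrs_subset(1)[OF G, of w] by (subst prod.reindex[OF injs(3)]) (auto intro!: prod.cong)
    moreover have "(\<Prod>b\<in>q ` (black_nbrs G v - {w}). \<mu> (g b)) =
        (\<Prod>b\<in>black_nbrs G v - {w}. \<mu> (restrict (g \<circ> q) (black G - {w}) b))"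
      using nbrs_subset(2)[OF G, of v] by (subst prod.reindex[OF injs(4)]) (auto intro!: prod.cong)
    ultimately show "of_bool (\<forall>u b. (u, b) \<in> map_prod p q ` edges G \<longrightarrow> u \<noteq> p v \<longrightarrow> b \<noteq> q w \<longrightarrow> (f u, g b) \<in> B) *
       (\<Prod>u\<in>p ` (white_nbrs G w - {v}). \<kappa> (f u)) * (\<Prod>b\<in>q ` (black_nbrs G v - {w}). \<mu> (g b)) =
       of_bool (\<forall>u b. (u, b) \<in> edges G \<longrightarrow> u \<noteq> v \<longrightarrow> b \<noteq> w \<longrightarrow>
         (restrict (f \<circ> p) (white G - {v}) u, restrict (g \<circ> q) (black G - {w}) b) \<in> B) *
       (\<Prod>u\<in>white_nbrs G w - {v}. \<kappa> (restrict (f \<circ> p) (white G - {v}) u)) *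
       (\<Prod>b\<in>black_nbrs G v - {w}. \<mu> (restrict (g \<circ> q) (black G - {w}) b))"
      by simp
  qed
qed

text \<open>In the glued graph the black neighbours of \<open>u\<close> become neighbours of
  \<open>v\<close>, so their colors must be at most \<open>y\<close>. By \<open>step\<close> this is
  the condition for \<open>u\<close> to have color \<open>Suc x\<close>, the column being cut. Hence
  \<open>u\<close> can be restored with its color fixed and its weight removed.\<close>

lemma psi_glue_white:
  assumes wf: "wf_decorated (G, (v, w))" and u: "(u, w) \<in> edges G" "u \<noteq> v"
    and x: "Suc x \<le> C" and step: "\<And>j. j \<in> {1..C} \<Longrightarrow> (Suc x, j) \<in> B \<longleftrightarrow> j \<le> y"
  shows "psi B C \<kappa> (cutoff y 0) (glue_white u v G, (v, w)) =
    (\<Sum>f \<in> (white G - {v}) \<rightarrow>\<^sub>E {1..C}. \<Sum>g \<in> (black G - {w}) \<rightarrow>\<^sub>E {1..C}.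
       of_bool (\<forall>u b. (u, b) \<in> edges G \<longrightarrow> u \<noteq> v \<longrightarrow> b \<noteq> w \<longrightarrow> (f u, g b) \<in> B)
       * (of_bool (f u = Suc x) * (\<Prod>u' \<in> white_nbrs G w - {v} - {u}. \<kappa> (f u')))
       * (\<Prod>b \<in> black_nbrs G v - {w}. cutoff y 0 (g b)))"
proof -
  have G: "finite_bigraph G" using wf by (simp add: wf_decorated_def)
  have ed: "u \<in> white G" "b \<in> black G" if "(u, b) \<in> edges G" for u b
    using G that by (auto simp: finite_bigraph_def)
  have vw: "(v, w) \<in> edges G" "v \<in> white G" "w \<in> black G" using wf ed by (auto simp: wf_decorated_def)
  let ?W = "white G - {v} - {u}"
  have W: "white G - {v} = insert u ?W" and W': "white (glue_white u v G) - {v} = ?W"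
    using u ed(1)[OF u(1)] vw merge_image[of v "white G" u] by (auto simp: insert_absorb)
  have edge: "(a, b) \<in> edges (glue_white u v G) \<longleftrightarrow> a \<noteq> u \<and> ((a, b) \<in> edges G \<or> a = v \<and> (u, b) \<in> edges G)" for a b
    unfolding glue_white_sel by (rule edge_glue_white[OF u(2)])
  have wn: "white_nbrs (glue_white u v G) w - {v} = white_nbrs G w - {v} - {u}"
    unfolding white_nbrs_def edge by auto
  have bn: "black_nbrs (glue_white u v G) v - {w} = (black_nbrs G v - {w}) \<union> (black_nbrs G u - {w})"
    unfolding black_nbrs_def edge using u by auto
  have fin: "finite (black_nbrs G v - {w})" "finite (black_nbrs G u - {w})"
    using finite_nbrs[OF G] by auto
  let ?c = "\<lambda>f g. of_bool (\<forall>u b. (u, b) \<in> edges G \<longrightarrow> u \<noteq> v \<longrightarrow> b \<noteq> w \<longrightarrow> (f u, g b) \<in> B) :: real"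
  let ?r = "\<lambda>f g i. ?c (f(u := i)) g
       * (of_bool (i = Suc x) * (\<Prod>u' \<in> white_nbrs G w - {v} - {u}. \<kappa> (f u')))
       * (\<Prod>b \<in> black_nbrs G v - {w}. cutoff y 0 (g b))"
  have pt: "of_bool (\<forall>a b. (a, b) \<in> edges (glue_white u v G) \<longrightarrow> a \<noteq> v \<longrightarrow> b \<noteq> w \<longrightarrow> (f a, g b) \<in> B)
      * (\<Prod>a \<in> white_nbrs G w - {v} - {u}. \<kappa> (f a))
      * (\<Prod>b \<in> (black_nbrs G v - {w}) \<union> (black_nbrs G u - {w}). cutoff y 0 (g b)) = ?r f g (Suc x)"
    if g: "g \<in> (black G - {w}) \<rightarrow>\<^sub>E {1..C}" for f g
  proof -
    have col: "(Suc x, g b) \<in> B \<longleftrightarrow> g b \<le> y" if "(a, b) \<in> edges G" "b \<noteq> w" for a b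
    proof -
      have "g b \<in> {1..C}" using g ed(2)[OF that(1)] that(2) by (auto simp: PiE_iff)
      then show ?thesis by (rule step)
    qed
    have "(\<forall>a b. (a, b) \<in> edges G \<longrightarrow> a \<noteq> v \<longrightarrow> b \<noteq> w \<longrightarrow> ((f(u := Suc x)) a, g b) \<in> B) \<longleftrightarrow>
        (\<forall>a b. (a, b) \<in> edges (glue_white u v G) \<longrightarrow> a \<noteq> v \<longrightarrow> b \<noteq> w \<longrightarrow> (f a, g b) \<in> B) \<and>
        (\<forall>b \<in> black_nbrs G u - {w}. g b \<le> y)"
      unfolding edge black_nbrs_def using col u(2) by fastforce
    then show ?thesis
      unfolding cutoff_0 prod_of_bool[OF fin(1)] prod_of_bool[OF finite_UnI[OF fin]] by (auto simp: ball_Un)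
  qed
  have "psi B C \<kappa> (cutoff y 0) (glue_white u v G, (v, w)) =
      (\<Sum>f \<in> ?W \<rightarrow>\<^sub>E {1..C}. \<Sum>g \<in> (black G - {w}) \<rightarrow>\<^sub>E {1..C}. ?r f g (Suc x))"
    unfolding psi_def prod.case W' wn bn glue_white_sel(2)
    by (intro sum.cong refl pt)
  \<comment> \<open>Only the summand \<open>i = Suc x\<close> is nonzero; the sum over
    \<open>i\<close> reintroduces \<open>u\<close> as a colored vertex.\<close>
  also have "\<dots> = (\<Sum>i\<in>{1..C}. \<Sum>f \<in> ?W \<rightarrow>\<^sub>E {1..C}. \<Sum>g \<in> (black G - {w}) \<rightarrow>\<^sub>E {1..C}. ?r f g i)"
    using x by (subst sum.remove[of "{1..C}" "Suc x"]) auto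
  also have "\<dots> = (\<Sum>f \<in> insert u ?W \<rightarrow>\<^sub>E {1..C}. \<Sum>g \<in> (black G - {w}) \<rightarrow>\<^sub>E {1..C}.
       ?c f g * (of_bool (f u = Suc x) * (\<Prod>u' \<in> white_nbrs G w - {v} - {u}. \<kappa> (f u')))
       * (\<Prod>b \<in> black_nbrs G v - {w}. cutoff y 0 (g b)))"
  proof (subst sum_PiE_insert)
    have *: "(\<Prod>u' \<in> white_nbrs G w - {v} - {u}. \<kappa> ((f(u := i)) u')) =
        (\<Prod>u' \<in> white_nbrs G w - {v} - {u}. \<kappa> (f u'))" for f i
      by (intro prod.cong) auto
    show "(\<Sum>i\<in>{1..C}. \<Sum>f \<in> ?W \<rightarrow>\<^sub>E {1..C}. \<Sum>g \<in> (black G - {w}) \<rightarrow>\<^sub>E {1..C}. ?r f g i) =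
      (\<Sum>i\<in>{1..C}. \<Sum>f \<in> ?W \<rightarrow>\<^sub>E {1..C}. \<Sum>g \<in> (black G - {w}) \<rightarrow>\<^sub>E {1..C}.
         ?c (f(u := i)) g * (of_bool ((f(u := i)) u = Suc x) *
           (\<Prod>u' \<in> white_nbrs G w - {v} - {u}. \<kappa> ((f(u := i)) u')))
         * (\<Prod>b \<in> black_nbrs G v - {w}. cutoff y 0 (g b)))"
      unfolding * by (simp only: fun_upd_same)
  qed simp
  finally show ?thesis
    by (simp only: W[symmetric])
qed

text \<open>\<open>cutoff x t i\<close> has derivative 1 if \<open>i = Suc x\<close> and 0
  otherwise. So the product rule selects another neighbour \<open>u\<close> of \<open>w\<close>,
  drops its weight and fixes its color to \<open>Suc x\<close>, which \<open>psi_glue_white\<close>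
  recognizes as gluing \<open>u\<close> to \<open>v\<close>.\<close>

lemma psi_deriv:
  assumes wf: "wf_decorated D"
    and x: "Suc x \<le> C" and step: "\<And>j. j \<in> {1..C} \<Longrightarrow> (Suc x, j) \<in> B \<longleftrightarrow> j \<le> y"
  shows "((\<lambda>t. psi B C (cutoff x t) (cutoff y 0) D) has_real_derivative
     xop (psi B C (cutoff x t) (cutoff y 0)) D) (at t)"
proof -
  obtain G v w where D: "D = (G, (v, w))" by (metis prod.exhaust)
  have G: "finite_bigraph G" using wf by (simp add: D wf_decorated_def)
  let ?A = "white_nbrs G w - {v}"
  let ?c = "\<lambda>f g. of_bool (\<forall>u b. (u, b) \<in> edges G \<longrightarrow> u \<noteq> v \<longrightarrow> b \<noteq> w \<longrightarrow> (f u, g b) \<in> B) :: real"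
  let ?m = "\<lambda>g. \<Prod>b \<in> black_nbrs G v - {w}. cutoff y 0 (g b)"
  let ?d = "\<lambda>f u. of_bool (f u = Suc x) * (\<Prod>u' \<in> ?A - {u}. cutoff x t (f u'))"
  have cutoff: "((\<lambda>t. cutoff x t i) has_real_derivative of_bool (i = Suc x)) (at t)" for i
    by (cases "i \<le> x"; cases "i = Suc x") (auto simp: cutoff_def intro!: derivative_eq_intros)
  have "((\<lambda>t. psi B C (cutoff x t) (cutoff y 0) D) has_real_derivative
      (\<Sum>f \<in> (white G - {v}) \<rightarrow>\<^sub>E {1..C}. \<Sum>g \<in> (black G - {w}) \<rightarrow>\<^sub>E {1..C}.
         ?c f g * (\<Sum>u\<in>?A. ?d f u) * ?m g)) (at t)"
    unfolding D psi_def prod.case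
    by (intro DERIV_sum DERIV_cmult DERIV_cmult_right has_field_derivative_prod cutoff)
  also have "(\<Sum>f \<in> (white G - {v}) \<rightarrow>\<^sub>E {1..C}. \<Sum>g \<in> (black G - {w}) \<rightarrow>\<^sub>E {1..C}.
         ?c f g * (\<Sum>u\<in>?A. ?d f u) * ?m g) =
      (\<Sum>f \<in> (white G - {v}) \<rightarrow>\<^sub>E {1..C}. \<Sum>g \<in> (black G - {w}) \<rightarrow>\<^sub>E {1..C}.
         \<Sum>u\<in>?A. ?c f g * ?d f u * ?m g)"
    by (simp only: sum_distrib_left sum_distrib_right)
  also have "\<dots> = (\<Sum>f \<in> (white G - {v}) \<rightarrow>\<^sub>E {1..C}. \<Sum>u\<in>?A. \<Sum>g \<in> (black G - {w}) \<rightarrow>\<^sub>E {1..C}.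
         ?c f g * ?d f u * ?m g)"
    by (intro sum.cong refl sum.swap)
  also have "\<dots> = (\<Sum>u\<in>?A. \<Sum>f \<in> (white G - {v}) \<rightarrow>\<^sub>E {1..C}. \<Sum>g \<in> (black G - {w}) \<rightarrow>\<^sub>E {1..C}.
         ?c f g * ?d f u * ?m g)"
    by (rule sum.swap)
  also have "\<dots> = (\<Sum>u\<in>?A. psi B C (cutoff x t) (cutoff y 0) (glue_white u v G, (v, w)))"
    by (intro sum.cong refl psi_glue_white[symmetric, OF wf[unfolded D] _ _ x step])
      (auto simp: white_nbrs_def)
  also have "\<dots> = xop (psi B C (cutoff x t) (cutoff y 0)) D"
  proof -
    have "{f \<in> edges G. f \<noteq> (v, w) \<and> snd f = w} = (\<lambda>u. (u, w)) ` ?A"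
      by (auto simp: white_nbrs_def)
    then show ?thesis
      by (simp add: D xop_def sum.reindex inj_on_def)
  qed
  finally show ?thesis .
qed

text \<open>The expansion is exact because each gluing removes a white vertex: by induction both
  sides have the same derivative in \<open>t\<close>, and they agree at
  \<open>t = s\<close>.\<close>

lemma psi_taylor_x:
  assumes wf: "wf_decorated D" "card (white (fst D)) \<le> K"
    and x: "Suc x \<le> C" and step: "\<And>j. j \<in> {1..C} \<Longrightarrow> (Suc x, j) \<in> B \<longleftrightarrow> j \<le> y"
  shows "psi B C (cutoff x t) (cutoff y 0) D =
     (\<Sum>k\<le>K. (t - s) ^ k / fact k * (xop ^^ k) (psi B C (cutoff x s) (cutoff y 0)) D)"
  using wf
proof (induction K arbitrary: D t)
  \<comment> \<open>Vacuous, since the decorated edge has a white end.\<close>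
  case 0
  obtain G v w where D: "D = (G, (v, w))" by (metis prod.exhaust)
  have "v \<in> white G" "finite (white G)"
    using 0 by (auto simp: D wf_decorated_def finite_bigraph_def)
  then show ?case using 0 by (auto simp: D)
next
  case (Suc K)
  let ?\<psi> = "\<lambda>t. psi B C (cutoff x t) (cutoff y 0)"
  let ?T = "\<lambda>t. \<Sum>k\<le>Suc K. (t - s) ^ k / fact k * (xop ^^ k) (?\<psi> s) D"
  have T: "?T t = ?\<psi> s D + (\<Sum>k\<le>K. (t - s) ^ Suc k / fact (Suc k) * xop ((xop ^^ k) (?\<psi> s)) D)" for t
    by (subst sum.atMost_Suc_shift) simp
  have IH: "xop (?\<psi> t) D = (\<Sum>k\<le>K. (t - s) ^ k / fact k * xop ((xop ^^ k) (?\<psi> s)) D)" for t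
  proof -
    obtain G v w where D: "D = (G, (v, w))" by (metis prod.exhaust)
    have G: "finite (white G)" "edges G \<subseteq> white G \<times> black G"
      using Suc.prems by (auto simp: D wf_decorated_def finite_bigraph_def)
    have vw: "v \<in> white G" using Suc.prems G by (auto simp: D wf_decorated_def)
    let ?F = "{f \<in> edges G. f \<noteq> (v, w) \<and> snd f = w}"
    have "?\<psi> t (glue_white (fst f) v G, (v, w)) = (\<Sum>k\<le>K. (t - s) ^ k / fact k *
        (xop ^^ k) (?\<psi> s) (glue_white (fst f) v G, (v, w)))" if f: "f \<in> ?F" for f
    proof (rule Suc.IH)
      show "wf_decorated (glue_white (fst f) v G, (v, w))"
        using wf_glue_white[of G "(v, w)" f] Suc.prems f by (simp add: D)
      have "fst f \<noteq> v" "fst f \<in> white G" using f G by (auto simp: prod_eq_iff)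
      then have "white (glue_white (fst f) v G) = white G - {fst f}"
        using vw unfolding glue_white_sel by (intro merge_image) auto
      then show "card (white (fst (glue_white (fst f) v G, (v, w)))) \<le> K"
        using Suc.prems(2) G \<open>fst f \<in> white G\<close> by (simp add: D)
    qed
    then have "xop (?\<psi> t) D = (\<Sum>f\<in>?F. \<Sum>k\<le>K. (t - s) ^ k / fact k *
        (xop ^^ k) (?\<psi> s) (glue_white (fst f) v G, (v, w)))"
      unfolding D xop_def prod.case fst_conv snd_conv by (intro sum.cong refl)
    also have "\<dots> = (\<Sum>k\<le>K. (t - s) ^ k / fact k * xop ((xop ^^ k) (?\<psi> s)) D)"
      by (subst sum.swap) (simp add: D xop_def sum_distrib_left)
    finally show ?thesis .
  qed
  have dT: "(?T has_real_derivative xop (?\<psi> t) D) (at t)" for t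
  proof -
    have "((\<lambda>t. (t - s) ^ Suc k / fact (Suc k) * c) has_real_derivative (t - s) ^ k / fact k * c) (at t)"
      for k c
    proof -
      have "((\<lambda>t. (t - s) ^ Suc k) has_real_derivative real (Suc k) * (t - s) ^ k) (at t)"
        by (auto intro!: derivative_eq_intros simp del: power_Suc of_nat_Suc)
      from DERIV_cmult_right[OF this, of "c / fact (Suc k)"]
      have "((\<lambda>t. (t - s) ^ Suc k * (c / fact (Suc k))) has_real_derivative
          real (Suc k) * (t - s) ^ k * (c / fact (Suc k))) (at t)" .
      moreover have "real (Suc k) * (t - s) ^ k * (c / fact (Suc k)) = (t - s) ^ k / fact k * c"
        unfolding fact_Suc by (simp del: of_nat_Suc)
      ultimately show ?thesis by (simp only: times_divide_eq_right times_divide_eq_left)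
    qed
    then have "((\<lambda>t. ?\<psi> s D + (\<Sum>k\<le>K. (t - s) ^ Suc k / fact (Suc k) * xop ((xop ^^ k) (?\<psi> s)) D))
        has_real_derivative 0 + (\<Sum>k\<le>K. (t - s) ^ k / fact k * xop ((xop ^^ k) (?\<psi> s)) D)) (at t)"
      by (intro DERIV_add DERIV_const DERIV_sum)
    then show ?thesis
      unfolding T IH by (simp only: add_0)
  qed
  have "((\<lambda>t. ?\<psi> t D - ?T t) has_real_derivative 0) (at t)" for t
    using DERIV_diff[OF psi_deriv[OF Suc.prems(1) x step] dT] by simp
  then have "?\<psi> t D - ?T t = ?\<psi> s D - ?T s"
    by (intro DERIV_isconst_all) blast
  then show ?case unfolding T by simp
qed


section \<open>Transposition\<close>

definition flip :: "('w, 'b) bigraph \<Rightarrow> ('b, 'w) bigraph" where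
  "flip G = Bigraph (black G) (white G) (prod.swap ` edges G)"

definition flip_decorated :: "('w, 'b) decorated \<Rightarrow> ('b, 'w) decorated" where
  "flip_decorated D = (flip (fst D), prod.swap (snd D))"

lemma flip_sel [simp]:
  "white (flip G) = black G" "black (flip G) = white G" "edges (flip G) = prod.swap ` edges G"
  by (simp_all add: flip_def)

lemma edge_flip: "(b, u) \<in> prod.swap ` E \<longleftrightarrow> (u, b) \<in> E"
  by force

lemma flip_flip_decorated [simp]: "flip_decorated (flip_decorated D) = D"
  by (cases D, cases "fst D") (simp add: flip_decorated_def flip_def image_comp)

lemma wf_flip_decorated: "wf_decorated D \<Longrightarrow> wf_decorated (flip_decorated D)"
  by (auto simp: wf_decorated_def flip_decorated_def finite_bigraph_def)

lemma nbrs_flip: "white_nbrs (flip G) = black_nbrs G" "black_nbrs (flip G) = white_nbrs G"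
  by (auto simp: fun_eq_iff white_nbrs_def black_nbrs_def edge_flip)

lemma psi_flip: "psi (B\<inverse>) C \<mu> \<kappa> (flip_decorated D) = psi B C \<kappa> \<mu> D"
proof -
  obtain G v w where D: "D = (G, (v, w))" by (metis prod.exhaust)
  have *: "(\<forall>b u. (b, u) \<in> edges (flip G) \<longrightarrow> b \<noteq> w \<longrightarrow> u \<noteq> v \<longrightarrow> (g b, f u) \<in> B\<inverse>) \<longleftrightarrow>
      (\<forall>u b. (u, b) \<in> edges G \<longrightarrow> u \<noteq> v \<longrightarrow> b \<noteq> w \<longrightarrow> (f u, g b) \<in> B)" for f g
    unfolding flip_sel edge_flip converse_iff by blast
  show ?thesis
    unfolding D psi_def flip_decorated_def prod.case swap_simp fst_conv snd_conv nbrs_flip *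
    by (subst sum.swap) (simp add: mult_ac)
qed

lemma coloring_number_flip: "coloring_number (B\<inverse>) C (flip G) = coloring_number B C G"
proof -
  have *: "(\<forall>b u. (b, u) \<in> edges (flip G) \<longrightarrow> (g b, f u) \<in> B\<inverse>) \<longleftrightarrow>
      (\<forall>u b. (u, b) \<in> edges G \<longrightarrow> (f u, g b) \<in> B)" for f g
    unfolding flip_sel edge_flip converse_iff by blast
  show ?thesis
    unfolding coloring_number_def * by (subst sum.swap) simp
qed

lemma zop_psi_flip: "zop (psi (B\<inverse>) C \<mu> \<kappa>) (flip G) = zop (psi B C \<kappa> \<mu>) G"
proof -
  have "zop (psi (B\<inverse>) C \<mu> \<kappa>) (flip G) = (\<Sum>e\<in>edges G. psi (B\<inverse>) C \<mu> \<kappa> (flip_decorated (G, e)))"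
    unfolding zop_def flip_sel by (subst sum.reindex) (auto simp: flip_decorated_def)
  then show ?thesis by (simp add: psi_flip zop_def)
qed

lemma xop_flip: "xop (\<lambda>D. \<psi> (flip_decorated D)) (flip_decorated D) = - yop \<psi> D"
proof -
  obtain G v w where D: "D = (G, (v, w))" by (metis prod.exhaust)
  have glue: "flip (glue_white c b (flip G)) = glue_black c b G" for c b
    by (simp add: flip_def glue_white_def glue_black_def image_image map_prod_def split_beta cong: if_cong)
  have F: "{f \<in> edges (flip G). f \<noteq> (w, v) \<and> snd f = v} =
      prod.swap ` {f \<in> edges G. f \<noteq> (v, w) \<and> fst f = v}"
    by force
  have "xop (\<lambda>D. \<psi> (flip_decorated D)) (flip_decorated D) =
     (\<Sum>f\<in>{f \<in> edges (flip G). f \<noteq> (w, v) \<and> snd f = v}. \<psi> (glue_black (fst f) w G, (v, w)))"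
    by (simp add: D xop_def flip_decorated_def glue del: flip_sel)
  also have "\<dots> = - yop \<psi> D"
    unfolding F by (subst sum.reindex) (auto simp: D yop_def)
  finally show ?thesis .
qed

lemma xop_scale: "xop (\<lambda>D. c * \<psi> D) D = c * xop \<psi> D"
  by (cases D) (simp add: xop_def sum_distrib_left)

lemma yop_pow_eq:
  "(yop ^^ k) \<psi> D = (- 1) ^ k * (xop ^^ k) (\<lambda>D. \<psi> (flip_decorated D)) (flip_decorated D)"
proof (induction k arbitrary: D)
  case (Suc k)
  have "(yop ^^ Suc k) \<psi> D = - xop (\<lambda>D. (yop ^^ k) \<psi> (flip_decorated D)) (flip_decorated D)"
    by (simp add: xop_flip)
  also have "\<dots> = (- 1) ^ Suc k * xop ((xop ^^ k) (\<lambda>D. \<psi> (flip_decorated D))) (flip_decorated D)"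
    by (simp add: Suc xop_scale)
  finally show ?case by simp
qed simp

text \<open>By transposition. The sign built into \<open>yop\<close> turns the increment
  \<open>t - s\<close> of \<open>y\<close> into \<open>s - t\<close>, the increment of the content
  \<open>x - y\<close>.\<close>

lemma psi_taylor_y:
  assumes wf: "wf_decorated D" "card (black (fst D)) \<le> K"
    and y: "Suc y \<le> C" and step: "\<And>i. i \<in> {1..C} \<Longrightarrow> (i, Suc y) \<in> B \<longleftrightarrow> i \<le> x"
  shows "psi B C (cutoff x 0) (cutoff y t) D =
     (\<Sum>k\<le>K. (s - t) ^ k / fact k * (yop ^^ k) (psi B C (cutoff x 0) (cutoff y s)) D)"
proof -
  have "psi B C (cutoff x 0) (cutoff y t) D = psi (B\<inverse>) C (cutoff y t) (cutoff x 0) (flip_decorated D)"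
    by (simp add: psi_flip)
  also have "\<dots> = (\<Sum>k\<le>K. (t - s) ^ k / fact k *
      (xop ^^ k) (psi (B\<inverse>) C (cutoff y s) (cutoff x 0)) (flip_decorated D))"
    using wf by (intro psi_taylor_x wf_flip_decorated y)
      (auto simp: flip_decorated_def step)
  also have "\<dots> = (\<Sum>k\<le>K. (s - t) ^ k / fact k * (yop ^^ k) (psi B C (cutoff x 0) (cutoff y s)) D)"
  proof (intro sum.cong refl)
    fix k
    have *: "psi (B\<inverse>) C (cutoff y s) (cutoff x 0) = (\<lambda>D. psi B C (cutoff x 0) (cutoff y s) (flip_decorated D))"
      by (intro ext) (metis psi_flip flip_flip_decorated)
    have **: "(s - t) ^ k * (- 1) ^ k = (t - s) ^ k"
      by (simp flip: power_mult_distrib)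
    show "(t - s) ^ k / fact k *
        (xop ^^ k) (psi (B\<inverse>) C (cutoff y s) (cutoff x 0)) (flip_decorated D) =
        (s - t) ^ k / fact k * (yop ^^ k) (psi B C (cutoff x 0) (cutoff y s)) D"
      unfolding yop_pow_eq * **[symmetric] by simp
  qed
  finally show ?thesis .
qed


section \<open>Diagrams\<close>

definition diagram :: "nat \<Rightarrow> (nat \<times> nat) set \<Rightarrow> bool" where
  "diagram M B \<longleftrightarrow> B \<subseteq> {1..M} \<times> {1..M} \<and> (\<forall>(i, j) \<in> B. {1..i} \<times> {1..j} \<subseteq> B)"

definition col_height :: "(nat \<times> nat) set \<Rightarrow> nat \<Rightarrow> nat" where
  "col_height B i = card {j. (i, j) \<in> B}"

lemma diagram_converse: "diagram M B \<Longrightarrow> diagram M (B\<inverse>)"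
  by (fastforce simp: diagram_def)

lemma diagram_bounds: "diagram M B \<Longrightarrow> (i, j) \<in> B \<Longrightarrow> 1 \<le> i \<and> i \<le> M \<and> 1 \<le> j \<and> j \<le> M"
  by (auto simp: diagram_def)

lemma diagram_down:
  "diagram M B \<Longrightarrow> (i, j) \<in> B \<Longrightarrow> 1 \<le> i' \<Longrightarrow> i' \<le> i \<Longrightarrow> 1 \<le> j' \<Longrightarrow> j' \<le> j \<Longrightarrow> (i', j') \<in> B"
  unfolding diagram_def by fastforce

lemma diagram_column: "diagram M B \<Longrightarrow> (i, j) \<in> B \<longleftrightarrow> 1 \<le> j \<and> j \<le> col_height B i"
proof -
  assume B: "diagram M B"
  let ?X = "{j. (i, j) \<in> B}"
  have "?X \<subseteq> {1..M}" using diagram_bounds[OF B] by auto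
  then have fin: "finite ?X" by (rule finite_subset) simp
  have "?X = {1..card ?X}"
  proof (cases "?X = {}")
    case False
    define m where "m = Max ?X"
    have m: "(i, m) \<in> B" using Max_in[OF fin False] by (simp add: m_def)
    have "?X = {1..m}"
    proof (intro set_eqI iffI)
      fix j assume "j \<in> ?X"
      then show "j \<in> {1..m}" using Max_ge[OF fin] diagram_bounds[OF B] by (auto simp: m_def)
    next
      fix j assume "j \<in> {1..m}"
      then show "j \<in> ?X" using diagram_down[OF B m, of i j] diagram_bounds[OF B m] by simp
    qed
    then show ?thesis by (metis card_atLeastAtMost diff_Suc_1)
  qed simp
  then show ?thesis unfolding col_height_def by (metis atLeastAtMost_iff mem_Collect_eq)
qed

lemma diagram_row: "diagram M B \<Longrightarrow> (i, j) \<in> B \<longleftrightarrow> 1 \<le> i \<and> i \<le> col_height (B\<inverse>) j"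
  using diagram_column[OF diagram_converse, of M B j i] by simp

lemma col_height_le: "diagram M B \<Longrightarrow> col_height B i \<le> M"
  using diagram_column[of M B i "col_height B i"] diagram_bounds[of M B i "col_height B i"]
  by (cases "col_height B i") auto

text \<open>For \<open>P\<close> the coloring constraint and \<open>r\<close> the weight of the
  vertices that it confines to the diagram: this weight is 1 wherever \<open>P\<close>
  holds.\<close>

lemma of_bool_absorb:
  fixes r :: real
  assumes "of_bool P = 1 \<Longrightarrow> r = 1" "p = l * r" "of_bool P = s"
  shows "of_bool P * p = l * s"
  using assms by (cases P) auto


section \<open>The boundary far to the right\<close>

lemma psi_far:
  assumes wf: "wf_decorated (G, (v, w))" and B: "diagram M B"
  shows "psi B (Suc M) (cutoff M t) (cutoff 0 0) (G, (v, w)) =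
    (if v \<in> leaves G w
     then (real M + t) ^ (card (leaves G w) - 1) * coloring_number B (Suc M) (strip w G) else 0)"
proof (cases "v \<in> leaves G w")
  case False
  have G: "finite_bigraph G" and vw: "(v, w) \<in> edges G" using wf by (auto simp: wf_decorated_def)
  obtain b where b: "(v, b) \<in> edges G" "b \<noteq> w" using False vw by (auto simp: leaves_def)
  have bb: "b \<in> black_nbrs G v - {w}" "b \<in> black G - {w}"
    using b G by (auto simp: black_nbrs_def finite_bigraph_def)
  \<comment> \<open>With \<open>y = 0\<close>, a further black neighbour of \<open>v\<close> has no
    color of nonzero weight.\<close>
  have "(\<Prod>b \<in> black_nbrs G v - {w}. cutoff 0 0 (g b)) = 0"
    if "g \<in> (black G - {w}) \<rightarrow>\<^sub>E {1..Suc M}" for g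
  proof (rule prod_zero)
    show "finite (black_nbrs G v - {w})" using finite_nbrs[OF G] by simp
    have "g b \<in> {1..Suc M}" using that bb(2) by (rule PiE_mem)
    then show "\<exists>a\<in>black_nbrs G v - {w}. cutoff 0 0 (g a) = 0"
      using bb(1) by (intro bexI[of _ b]) (auto simp: cutoff_0)
  qed
  then show ?thesis using False unfolding psi_def prod.case by (simp add: sum.neutral)
next
  case True
  have G: "finite_bigraph G" using wf by (auto simp: wf_decorated_def)
  have ed: "u \<in> white G" "b \<in> black G" if "(u, b) \<in> edges G" for u b
    using G that by (auto simp: finite_bigraph_def)
  let ?C = "{1..Suc M}"
  let ?L = "leaves G w - {v}" and ?A = "white G - leaves G w"
  let ?R = "white_nbrs G w - leaves G w"
  have lf: "leaves G w \<subseteq> white G" using leaves_subset[OF G] .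
  have fin: "finite (leaves G w)" "finite ?R"
    using lf G finite_nbrs[OF G] by (auto simp: finite_bigraph_def intro: finite_subset)
  have W: "white G - {v} = ?L \<union> ?A" using True lf by auto
  have bn: "black_nbrs G v - {w} = {}" using True by (auto simp: leaves_def black_nbrs_def)
  have wn: "white_nbrs G w - {v} = ?L \<union> ?R"
    using True by (auto simp: leaves_def white_nbrs_def)
  let ?c = "\<lambda>f g. of_bool (\<forall>u b. (u, b) \<in> edges G \<longrightarrow> u \<noteq> v \<longrightarrow> b \<noteq> w \<longrightarrow> (f u, g b) \<in> B) :: real"
  let ?s = "\<lambda>f g. of_bool (\<forall>u b. (u, b) \<in> edges (strip w G) \<longrightarrow> (f u, g b) \<in> B) :: real"
  have pt: "?c f g * (\<Prod>u \<in> white_nbrs G w - {v}. cutoff M t (f u)) =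
      (\<Prod>u\<in>?L. cutoff M t (f u)) * ?s (restrict f ?A) g" for f g
  proof -
    have "(\<forall>u b. (u, b) \<in> edges G \<longrightarrow> u \<noteq> v \<longrightarrow> b \<noteq> w \<longrightarrow> (f u, g b) \<in> B) \<longleftrightarrow>
        (\<forall>u b. (u, b) \<in> edges G \<longrightarrow> b \<noteq> w \<longrightarrow> (f u, g b) \<in> B)"
      using True by (auto simp: leaves_def)
    also have "\<dots> \<longleftrightarrow> (\<forall>u b. (u, b) \<in> edges (strip w G) \<longrightarrow> (restrict f ?A u, g b) \<in> B)"
    proof -
      have "restrict f ?A u = f u" if "(u, b) \<in> edges G" "b \<noteq> w" for u b
        using that ed by (auto simp: leaves_def)
      then show ?thesis unfolding strip_sel mem_Collect_eq snd_conv by metis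
    qed
    finally have c: "?c f g = ?s (restrict f ?A) g" by simp
    \<comment> \<open>A neighbour of \<open>w\<close> that is no leaf has another edge, which forces
      its color to be at most \<open>M\<close>. Only the leaves see the cut column.\<close>
    have "(\<Prod>u \<in> ?R. cutoff M t (f u)) = 1" if "?c f g = 1"
    proof (rule prod.neutral, intro ballI)
      fix u assume "u \<in> ?R"
      then obtain b where b: "(u, b) \<in> edges G" "b \<noteq> w" "u \<noteq> v"
        using True by (auto simp: white_nbrs_def leaves_def)
      then have "(f u, g b) \<in> B" using that by (auto split: if_splits)
      then show "cutoff M t (f u) = 1" using diagram_bounds[OF B] by (auto simp: cutoff_def)
    qed
    moreover have "(\<Prod>u \<in> white_nbrs G w - {v}. cutoff M t (f u)) =
        (\<Prod>u \<in> ?L. cutoff M t (f u)) * (\<Prod>u \<in> ?R. cutoff M t (f u))"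
      unfolding wn using fin by (intro prod.union_disjoint) auto
    ultimately show ?thesis using c by (intro of_bool_absorb)
  qed
  \<comment> \<open>\<open>M\<close> whole columns and the fraction \<open>t\<close> of column
    \<open>M + 1\<close>.\<close>
  have weight: "(\<Sum>i\<in>?C. cutoff M t i) = real M + t"
    by (subst sum.cl_ivl_Suc) (simp add: cutoff_def)
  have "psi B (Suc M) (cutoff M t) (cutoff 0 0) (G, (v, w)) =
      (\<Sum>f \<in> (?L \<union> ?A) \<rightarrow>\<^sub>E ?C. \<Sum>g \<in> (black G - {w}) \<rightarrow>\<^sub>E ?C.
        (\<Prod>u\<in>?L. cutoff M t (f u)) * ?s (restrict f ?A) g)"
    unfolding psi_def prod.case bn W[symmetric] pt by simp
  also have "\<dots> = (\<Sum>f \<in> (?L \<union> ?A) \<rightarrow>\<^sub>E ?C. (\<Prod>u\<in>?L. cutoff M t (f u)) *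
      (\<Sum>g \<in> (black G - {w}) \<rightarrow>\<^sub>E ?C. ?s (restrict f ?A) g))"
    by (simp only: sum_distrib_left)
  also have "\<dots> = (real M + t) ^ card ?L *
      (\<Sum>f \<in> ?A \<rightarrow>\<^sub>E ?C. \<Sum>g \<in> (black G - {w}) \<rightarrow>\<^sub>E ?C. ?s f g)"
    unfolding weight[symmetric] using fin by (intro sum_PiE_Un_prod) auto
  finally show ?thesis
    using True fin by (simp add: coloring_number_def)
qed

text \<open>The edges are grouped by their black end, whose leaves contribute equally. A vertex has
  at most \<open>K\<close> leaves, so the degree stays below \<open>K\<close>.\<close>

lemma zop_psi_far:
  assumes G: "finite_bigraph G" and B: "diagram M B" and K: "card (white G) \<le> K"
  shows "zop (psi B (Suc M) (cutoff M t) (cutoff 0 0)) G =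
    (\<Sum>k<K. (real M + t) ^ k * strip_op k (coloring_number B (Suc M)) G)"
proof -
  let ?n = "\<lambda>w. coloring_number B (Suc M) (strip w G)"
  let ?z = "real M + t"
  have fin: "finite (black G)" "finite (white G)" using G by (auto simp: finite_bigraph_def)
  have fl: "finite (leaves G w)" "card (leaves G w) \<le> K" for w
    using leaves_subset[OF G, of w] fin K by (auto intro: finite_subset dest: card_mono)
  have E: "{e \<in> edges G. fst e \<in> leaves G (snd e)} = (\<lambda>(w, v). (v, w)) ` (SIGMA w:black G. leaves G w)"
  proof (intro equalityI subsetI)
    fix e assume e: "e \<in> {e \<in> edges G. fst e \<in> leaves G (snd e)}"
    then have "(snd e, fst e) \<in> (SIGMA w:black G. leaves G w)"
      using G by (cases e) (auto simp: finite_bigraph_def)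
    then show "e \<in> (\<lambda>(w, v). (v, w)) ` (SIGMA w:black G. leaves G w)"
      by (rule rev_image_eqI) simp
  next
    fix e assume "e \<in> (\<lambda>(w, v). (v, w)) ` (SIGMA w:black G. leaves G w)"
    then obtain w v where e: "e = (v, w)" "v \<in> leaves G w" by auto
    then have "(v, w) \<in> edges G" unfolding leaves_def by blast
    then show "e \<in> {e \<in> edges G. fst e \<in> leaves G (snd e)}" using e by simp
  qed
  have "zop (psi B (Suc M) (cutoff M t) (cutoff 0 0)) G =
      (\<Sum>e\<in>edges G. if fst e \<in> leaves G (snd e)
        then ?z ^ (card (leaves G (snd e)) - 1) * ?n (snd e) else 0)"
    unfolding zop_def
  proof (intro sum.cong refl)
    fix e assume "e \<in> edges G"
    then have "wf_decorated (G, (fst e, snd e))" using G by (simp add: wf_decorated_def)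
    from psi_far[OF this B]
    show "psi B (Suc M) (cutoff M t) (cutoff 0 0) (G, e) = (if fst e \<in> leaves G (snd e)
        then ?z ^ (card (leaves G (snd e)) - 1) * ?n (snd e) else 0)" by simp
  qed
  also have "\<dots> = (\<Sum>e\<in>{e \<in> edges G. fst e \<in> leaves G (snd e)}. ?z ^ (card (leaves G (snd e)) - 1) * ?n (snd e))"
    using finite_edges[OF G] by (intro sum.inter_filter[symmetric])
  also have "\<dots> = (\<Sum>w\<in>black G. \<Sum>v\<in>leaves G w. ?z ^ (card (leaves G w) - 1) * ?n w)"
  proof -
    have "(\<Sum>w\<in>black G. \<Sum>v\<in>leaves G w. ?z ^ (card (leaves G w) - 1) * ?n w) =
        (\<Sum>p\<in>(SIGMA w:black G. leaves G w). ?z ^ (card (leaves G (fst p)) - 1) * ?n (fst p))"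
      using fin fl by (subst sum.Sigma) (auto simp: split_def)
    then show ?thesis
      unfolding E by (subst sum.reindex) (auto simp: inj_on_def split_def)
  qed
  also have "\<dots> = (\<Sum>w\<in>black G. \<Sum>k<K. if card (leaves G w) = Suc k then ?z ^ k * (real (Suc k) * ?n w) else 0)"
  proof (intro sum.cong refl)
    fix w
    show "(\<Sum>v\<in>leaves G w. ?z ^ (card (leaves G w) - 1) * ?n w) =
        (\<Sum>k<K. if card (leaves G w) = Suc k then ?z ^ k * (real (Suc k) * ?n w) else 0)"
    proof (cases "card (leaves G w)")
      case (Suc l)
      then have "l < K" using fl(2)[of w] by simp
      then show ?thesis by (simp add: Suc)
    qed simp
  qed
  also have "\<dots> = (\<Sum>k<K. \<Sum>w\<in>black G. if card (leaves G w) = Suc k then ?z ^ k * (real (Suc k) * ?n w) else 0)"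
    by (rule sum.swap)
  also have "\<dots> = (\<Sum>k<K. ?z ^ k * strip_op k (coloring_number B (Suc M)) G)"
    unfolding strip_op_def sum_distrib_left using fin(1)
    by (intro sum.cong refl sum.inter_filter[symmetric])
  finally show ?thesis .
qed


section \<open>Vertex counts as integrals over the boundary\<close>

section \<open>Counting colorings along the boundary\<close>

text \<open>Let each color \<open>i\<close> be spread uniformly over the interval from
  \<open>i - 1\<close> to \<open>i\<close>. The product belonging to \<open>v\<close> is the density
  for \<open>v\<close> to be the rightmost point, at offset \<open>t\<close> in its column. Only
  vertices of the largest color contribute, and if there are \<open>r\<close> of them,
  \<open>r * t ^ (r - 1)\<close> integrates to 1.\<close>

lemma max_color_integral:
  fixes f :: "'a \<Rightarrow> nat" and c :: "nat \<Rightarrow> real"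
  assumes A: "finite A" "A \<noteq> {}" and f: "\<And>u. u \<in> A \<Longrightarrow> f u \<ge> 1"
  shows "((\<lambda>t. \<Sum>v\<in>A. c (f v) * (\<Prod>u \<in> A - {v}. cutoff (f v - 1) t (f u)))
    has_integral c (Max (f ` A))) {0..1}"
proof -
  define m where "m = Max (f ` A)"
  let ?T = "{v \<in> A. f v = m}"
  have le: "f u \<le> m" if "u \<in> A" for u using A that by (simp add: m_def)
  have "m \<in> f ` A" unfolding m_def using A by (intro Max_in) auto
  then obtain v0 where v0: "v0 \<in> ?T" by auto
  have r: "card ?T \<ge> 1" using v0 A by (metis (no_types, lifting) card_0_eq empty_iff finite_subset
        less_one mem_Collect_eq not_less subsetI)
  \<comment> \<open>A vertex of larger color lies beyond the cut column of \<open>v\<close> and has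
    weight 0. Colors are positive, so \<open>f v - 1\<close> really is the column before
    \<open>f v\<close>.\<close>
  have 0: "(\<Prod>u \<in> A - {v}. cutoff (f v - 1) t (f u)) = 0" if "v \<in> A" "f v \<noteq> m" for v t
  proof (rule prod_zero)
    show "\<exists>u\<in>A - {v}. cutoff (f v - 1) t (f u) = 0"
      using v0 that le[OF that(1)] f[OF that(1)] by (intro bexI[of _ v0]) (auto simp: cutoff_def)
  qed (use A in auto)
  have 1: "(\<Prod>u \<in> A - {v}. cutoff (f v - 1) t (f u)) = t ^ (card ?T - 1)" if "v \<in> ?T" for v t
  proof -
    have "(\<Prod>u \<in> A - {v}. cutoff (f v - 1) t (f u)) = (\<Prod>u \<in> A - {v}. if f u = m then t else 1)"
    proof (intro prod.cong refl)
      fix u assume "u \<in> A - {v}"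
      then show "cutoff (f v - 1) t (f u) = (if f u = m then t else 1)"
        using that le[of u] f[of v] by (auto simp: cutoff_def)
    qed
    also have "\<dots> = (\<Prod>u \<in> {u \<in> A - {v}. f u = m}. t)"
      using A by (intro prod.inter_filter[symmetric]) auto
    also have "\<dots> = t ^ card (?T - {v})"
      by (simp add: set_diff_eq conj_commute conj_left_commute)
    finally show ?thesis using that A by simp
  qed
  have "(\<Sum>v\<in>A. c (f v) * (\<Prod>u \<in> A - {v}. cutoff (f v - 1) t (f u))) =
      c m * (real (card ?T) * t ^ (card ?T - 1))" for t
  proof -
    have "(\<Sum>v\<in>A. c (f v) * (\<Prod>u \<in> A - {v}. cutoff (f v - 1) t (f u))) =
        (\<Sum>v\<in>?T. c (f v) * (\<Prod>u \<in> A - {v}. cutoff (f v - 1) t (f u)))"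
      using A 0 by (intro sum.mono_neutral_right) auto
    also have "\<dots> = (\<Sum>v\<in>?T. c m * t ^ (card ?T - 1))"
    proof (intro sum.cong refl)
      fix v assume v: "v \<in> ?T"
      show "c (f v) * (\<Prod>u \<in> A - {v}. cutoff (f v - 1) t (f u)) = c m * t ^ (card ?T - 1)"
        unfolding 1[OF v] using v by simp
    qed
    finally show ?thesis by simp
  qed
  moreover have "((\<lambda>t::real. real (card ?T) * t ^ (card ?T - 1)) has_integral (1 ^ card ?T - 0 ^ card ?T)) {0..1}"
    by (intro fundamental_theorem_of_calculus)
      (auto intro!: derivative_eq_intros simp flip: has_real_derivative_iff_has_vector_derivative)
  then have "((\<lambda>t::real. real (card ?T) * t ^ (card ?T - 1)) has_integral 1) {0..1}"
    using r by (simp add: power_0_left)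
  then have "((\<lambda>t. c m * (real (card ?T) * t ^ (card ?T - 1))) has_integral c m) {0..1}"
    using has_integral_mult_right[of _ 1 "{0..1}" "c m"] by simp
  ultimately show ?thesis by (simp add: m_def)
qed

text \<open>On top of column \<open>x + 1\<close>, the bounds on the black neighbours of
  \<open>v\<close> say precisely that \<open>v\<close> may have color \<open>Suc x\<close>. So
  \<open>v\<close> is reinstated as a colored vertex, while \<open>w\<close> stays
  uncolored.\<close>

lemma psi_column:
  assumes wf: "wf_decorated (G, (v, w))" and B: "diagram M B" and x: "x < C"
  shows "psi B C (cutoff x t) (cutoff (col_height B (Suc x)) 0) (G, (v, w)) =
    (\<Sum>f \<in> white G \<rightarrow>\<^sub>E {1..C}. \<Sum>g \<in> (black G - {w}) \<rightarrow>\<^sub>E {1..C}.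
       of_bool (\<forall>u b. (u, b) \<in> edges G \<longrightarrow> b \<noteq> w \<longrightarrow> (f u, g b) \<in> B)
       * (of_bool (f v = Suc x) * (\<Prod>u \<in> white_nbrs G w - {v}. cutoff x t (f u))))"
proof -
  have G: "finite_bigraph G" using wf by (simp add: wf_decorated_def)
  have ed: "u \<in> white G" "b \<in> black G" if "(u, b) \<in> edges G" for u b
    using G that by (auto simp: finite_bigraph_def)
  let ?W = "white G - {v}"
  have W: "white G = insert v ?W" using wf ed by (auto simp: wf_decorated_def)
  have fin: "finite (black_nbrs G v - {w})" using finite_nbrs[OF G] by simp
  let ?c = "\<lambda>f g. of_bool (\<forall>u b. (u, b) \<in> edges G \<longrightarrow> b \<noteq> w \<longrightarrow> (f u, g b) \<in> B) :: real"
  let ?r = "\<lambda>f g i. ?c (f(v := i)) g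
       * (of_bool (i = Suc x) * (\<Prod>u \<in> white_nbrs G w - {v}. cutoff x t (f u)))"
  have pt: "of_bool (\<forall>u b. (u, b) \<in> edges G \<longrightarrow> u \<noteq> v \<longrightarrow> b \<noteq> w \<longrightarrow> (f u, g b) \<in> B)
       * (\<Prod>u \<in> white_nbrs G w - {v}. cutoff x t (f u))
       * (\<Prod>b \<in> black_nbrs G v - {w}. cutoff (col_height B (Suc x)) 0 (g b)) = ?r f g (Suc x)"
    if g: "g \<in> (black G - {w}) \<rightarrow>\<^sub>E {1..C}" for f g
  proof -
    have col: "(Suc x, g b) \<in> B \<longleftrightarrow> g b \<le> col_height B (Suc x)" if "(a, b) \<in> edges G" "b \<noteq> w" for a b
    proof -
      have "g b \<in> {1..C}" using g ed(2)[OF that(1)] that(2) by (auto simp: PiE_iff)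
      then show ?thesis using diagram_column[OF B] by simp
    qed
    have "(\<forall>a b. (a, b) \<in> edges G \<longrightarrow> b \<noteq> w \<longrightarrow> ((f(v := Suc x)) a, g b) \<in> B) \<longleftrightarrow>
        (\<forall>a b. (a, b) \<in> edges G \<longrightarrow> a \<noteq> v \<longrightarrow> b \<noteq> w \<longrightarrow> (f a, g b) \<in> B) \<and>
        (\<forall>b \<in> black_nbrs G v - {w}. g b \<le> col_height B (Suc x))"
      unfolding black_nbrs_def using col by fastforce
    then show ?thesis
      unfolding cutoff_0 prod_of_bool[OF fin] by auto
  qed
  have "psi B C (cutoff x t) (cutoff (col_height B (Suc x)) 0) (G, (v, w)) =
      (\<Sum>f \<in> ?W \<rightarrow>\<^sub>E {1..C}. \<Sum>g \<in> (black G - {w}) \<rightarrow>\<^sub>E {1..C}. ?r f g (Suc x))"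
    unfolding psi_def prod.case by (intro sum.cong refl pt)
  also have "\<dots> = (\<Sum>i\<in>{1..C}. \<Sum>f \<in> ?W \<rightarrow>\<^sub>E {1..C}. \<Sum>g \<in> (black G - {w}) \<rightarrow>\<^sub>E {1..C}. ?r f g i)"
    using x by (subst sum.remove[of "{1..C}" "Suc x"]) auto
  also have "\<dots> = (\<Sum>f \<in> insert v ?W \<rightarrow>\<^sub>E {1..C}. \<Sum>g \<in> (black G - {w}) \<rightarrow>\<^sub>E {1..C}.
       ?c f g * (of_bool (f v = Suc x) * (\<Prod>u \<in> white_nbrs G w - {v}. cutoff x t (f u))))"
  proof (subst sum_PiE_insert)
    have *: "(\<Prod>u \<in> white_nbrs G w - {v}. cutoff x t ((f(v := i)) u)) =
        (\<Prod>u \<in> white_nbrs G w - {v}. cutoff x t (f u))" for f i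
      by (intro prod.cong) auto
    show "(\<Sum>i\<in>{1..C}. \<Sum>f \<in> ?W \<rightarrow>\<^sub>E {1..C}. \<Sum>g \<in> (black G - {w}) \<rightarrow>\<^sub>E {1..C}. ?r f g i) =
      (\<Sum>i\<in>{1..C}. \<Sum>f \<in> ?W \<rightarrow>\<^sub>E {1..C}. \<Sum>g \<in> (black G - {w}) \<rightarrow>\<^sub>E {1..C}.
         ?c (f(v := i)) g * (of_bool ((f(v := i)) v = Suc x) *
           (\<Prod>u \<in> white_nbrs G w - {v}. cutoff x t ((f(v := i)) u))))"
      unfolding * by (simp only: fun_upd_same)
  qed simp
  finally show ?thesis
    by (simp only: W[symmetric])
qed

lemma coloring_number_remove_black:
  assumes G: "finite_bigraph G" and w: "w \<in> black G"
  shows "coloring_number B C G =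
    (\<Sum>f \<in> white G \<rightarrow>\<^sub>E {1..C}. \<Sum>g \<in> (black G - {w}) \<rightarrow>\<^sub>E {1..C}.
       of_bool (\<forall>u b. (u, b) \<in> edges G \<longrightarrow> b \<noteq> w \<longrightarrow> (f u, g b) \<in> B)
       * real (card {j \<in> {1..C}. \<forall>u \<in> white_nbrs G w. (f u, j) \<in> B}))"
proof -
  let ?K = "black G - {w}"
  have K: "black G = insert w ?K" using w by auto
  have "(\<Sum>g \<in> insert w ?K \<rightarrow>\<^sub>E {1..C}. of_bool (\<forall>u b. (u, b) \<in> edges G \<longrightarrow> (f u, g b) \<in> B)) =
      (\<Sum>g \<in> ?K \<rightarrow>\<^sub>E {1..C}.
       of_bool (\<forall>u b. (u, b) \<in> edges G \<longrightarrow> b \<noteq> w \<longrightarrow> (f u, g b) \<in> B)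
       * real (card {j \<in> {1..C}. \<forall>u \<in> white_nbrs G w. (f u, j) \<in> B}))" for f
  proof -
    have *: "of_bool (\<forall>u b. (u, b) \<in> edges G \<longrightarrow> (f u, (g(w := j)) b) \<in> B) =
        of_bool (\<forall>u b. (u, b) \<in> edges G \<longrightarrow> b \<noteq> w \<longrightarrow> (f u, g b) \<in> B) *
        (if \<forall>u \<in> white_nbrs G w. (f u, j) \<in> B then 1 else 0 :: real)" for g j
      by (auto simp: white_nbrs_def)
    have "(\<Sum>g \<in> insert w ?K \<rightarrow>\<^sub>E {1..C}. of_bool (\<forall>u b. (u, b) \<in> edges G \<longrightarrow> (f u, g b) \<in> B)) =
        (\<Sum>g \<in> ?K \<rightarrow>\<^sub>E {1..C}. \<Sum>j\<in>{1..C}.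
          of_bool (\<forall>u b. (u, b) \<in> edges G \<longrightarrow> b \<noteq> w \<longrightarrow> (f u, g b) \<in> B) *
          (if \<forall>u \<in> white_nbrs G w. (f u, j) \<in> B then 1 else 0 :: real))"
      by (subst sum_PiE_insert) (simp_all only: * sum.swap[of _ "{1..C}"], simp)
    then show ?thesis
      by (simp only: sum_distrib_left[symmetric] sum.inter_filter[OF finite_atLeastAtMost, symmetric]
          real_of_card)
  qed
  then show ?thesis
    unfolding coloring_number_def by (simp only: K[symmetric])
qed

text \<open>For each black \<open>w\<close>, the number of its colors is the height of the column
  given by the largest color among its neighbours, and \<open>max_color_integral\<close> distributes
  this height over the edges at \<open>w\<close>. That \<open>w\<close> has a neighbour is ensured
  by \<open>spanned\<close>.\<close>

lemma column_integral:
  assumes G: "finite_bigraph G" "spanned G" and B: "diagram M B" and C: "M \<le> C"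
  shows "((\<lambda>t. \<Sum>x<C. real (col_height B (Suc x)) *
      zop (psi B C (cutoff x t) (cutoff (col_height B (Suc x)) 0)) G)
    has_integral real (card (black G)) * coloring_number B C G) {0..1}"
proof -
  let ?b = "\<lambda>i. real (col_height B i)"
  let ?c = "\<lambda>w f g. of_bool (\<forall>u b. (u, b) \<in> edges G \<longrightarrow> b \<noteq> w \<longrightarrow> (f u, g b) \<in> B) :: real"
  let ?h = "\<lambda>w t f. \<Sum>v\<in>white_nbrs G w. ?b (f v) * (\<Prod>u \<in> white_nbrs G w - {v}. cutoff (f v - 1) t (f u))"
  have fin: "finite (black G)" "finite (white G)" using G by (auto simp: finite_bigraph_def)
  have E: "edges G = (\<lambda>(w, v). (v, w)) ` (SIGMA w:black G. white_nbrs G w)"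
    using G by (auto simp: white_nbrs_def finite_bigraph_def image_iff)
  have zop_eq: "zop \<psi> G = (\<Sum>w\<in>black G. \<Sum>v\<in>white_nbrs G w. \<psi> (G, (v, w)))" for \<psi>
  proof -
    have "(\<Sum>w\<in>black G. \<Sum>v\<in>white_nbrs G w. \<psi> (G, (v, w))) =
        (\<Sum>p\<in>(SIGMA w:black G. white_nbrs G w). \<psi> (G, (snd p, fst p)))"
      using fin finite_nbrs[OF G(1)] by (subst sum.Sigma) (auto simp: split_def)
    moreover have "zop \<psi> G = (\<Sum>e\<in>(\<lambda>(w, v). (v, w)) ` (SIGMA w:black G. white_nbrs G w). \<psi> (G, e))"
      unfolding zop_def using E by simp
    ultimately show ?thesis
      by (subst (asm) sum.reindex) (auto simp: inj_on_def split_def)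
  qed
  have term_eq: "(\<Sum>x<C. ?b (Suc x) * psi B C (cutoff x t) (cutoff (col_height B (Suc x)) 0) (G, (v, w))) =
     (\<Sum>f \<in> white G \<rightarrow>\<^sub>E {1..C}. \<Sum>g \<in> (black G - {w}) \<rightarrow>\<^sub>E {1..C}.
       ?c w f g * (?b (f v) * (\<Prod>u \<in> white_nbrs G w - {v}. cutoff (f v - 1) t (f u))))"
    if vw: "v \<in> white_nbrs G w" for v w t
  proof -
    have wf: "wf_decorated (G, (v, w))" using vw G by (simp add: wf_decorated_def white_nbrs_def)
    have v: "v \<in> white G" using vw nbrs_subset(1)[OF G(1)] by blast
    let ?p = "\<lambda>x f. \<Prod>u \<in> white_nbrs G w - {v}. cutoff x t (f u)"
    have "(\<Sum>x<C. ?b (Suc x) * psi B C (cutoff x t) (cutoff (col_height B (Suc x)) 0) (G, (v, w))) =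
      (\<Sum>x<C. \<Sum>f \<in> white G \<rightarrow>\<^sub>E {1..C}. \<Sum>g \<in> (black G - {w}) \<rightarrow>\<^sub>E {1..C}.
        ?b (Suc x) * (?c w f g * (of_bool (f v = Suc x) * ?p x f)))"
      by (intro sum.cong refl) (simp only: psi_column[OF wf B] lessThan_iff sum_distrib_left)
    also have "\<dots> = (\<Sum>f \<in> white G \<rightarrow>\<^sub>E {1..C}. \<Sum>x<C. \<Sum>g \<in> (black G - {w}) \<rightarrow>\<^sub>E {1..C}.
        ?b (Suc x) * (?c w f g * (of_bool (f v = Suc x) * ?p x f)))"
      by (rule sum.swap)
    also have "\<dots> = (\<Sum>f \<in> white G \<rightarrow>\<^sub>E {1..C}. \<Sum>g \<in> (black G - {w}) \<rightarrow>\<^sub>E {1..C}. \<Sum>x<C.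
        ?b (Suc x) * (?c w f g * (of_bool (f v = Suc x) * ?p x f)))"
      by (intro sum.cong refl sum.swap)
    also have "\<dots> = (\<Sum>f \<in> white G \<rightarrow>\<^sub>E {1..C}. \<Sum>g \<in> (black G - {w}) \<rightarrow>\<^sub>E {1..C}.
       ?c w f g * (?b (f v) * ?p (f v - 1) f))"
    proof (intro sum.cong refl)
      fix f g assume "f \<in> white G \<rightarrow>\<^sub>E {1..C}"
      then have fv: "f v \<in> {1..C}" using v by (rule PiE_mem)
      show "(\<Sum>x<C. ?b (Suc x) * (?c w f g * (of_bool (f v = Suc x) * ?p x f))) =
        ?c w f g * (?b (f v) * ?p (f v - 1) f)"
        using fv by (subst sum.remove[of "{..<C}" "f v - 1"]) (auto intro!: sum.neutral)
    qed
    finally show ?thesis .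
  qed
  have "(\<Sum>x<C. ?b (Suc x) * zop (psi B C (cutoff x t) (cutoff (col_height B (Suc x)) 0)) G) =
    (\<Sum>w\<in>black G. \<Sum>f \<in> white G \<rightarrow>\<^sub>E {1..C}. \<Sum>g \<in> (black G - {w}) \<rightarrow>\<^sub>E {1..C}. ?c w f g * ?h w t f)" for t
  proof -
    have "(\<Sum>x<C. ?b (Suc x) * zop (psi B C (cutoff x t) (cutoff (col_height B (Suc x)) 0)) G) =
      (\<Sum>w\<in>black G. \<Sum>v\<in>white_nbrs G w. \<Sum>x<C.
        ?b (Suc x) * psi B C (cutoff x t) (cutoff (col_height B (Suc x)) 0) (G, (v, w)))"
      unfolding zop_eq sum_distrib_left
      by (subst sum.swap) (intro sum.cong refl sum.swap)
    also have "\<dots> = (\<Sum>w\<in>black G. \<Sum>v\<in>white_nbrs G w. \<Sum>f \<in> white G \<rightarrow>\<^sub>E {1..C}. \<Sum>g \<in> (black G - {w}) \<rightarrow>\<^sub>E {1..C}.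
       ?c w f g * (?b (f v) * (\<Prod>u \<in> white_nbrs G w - {v}. cutoff (f v - 1) t (f u))))"
      by (intro sum.cong refl term_eq)
    also have "\<dots> = (\<Sum>w\<in>black G. \<Sum>f \<in> white G \<rightarrow>\<^sub>E {1..C}. \<Sum>v\<in>white_nbrs G w. \<Sum>g \<in> (black G - {w}) \<rightarrow>\<^sub>E {1..C}.
       ?c w f g * (?b (f v) * (\<Prod>u \<in> white_nbrs G w - {v}. cutoff (f v - 1) t (f u))))"
      by (intro sum.cong refl sum.swap)
    also have "\<dots> = (\<Sum>w\<in>black G. \<Sum>f \<in> white G \<rightarrow>\<^sub>E {1..C}. \<Sum>g \<in> (black G - {w}) \<rightarrow>\<^sub>E {1..C}. ?c w f g * ?h w t f)"
      unfolding sum_distrib_left by (intro sum.cong refl sum.swap)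
    finally show ?thesis .
  qed
  moreover have "real (card (black G)) * coloring_number B C G =
    (\<Sum>w\<in>black G. \<Sum>f \<in> white G \<rightarrow>\<^sub>E {1..C}. \<Sum>g \<in> (black G - {w}) \<rightarrow>\<^sub>E {1..C}.
       ?c w f g * real (card {j \<in> {1..C}. \<forall>u \<in> white_nbrs G w. (f u, j) \<in> B}))"
  proof -
    have "(\<Sum>w\<in>black G. coloring_number B C G) =
      (\<Sum>w\<in>black G. \<Sum>f \<in> white G \<rightarrow>\<^sub>E {1..C}. \<Sum>g \<in> (black G - {w}) \<rightarrow>\<^sub>E {1..C}.
       ?c w f g * real (card {j \<in> {1..C}. \<forall>u \<in> white_nbrs G w. (f u, j) \<in> B}))"
      by (intro sum.cong refl coloring_number_remove_black[OF G(1)])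
    then show ?thesis by simp
  qed
  moreover have "((\<lambda>t. \<Sum>w\<in>black G. \<Sum>f \<in> white G \<rightarrow>\<^sub>E {1..C}. \<Sum>g \<in> (black G - {w}) \<rightarrow>\<^sub>E {1..C}. ?c w f g * ?h w t f)
    has_integral (\<Sum>w\<in>black G. \<Sum>f \<in> white G \<rightarrow>\<^sub>E {1..C}. \<Sum>g \<in> (black G - {w}) \<rightarrow>\<^sub>E {1..C}.
       ?c w f g * real (card {j \<in> {1..C}. \<forall>u \<in> white_nbrs G w. (f u, j) \<in> B}))) {0..1}"
  proof (intro has_integral_sum has_integral_mult_right)
    fix w f assume w: "w \<in> black G" and f: "f \<in> white G \<rightarrow>\<^sub>E {1..C}"
    let ?A = "white_nbrs G w"
    have A: "finite ?A" "?A \<noteq> {}"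
      using finite_nbrs[OF G(1)] w G(2) by (auto simp: spanned_def white_nbrs_def)
    have fA: "f u \<in> {1..C}" if "u \<in> ?A" for u
      using f that nbrs_subset(1)[OF G(1), of w] by (auto simp: PiE_iff)
    have mem: "Max (f ` ?A) \<in> f ` ?A" using A by (intro Max_in) auto
    \<comment> \<open>Columns do not grow to the right, so the largest color imposes the strictest
      condition.\<close>
    have "(\<forall>u \<in> ?A. (f u, j) \<in> B) \<longleftrightarrow> (Max (f ` ?A), j) \<in> B" for j
    proof
      assume j: "(Max (f ` ?A), j) \<in> B"
      then have "1 \<le> j" using diagram_bounds[OF B] by blast
      then show "\<forall>u \<in> ?A. (f u, j) \<in> B"
        using diagram_down[OF B j] fA A by (metis Max_ge atLeastAtMost_iff finite_imageI image_eqI order_refl)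
    qed (use mem in auto)
    then have "{j \<in> {1..C}. \<forall>u \<in> ?A. (f u, j) \<in> B} = {j \<in> {1..C}. (Max (f ` ?A), j) \<in> B}" by simp
    also have "\<dots> = {j. (Max (f ` ?A), j) \<in> B}"
      using diagram_bounds[OF B] C by (auto intro: order_trans)
    finally have "card {j \<in> {1..C}. \<forall>u \<in> ?A. (f u, j) \<in> B} = col_height B (Max (f ` ?A))"
      by (simp only: col_height_def)
    then show "((\<lambda>t. ?h w t f) has_integral real (card {j \<in> {1..C}. \<forall>u \<in> ?A. (f u, j) \<in> B})) {0..1}"
      using max_color_integral[OF A, of f ?b] fA by simp
  qed (use fin in \<open>auto intro: finite_PiE\<close>)
  ultimately show ?thesis by (simp only:)
qed


section \<open>Green's formula for diagrams\<close>

section \<open>The functions \<open>S k\<close> as sums over boxes\<close>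

lemma has_integral_power_diff1:
  fixes a b c :: real
  assumes "a \<le> b"
  shows "((\<lambda>x. (x - c) ^ k) has_integral ((b - c) ^ Suc k - (a - c) ^ Suc k) / real (Suc k)) {a..b}"
proof -
  have "((\<lambda>x. (x - c) ^ k) has_integral (b - c) ^ Suc k / real (Suc k) - (a - c) ^ Suc k / real (Suc k)) {a..b}"
    using assms
    by (intro fundamental_theorem_of_calculus)
      (auto intro!: derivative_eq_intros simp del: power_Suc of_nat_Suc
        simp flip: has_real_derivative_iff_has_vector_derivative)
  then show ?thesis by (simp only: diff_divide_distrib)
qed

lemma has_integral_power_diff2:
  fixes a b c :: real
  assumes "a \<le> b"
  shows "((\<lambda>x. (c - x) ^ k) has_integral ((c - a) ^ Suc k - (c - b) ^ Suc k) / real (Suc k)) {a..b}"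
proof -
  have "((\<lambda>x. (c - x) ^ k) has_integral (- ((c - b) ^ Suc k / real (Suc k)) - (- ((c - a) ^ Suc k / real (Suc k))))) {a..b}"
    using assms
    by (intro fundamental_theorem_of_calculus)
      (auto intro!: derivative_eq_intros simp del: power_Suc of_nat_Suc
        simp flip: has_real_derivative_iff_has_vector_derivative)
  then show ?thesis by (simp add: diff_divide_distrib del: power_Suc of_nat_Suc)
qed

text \<open>The second difference of \<open>d ^ (k + 2)\<close> at the content
  \<open>d = i - j\<close>, that is, \<open>(k + 1) * (k + 2)\<close> times the integral of
  \<open>(x - y) ^ k\<close> over the box.\<close>

definition box_weight :: "nat \<Rightarrow> nat \<times> nat \<Rightarrow> real" where
  "box_weight k = (\<lambda>(i, j). (real i - real j + 1) ^ (k + 2) - 2 * (real i - real j) ^ (k + 2)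
     + (real i - real j - 1) ^ (k + 2))"

lemma has_integral_box:
  "((\<lambda>(x, y). (x - y) ^ k) has_integral box_weight k (i, j) / (real (k + 1) * real (k + 2)))
     ({real i - 1..real i} \<times> {real j - 1..real j})"
proof -
  let ?f = "\<lambda>(x::real, y::real). (x - y) ^ k"
  let ?d = "real i - real j"
  have cont: "continuous_on X ?f" for X
    unfolding split_def by (intro continuous_intros)
  have "integral (cbox (real i - 1, real j - 1) (real i, real j)) ?f =
      integral {real i - 1..real i} (\<lambda>x. integral {real j - 1..real j} (\<lambda>y. (x - y) ^ k))"
    using integral_prod_continuous[OF cont] by simp
  also have "\<dots> = integral {real i - 1..real i}
      (\<lambda>x. (x - (real j - 1)) ^ Suc k / real (Suc k) - (x - real j) ^ Suc k / real (Suc k))"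
    by (intro integral_cong integral_unique)
      (simp only: has_integral_power_diff2[of "real j - 1" "real j"] diff_divide_distrib[symmetric])
  also have "\<dots> = ((real i - (real j - 1)) ^ Suc (Suc k) - (real i - 1 - (real j - 1)) ^ Suc (Suc k))
        / real (Suc (Suc k)) / real (Suc k)
      - ((real i - real j) ^ Suc (Suc k) - (real i - 1 - real j) ^ Suc (Suc k))
        / real (Suc (Suc k)) / real (Suc k)"
    by (intro integral_unique has_integral_diff has_integral_divide has_integral_power_diff1) auto
  also have "\<dots> = box_weight k (i, j) / (real (k + 1) * real (k + 2))"
  proof -
    have e: "real i - (real j - 1) = ?d + 1" "real i - 1 - (real j - 1) = ?d"
      "real i - 1 - real j = ?d - 1" "Suc (Suc k) = k + 2" "Suc k = k + 1"
      by auto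
    show ?thesis
      unfolding e box_weight_def prod.case
      by (simp add: field_simps del: of_nat_Suc of_nat_add power_Suc)
  qed
  finally have "integral (cbox (real i - 1, real j - 1) (real i, real j)) ?f =
      box_weight k (i, j) / (real (k + 1) * real (k + 2))" .
  moreover have "?f integrable_on cbox (real i - 1, real j - 1) (real i, real j)"
    by (intro integrable_continuous cont)
  ultimately have "(?f has_integral box_weight k (i, j) / (real (k + 1) * real (k + 2)))
      (cbox (real i - 1, real j - 1) (real i, real j))"
    unfolding has_integral_iff by (intro conjI)
  then have "(?f has_integral box_weight k (i, j) / (real (k + 1) * real (k + 2)))
      (cbox (real i - 1) (real i) \<times> cbox (real j - 1) (real j))"
    by (simp only: cbox_Pair_eq)
  then show ?thesis by (simp only: cbox_interval)
qed

lemma S_eq_sum: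
  "S (k + 2) \<nu> = (\<Sum>p \<in> boxes \<nu>. box_weight k p) / real (k + 2)"
proof -
  have fin: "finite (boxes \<nu>)" using boxes[of \<nu>] by simp
  let ?Q = "\<lambda>(i, j). {real i - 1..real i} \<times> {real j - 1..real j}"
  have neg: "negligible (?Q p \<inter> ?Q q)" if "p \<noteq> q" for p q :: "nat \<times> nat"
  proof -
    obtain i j i' j' where pq: "p = (i, j)" "q = (i', j')" by (metis prod.exhaust)
    have hyp: "negligible {x :: real \<times> real. x \<bullet> (1, 0) = c}" "negligible {x :: real \<times> real. x \<bullet> (0, 1) = c}" for c
      by (intro negligible_standard_hyperplane; simp add: Basis_prod_def)+
    show ?thesis
    proof (cases "i = i'")
      case True
      \<comment> \<open>Distinct squares of one column can meet only in the upper side of the lower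
        square.\<close>
      then have "?Q p \<inter> ?Q q \<subseteq> {x. x \<bullet> (0, 1) = real (min j j')}"
        using that by (auto simp: pq min_def not_le)
      then show ?thesis by (rule negligible_subset[OF hyp(2)])
    next
      case False
      then have "?Q p \<inter> ?Q q \<subseteq> {x. x \<bullet> (1, 0) = real (min i i')}"
        by (auto simp: pq min_def not_le)
      then show ?thesis by (rule negligible_subset[OF hyp(1)])
    qed
  qed
  have "((\<lambda>(x, y). (x - y) ^ k) has_integral
      (\<Sum>p \<in> boxes \<nu>. box_weight k p / (real (k + 1) * real (k + 2)))) (\<Union>p \<in> boxes \<nu>. ?Q p)"
  proof (rule has_integral_UN[OF fin])
    show "((\<lambda>(x, y). (x - y) ^ k) has_integral box_weight k p / (real (k + 1) * real (k + 2))) (?Q p)" for p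
      using has_integral_box[of k "fst p" "snd p"] by (simp add: split_def)
    show "pairwise (\<lambda>p q. negligible (?Q p \<inter> ?Q q)) (boxes \<nu>)"
      using neg by (simp add: pairwise_def)
  qed
  then have "integral (region \<nu>) (\<lambda>(x, y). (x - y) ^ k) =
      (\<Sum>p \<in> boxes \<nu>. box_weight k p) / (real (k + 1) * real (k + 2))"
    unfolding region_def by (simp add: integral_unique sum_divide_distrib)
  then show ?thesis by (simp add: S_def)
qed

text \<open>Discrete form of Green's formula for the vector field \<open>(x - y) ^ k (x, y)\<close>: both sums telescope.\<close>

lemma boundary_sum_eq_box_sum:
  assumes B: "diagram M B" and C: "M \<le> C"
  shows "(\<Sum>x<C. real (col_height B (Suc x)) *
      ((real x - real (col_height B (Suc x)) + 1) ^ Suc k - (real x - real (col_height B (Suc x))) ^ Suc k))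
    + (\<Sum>y<C. real (col_height (B\<inverse>) (Suc y)) *
      ((real (col_height (B\<inverse>) (Suc y)) - real y) ^ Suc k
        - (real (col_height (B\<inverse>) (Suc y)) - real y - 1) ^ Suc k))
    = (\<Sum>p\<in>B. box_weight k p)"
proof -
  let ?g = "\<lambda>x j. real j * ((real x - real j + 1) ^ Suc k - (real x - real j) ^ Suc k)"
  let ?h = "\<lambda>y i. real i * ((real i - real y) ^ Suc k - (real i - real y - 1) ^ Suc k)"
  have B1: "B = (\<lambda>(x, j). (Suc x, Suc j)) ` (SIGMA x:{..<C}. {..<col_height B (Suc x)})"
  proof (intro equalityI subsetI)
    fix p assume p: "p \<in> B"
    obtain i j where ij: "p = (i, j)" by (cases p)
    have "1 \<le> i" "i \<le> C" "1 \<le> j" using p diagram_bounds[OF B] C unfolding ij by force+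
    moreover have "j \<le> col_height B i" using p diagram_column[OF B] unfolding ij by blast
    ultimately show "p \<in> (\<lambda>(x, j). (Suc x, Suc j)) ` (SIGMA x:{..<C}. {..<col_height B (Suc x)})"
      unfolding ij by (intro image_eqI[of _ _ "(i - 1, j - 1)"]) auto
  qed (use diagram_column[OF B] in auto)
  have B2: "B = (\<lambda>(y, i). (Suc i, Suc y)) ` (SIGMA y:{..<C}. {..<col_height (B\<inverse>) (Suc y)})"
  proof (intro equalityI subsetI)
    fix p assume p: "p \<in> B"
    obtain i j where ij: "p = (i, j)" by (cases p)
    have "1 \<le> i" "1 \<le> j" "j \<le> C" using p diagram_bounds[OF B] C unfolding ij by force+
    moreover have "i \<le> col_height (B\<inverse>) j" using p diagram_row[OF B] unfolding ij by blast
    ultimately show "p \<in> (\<lambda>(y, i). (Suc i, Suc y)) ` (SIGMA y:{..<C}. {..<col_height (B\<inverse>) (Suc y)})"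
      unfolding ij by (intro image_eqI[of _ _ "(j - 1, i - 1)"]) auto
  qed (use diagram_row[OF B] in auto)
  have sum1: "(\<Sum>p\<in>B. F p) = (\<Sum>x<C. \<Sum>j<col_height B (Suc x). F (Suc x, Suc j))" for F :: "nat \<times> nat \<Rightarrow> real"
  proof -
    have "(\<Sum>p\<in>B. F p) = (\<Sum>p\<in>(\<lambda>(x, j). (Suc x, Suc j)) ` (SIGMA x:{..<C}. {..<col_height B (Suc x)}). F p)"
      by (rule arg_cong[OF B1])
    also have "\<dots> = (\<Sum>(x, j)\<in>(SIGMA x:{..<C}. {..<col_height B (Suc x)}). F (Suc x, Suc j))"
      by (subst sum.reindex) (auto simp: inj_on_def split_def)
    finally show ?thesis by (subst sum.Sigma) auto
  qed
  have sum2: "(\<Sum>p\<in>B. F p) = (\<Sum>y<C. \<Sum>i<col_height (B\<inverse>) (Suc y). F (Suc i, Suc y))" for F :: "nat \<times> nat \<Rightarrow> real"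
  proof -
    have "(\<Sum>p\<in>B. F p) = (\<Sum>p\<in>(\<lambda>(y, i). (Suc i, Suc y)) ` (SIGMA y:{..<C}. {..<col_height (B\<inverse>) (Suc y)}). F p)"
      by (rule arg_cong[OF B2])
    also have "\<dots> = (\<Sum>(y, i)\<in>(SIGMA y:{..<C}. {..<col_height (B\<inverse>) (Suc y)}). F (Suc i, Suc y))"
      by (subst sum.reindex) (auto simp: inj_on_def split_def)
    finally show ?thesis by (subst sum.Sigma) auto
  qed
  \<comment> \<open>The factors \<open>real j\<close> and \<open>real i\<close> make both
    expressions vanish at 0, so only the upper end of the telescope remains.\<close>
  have tele: "(\<Sum>j<m. ?g x (Suc j) - ?g x j) = ?g x m" "(\<Sum>i<m. ?h y (Suc i) - ?h y i) = ?h y m" for x y m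
    using sum_lessThan_telescope[of "?g x" m] sum_lessThan_telescope[of "?h y" m]
    by (simp_all only: of_nat_0 mult_zero_left diff_zero)
  have "(\<Sum>x<C. ?g x (col_height B (Suc x))) =
      (\<Sum>x<C. \<Sum>j<col_height B (Suc x). ?g x (Suc j) - ?g x j)"
    by (simp only: tele)
  also have "\<dots> = (\<Sum>p\<in>B. ?g (fst p - 1) (snd p) - ?g (fst p - 1) (snd p - 1))"
    by (simp only: sum1 fst_conv snd_conv diff_Suc_1)
  finally have g: "(\<Sum>x<C. ?g x (col_height B (Suc x))) =
      (\<Sum>p\<in>B. ?g (fst p - 1) (snd p) - ?g (fst p - 1) (snd p - 1))" .
  have "(\<Sum>y<C. ?h y (col_height (B\<inverse>) (Suc y))) =
      (\<Sum>y<C. \<Sum>i<col_height (B\<inverse>) (Suc y). ?h y (Suc i) - ?h y i)"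
    by (simp only: tele)
  also have "\<dots> = (\<Sum>p\<in>B. ?h (snd p - 1) (fst p) - ?h (snd p - 1) (fst p - 1))"
    by (simp only: sum2 fst_conv snd_conv diff_Suc_1)
  finally have h: "(\<Sum>y<C. ?h y (col_height (B\<inverse>) (Suc y))) =
      (\<Sum>p\<in>B. ?h (snd p - 1) (fst p) - ?h (snd p - 1) (fst p - 1))" .
  have "?g (fst p - 1) (snd p) - ?g (fst p - 1) (snd p - 1)
      + (?h (snd p - 1) (fst p) - ?h (snd p - 1) (fst p - 1)) = box_weight k p" if "p \<in> B" for p
  proof -
    obtain i j where ij: "p = (i, j)" by (cases p)
    define x y where "x = i - 1" and "y = j - 1"
    have p: "p = (Suc x, Suc y)"
      using that diagram_bounds[OF B, of i j] by (simp add: ij x_def y_def)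
    define d where "d = real x - real y"
    define a0 ap am where "a0 = d ^ Suc k" and "ap = (d + 1) ^ Suc k" and "am = (d - 1) ^ Suc k"
    have e: "real x - real (Suc y) + 1 = d" "real x - real (Suc y) = d - 1"
      "real (Suc x) - real y = d + 1" "d + 1 - 1 = d" "d - 1 + 1 = d"
      "real (Suc x) - real (Suc y) = d" "real x - real y = d"
      by (simp_all add: d_def)
    have w: "d ^ (k + 2) = d * a0" "(d + 1) ^ (k + 2) = (d + 1) * ap" "(d - 1) ^ (k + 2) = (d - 1) * am"
      by (simp_all add: a0_def ap_def am_def)
    \<comment> \<open>The coefficients of the three powers depend on \<open>x\<close> and
      \<open>y\<close> only through \<open>d = x - y\<close>.\<close>
    have "real (Suc y) * (a0 - am) - real y * (ap - a0) + (real (Suc x) * (ap - a0) - real x * (a0 - am)) =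
        (d + 1) * ap - 2 * (d * a0) + (d - 1) * am"
      by (simp add: d_def algebra_simps)
    then show ?thesis
      unfolding p box_weight_def prod.case fst_conv snd_conv diff_Suc_1 e w
        a0_def[symmetric] ap_def[symmetric] am_def[symmetric] .
  qed
  then show ?thesis
    unfolding g h sum.distrib[symmetric] by (intro sum.cong refl)
qed


section \<open>Numbers of colorings\<close>

lemma N_eq_0_if_not_spanned:
  assumes G: "finite_bigraph G" and ns: "\<not> spanned G"
  shows "N G \<nu> = 0"
proof (rule ccontr)
  assume "N G \<nu> \<noteq> 0"
  then have fin: "finite (compatible_colorings G \<nu>)" and "compatible_colorings G \<nu> \<noteq> {}"
    unfolding N_def by (auto simp: card_eq_0_iff)
  then obtain h where h: "h \<in> compatible_colorings G \<nu>" by blast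
  have "fst ` edges G \<subseteq> white G" "snd ` edges G \<subseteq> black G"
    using G by (force simp: finite_bigraph_def)+
  then obtain a where a: "a \<in> white G <+> black G" "\<And>u b. (u, b) \<in> edges G \<Longrightarrow> a \<noteq> Inl u \<and> a \<noteq> Inr b"
    using ns unfolding spanned_def by (metis (no_types, lifting) InlI InrI fst_conv image_eqI
        snd_conv subsetI subset_antisym sum.inject sum.distinct)
  have "h(a := n) \<in> compatible_colorings G \<nu>" if "n \<ge> 1" for n
  proof -
    have "(h(a := n)) (Inl u) = h (Inl u)" "(h(a := n)) (Inr b) = h (Inr b)" if "(u, b) \<in> edges G" for u b
      using a(2)[OF that] by auto
    moreover have "h(a := n) \<in> (white G <+> black G) \<rightarrow>\<^sub>E {1..}"
      using h a(1) that by (auto simp: compatible_colorings_def PiE_iff extensional_def)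
    ultimately show ?thesis
      using h unfolding compatible_colorings_def by (auto simp del: fun_upd_apply)
  qed
  then have "(\<lambda>n. h(a := n)) ` {1..} \<subseteq> compatible_colorings G \<nu>" by auto
  then have "finite ((\<lambda>n. h(a := n)) ` {1..})" using fin by (rule finite_subset)
  moreover have "inj_on (\<lambda>n. h(a := n)) {1..}" by (auto simp: inj_on_def fun_upd_eqD)
  ultimately have "finite {1 :: nat..}" by (rule finite_imageD)
  then show False using infinite_Ici by blast
qed

text \<open>Every vertex lies on an edge, so compatibility alone keeps all colors within
  \<open>{1..C}\<close>.\<close>

lemma N_eq_coloring_number:
  assumes G: "finite_bigraph G" "spanned G" and B: "diagram C (boxes \<nu>)"
  shows "real (N G \<nu>) = coloring_number (boxes \<nu>) C G"
proof -
  let ?F = "white G \<rightarrow>\<^sub>E {1..C}" and ?K = "black G \<rightarrow>\<^sub>E {1..C}"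
  let ?P = "\<lambda>(f, g). \<forall>u b. (u, b) \<in> edges G \<longrightarrow> (f u, g b) \<in> boxes \<nu>"
  have fin: "finite ?F" "finite ?K" using G by (auto simp: finite_bigraph_def intro!: finite_PiE)
  have "coloring_number (boxes \<nu>) C G = (\<Sum>p \<in> ?F \<times> ?K. if ?P p then 1 else 0)"
    by (simp add: coloring_number_def sum.cartesian_product split_def of_bool_def)
  also have "\<dots> = real (card {p \<in> ?F \<times> ?K. ?P p})"
    using fin by (subst sum.inter_filter[symmetric]) auto
  also have "card {p \<in> ?F \<times> ?K. ?P p} = card (compatible_colorings G \<nu>)"
  proof (rule bij_betw_same_card, rule bij_betw_byWitness)
    let ?s = "\<lambda>(f, g). case_sum f g"
    let ?t = "\<lambda>h :: 'a + 'b \<Rightarrow> nat. (\<lambda>u. h (Inl u), \<lambda>b. h (Inr b))"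
    show "\<forall>p\<in>{p \<in> ?F \<times> ?K. ?P p}. ?t (?s p) = p" by auto
    show "\<forall>h\<in>compatible_colorings G \<nu>. ?s (?t h) = h" by (auto simp: fun_eq_iff split: sum.split)
    show "?s ` {p \<in> ?F \<times> ?K. ?P p} \<subseteq> compatible_colorings G \<nu>"
      by (fastforce simp: compatible_colorings_def PiE_iff extensional_def split: sum.split)
    show "?t ` compatible_colorings G \<nu> \<subseteq> {p \<in> ?F \<times> ?K. ?P p}"
    proof (intro image_subsetI)
      fix h assume h: "h \<in> compatible_colorings G \<nu>"
      then have e: "(h (Inl u), h (Inr b)) \<in> boxes \<nu>" if "(u, b) \<in> edges G" for u b
        using that by (auto simp: compatible_colorings_def)
      have "h (Inl u) \<in> {1..C}" if "u \<in> white G" for u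
      proof -
        from that G(2) have "u \<in> fst ` edges G" by (simp add: spanned_def)
        then obtain z where "z \<in> edges G" "u = fst z" by (rule imageE)
        then show ?thesis using diagram_bounds[OF B e[of u "snd z"]] by simp
      qed
      moreover have "h (Inr b) \<in> {1..C}" if "b \<in> black G" for b
      proof -
        from that G(2) have "b \<in> snd ` edges G" by (simp add: spanned_def)
        then obtain z where "z \<in> edges G" "b = snd z" by (rule imageE)
        then show ?thesis using diagram_bounds[OF B e[of "fst z" b]] by simp
      qed
      moreover have "h (Inl u) = undefined" if "u \<notin> white G" for u
        using h that by (auto simp: compatible_colorings_def PiE_iff extensional_def)
      moreover have "h (Inr b) = undefined" if "b \<notin> black G" for b
        using h that by (auto simp: compatible_colorings_def PiE_iff extensional_def)
      ultimately show "?t h \<in> {p \<in> ?F \<times> ?K. ?P p}"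
        using e by (auto simp: PiE_iff extensional_def)
    qed
  qed
  finally show ?thesis by (simp add: N_def)
qed


section \<open>One polynomial along the whole boundary, and the resulting recursion\<close>

section \<open>The content polynomial\<close>

text \<open>
  Taylor polynomial, at the lattice point \<open>(x, y)\<close> of the boundary, of the weighted number of
  colorings with the decorated edge on the boundary, as a function of the content.
\<close>

definition boundary_poly :: "(('w, 'b) bigraph \<Rightarrow>\<^sub>0 real) \<Rightarrow> (nat \<times> nat) set \<Rightarrow> nat \<Rightarrow> nat
    \<Rightarrow> nat \<Rightarrow> nat \<Rightarrow> real \<Rightarrow> real" where
  "boundary_poly \<G> B C K x y t =
     (\<Sum>k\<le>K. t ^ k / fact k * pairing \<G> (zop ((xop ^^ k) (psi B C (cutoff x 0) (cutoff y 0)))))"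

lemma zop_sum: "zop (\<lambda>D. \<Sum>k\<in>I. c k * \<psi> k D) G = (\<Sum>k\<in>I. c k * zop (\<psi> k) G)"
  unfolding zop_def sum_distrib_left by (rule sum.swap)

context
  fixes \<G> :: "('w, 'b) bigraph \<Rightarrow>\<^sub>0 real" and B :: "(nat \<times> nat) set" and M K :: nat
  assumes graphs: "\<And>G. G \<in> Poly_Mapping.keys \<G> \<Longrightarrow>
      finite_bigraph G \<and> spanned G \<and> card (white G) \<le> K \<and> card (black G) \<le> K"
    and bal: "xy_balanced \<G>"
    and B: "diagram M B"
begin

abbreviation "boundary x y \<equiv> boundary_poly \<G> B (Suc M) K x y"

text \<open>Two Taylor expansions of the same function of \<open>t\<close>: about
  \<open>s = 0\<close> it gives the polynomial at \<open>(x, y)\<close>, about \<open>s = 1\<close>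
  the one at \<open>(x + 1, y)\<close>, because
  \<open>cutoff x 1 = cutoff (Suc x) 0\<close>.\<close>

lemma horizontal_step:
  assumes x: "x \<le> M" and step: "\<And>j. j \<in> {1..Suc M} \<Longrightarrow> (Suc x, j) \<in> B \<longleftrightarrow> j \<le> y"
  shows "pairing \<G> (zop (psi B (Suc M) (cutoff x t) (cutoff y 0))) = boundary x y t"
    and "boundary (Suc x) y (t - 1) = boundary x y t"
proof -
  have taylor: "pairing \<G> (zop (psi B (Suc M) (cutoff x t) (cutoff y 0))) =
      (\<Sum>k\<le>K. (t - s) ^ k / fact k * pairing \<G> (zop ((xop ^^ k) (psi B (Suc M) (cutoff x s) (cutoff y 0)))))"
    for s
  proof -
    have "pairing \<G> (zop (psi B (Suc M) (cutoff x t) (cutoff y 0))) =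
        pairing \<G> (\<lambda>G. \<Sum>k\<le>K. (t - s) ^ k / fact k *
          zop ((xop ^^ k) (psi B (Suc M) (cutoff x s) (cutoff y 0))) G)"
    proof (rule pairing_cong)
      fix G assume G: "G \<in> Poly_Mapping.keys \<G>"
      have "zop (psi B (Suc M) (cutoff x t) (cutoff y 0)) G =
          zop (\<lambda>D. \<Sum>k\<le>K. (t - s) ^ k / fact k * (xop ^^ k) (psi B (Suc M) (cutoff x s) (cutoff y 0)) D) G"
        unfolding zop_def using graphs[OF G] x
        by (intro sum.cong refl psi_taylor_x step) (auto simp: wf_decorated_def)
      then show "zop (psi B (Suc M) (cutoff x t) (cutoff y 0)) G = (\<Sum>k\<le>K. (t - s) ^ k / fact k *
          zop ((xop ^^ k) (psi B (Suc M) (cutoff x s) (cutoff y 0))) G)"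
        by (simp only: zop_sum)
    qed
    then show ?thesis by (simp only: pairing_fun_sum pairing_fun_scale)
  qed
  show 1: "pairing \<G> (zop (psi B (Suc M) (cutoff x t) (cutoff y 0))) = boundary x y t"
    using taylor[of 0] by (simp add: boundary_poly_def)
  show "boundary (Suc x) y (t - 1) = boundary x y t"
    unfolding 1[symmetric] using taylor[of 1] by (simp add: boundary_poly_def cutoff_1)
qed

lemma vertical_step:
  assumes y: "y \<le> M" and step: "\<And>i. i \<in> {1..Suc M} \<Longrightarrow> (i, Suc y) \<in> B \<longleftrightarrow> i \<le> x"
  shows "pairing \<G> (zop (psi B (Suc M) (cutoff x 0) (cutoff y t))) = boundary x y (- t)"
    and "boundary x (Suc y) (1 - t) = boundary x y (- t)"
proof -
  have taylor: "pairing \<G> (zop (psi B (Suc M) (cutoff x 0) (cutoff y t))) =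
      (\<Sum>k\<le>K. (s - t) ^ k / fact k * pairing \<G> (zop ((xop ^^ k) (psi B (Suc M) (cutoff x 0) (cutoff y s)))))"
    for s
  proof -
    have "pairing \<G> (zop (psi B (Suc M) (cutoff x 0) (cutoff y t))) =
        pairing \<G> (\<lambda>G. \<Sum>k\<le>K. (s - t) ^ k / fact k *
          zop ((yop ^^ k) (psi B (Suc M) (cutoff x 0) (cutoff y s))) G)"
    proof (rule pairing_cong)
      fix G assume G: "G \<in> Poly_Mapping.keys \<G>"
      have "zop (psi B (Suc M) (cutoff x 0) (cutoff y t)) G =
          zop (\<lambda>D. \<Sum>k\<le>K. (s - t) ^ k / fact k * (yop ^^ k) (psi B (Suc M) (cutoff x 0) (cutoff y s)) D) G"
        unfolding zop_def using graphs[OF G] y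
        by (intro sum.cong refl psi_taylor_y step) (auto simp: wf_decorated_def)
      then show "zop (psi B (Suc M) (cutoff x 0) (cutoff y t)) G = (\<Sum>k\<le>K. (s - t) ^ k / fact k *
          zop ((yop ^^ k) (psi B (Suc M) (cutoff x 0) (cutoff y s))) G)"
        by (simp only: zop_sum)
    qed
    then have "pairing \<G> (zop (psi B (Suc M) (cutoff x 0) (cutoff y t))) =
      (\<Sum>k\<le>K. (s - t) ^ k / fact k * pairing \<G> (zop ((yop ^^ k) (psi B (Suc M) (cutoff x 0) (cutoff y s)))))"
      by (simp only: pairing_fun_sum pairing_fun_scale)
    \<comment> \<open>Here the hypothesis on \<open>\<G>\<close> enters: powers of
      \<open>yop\<close> are exchanged for the powers of \<open>xop\<close> in
      \<open>boundary_poly\<close>.\<close>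
    moreover have "pairing \<G> (zop ((yop ^^ k) (psi B (Suc M) (cutoff x 0) (cutoff y s)))) =
        pairing \<G> (zop ((xop ^^ k) (psi B (Suc M) (cutoff x 0) (cutoff y s))))" for k
      using bal iso_invariant_psi unfolding xy_balanced_def by metis
    ultimately show ?thesis by (simp only:)
  qed
  show 1: "pairing \<G> (zop (psi B (Suc M) (cutoff x 0) (cutoff y t))) = boundary x y (- t)"
    using taylor[of 0] by (simp add: boundary_poly_def)
  show "boundary x (Suc y) (1 - t) = boundary x y (- t)"
    unfolding 1[symmetric] using taylor[of 1] by (simp add: boundary_poly_def cutoff_1)
qed

text \<open>The last two assumptions place the lattice point \<open>(x, y)\<close> on the boundary,
  which includes the axes outside the diagram. From there the boundary is followed down and to the
  right to \<open>(M, 0)\<close>; \<open>y + (M - x)\<close> drops by one with each edge.\<close>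

lemma boundary_poly_path:
  assumes "x \<le> M" "y \<le> M" "(Suc x, Suc y) \<notin> B" "x = 0 \<or> y = 0 \<or> (x, y) \<in> B"
  shows "boundary x y (z - (real x - real y)) = boundary M 0 (z - real M)"
  using assms
proof (induction "y + (M - x)" arbitrary: x y rule: less_induct)
  case less
  have out: "(Suc M, y) \<notin> B" using diagram_bounds[OF B, of "Suc M" y] by auto
  \<comment> \<open>The path goes down if the box to the lower right of \<open>(x, y)\<close> is
    missing, otherwise right.\<close>
  consider (vertical) y' where "y = Suc y'" "(Suc x, y) \<notin> B"
    | (horizontal) "x < M" "y = 0 \<or> (Suc x, y) \<in> B"
    | (far) "x = M" "y = 0"
    using less.prems(1) out by (cases y) (auto simp: le_less)
  then show ?case
  proof cases
    case vertical
    have xy: "x = 0 \<or> (x, Suc y') \<in> B" using less.prems(4) vertical(1) by simp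
    have step: "(i, Suc y') \<in> B \<longleftrightarrow> i \<le> x" if "i \<in> {1..Suc M}" for i
    proof
      assume i: "(i, Suc y') \<in> B"
      show "i \<le> x"
      proof (rule ccontr)
        assume "\<not> i \<le> x"
        then have "(Suc x, Suc y') \<in> B" using diagram_down[OF B i, of "Suc x" "Suc y'"] by simp
        then show False using vertical by simp
      qed
    next
      assume "i \<le> x"
      then show "(i, Suc y') \<in> B"
        using xy that diagram_down[OF B, of x "Suc y'" i "Suc y'"] by auto
    qed
    have "x = 0 \<or> y' = 0 \<or> (x, y') \<in> B"
      using xy diagram_down[OF B, of x "Suc y'" x y'] diagram_bounds[OF B, of x "Suc y'"]
      by (cases y') auto
    then have "boundary x y' (z - (real x - real y')) = boundary M 0 (z - real M)"
      using less.prems vertical by (intro less.hyps) auto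
    moreover have "boundary x (Suc y') (1 - (real x - real y' - z)) = boundary x y' (- (real x - real y' - z))"
      using less.prems vertical by (intro vertical_step step) auto
    ultimately show ?thesis by (simp add: vertical(1) algebra_simps)
  next
    case horizontal
    have step: "(Suc x, j) \<in> B \<longleftrightarrow> j \<le> y" if "j \<in> {1..Suc M}" for j
    proof
      assume j: "(Suc x, j) \<in> B"
      show "j \<le> y"
      proof (rule ccontr)
        assume "\<not> j \<le> y"
        then have "(Suc x, Suc y) \<in> B" using diagram_down[OF B j, of "Suc x" "Suc y"] by simp
        then show False using less.prems by simp
      qed
    next
      assume "j \<le> y"
      then show "(Suc x, j) \<in> B"
        using horizontal that diagram_down[OF B, of "Suc x" y "Suc x" j] by auto
    qed
    have "(Suc (Suc x), Suc y) \<notin> B"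
      using less.prems(3) diagram_down[OF B, of "Suc (Suc x)" "Suc y" "Suc x" "Suc y"] by auto
    then have "boundary (Suc x) y (z - (real (Suc x) - real y)) = boundary M 0 (z - real M)"
      using less.prems horizontal by (intro less.hyps) auto
    moreover have "boundary (Suc x) y (z - (real x - real y) - 1) = boundary x y (z - (real x - real y))"
      using horizontal by (intro horizontal_step step) auto
    ultimately show ?thesis by (simp add: algebra_simps)
  qed simp
qed

text \<open>Column \<open>M + 1\<close> is empty, so the boundary below it is the axis
  \<open>y = 0\<close>. The weight \<open>t = z - M\<close> may be any real number, which gives the
  polynomial identity for all \<open>z\<close>.\<close>

lemma boundary_poly_far:
  "boundary M 0 (z - real M) =
     (\<Sum>k<K. z ^ k * pairing (strip_comb k \<G>) (coloring_number B (Suc M)))"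
proof -
  have step: "(Suc M, j) \<in> B \<longleftrightarrow> j \<le> 0" if "j \<in> {1..Suc M}" for j
    using that diagram_bounds[OF B, of "Suc M" j] by auto
  have "boundary M 0 (z - real M) = pairing \<G> (zop (psi B (Suc M) (cutoff M (z - real M)) (cutoff 0 0)))"
    using step by (intro horizontal_step(1)[symmetric]) auto
  also have "\<dots> = pairing \<G> (\<lambda>G. \<Sum>k<K. z ^ k * strip_op k (coloring_number B (Suc M)) G)"
  proof (rule pairing_cong)
    fix G assume "G \<in> Poly_Mapping.keys \<G>"
    then have "finite_bigraph G" "card (white G) \<le> K" using graphs by auto
    from zop_psi_far[OF this(1) B this(2), of "z - real M"]
    show "zop (psi B (Suc M) (cutoff M (z - real M)) (cutoff 0 0)) G =
        (\<Sum>k<K. z ^ k * strip_op k (coloring_number B (Suc M)) G)" by simp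
  qed
  finally show ?thesis
    by (simp only: pairing_fun_sum pairing_fun_scale pairing_strip_comb)
qed

text \<open>The horizontal and the vertical part of the boundary integral are each evaluated twice:
  as vertex counts by \<open>column_integral\<close>, and termwise in the coefficients
  \<open>c k\<close>, where integrating \<open>z ^ k\<close> produces \<open>1 / (k + 1)\<close>.
  Uniqueness of the integral equates the results.\<close>

lemma vertex_count_pairing:
  "pairing \<G> (\<lambda>G. real (vertex_count G) * coloring_number B (Suc M) G) =
     (\<Sum>k<K. pairing (strip_comb k \<G>) (coloring_number B (Suc M)) / real (k + 1) * (\<Sum>p\<in>B. box_weight k p))"
proof -
  let ?C = "Suc M"
  define c where "c k = pairing (strip_comb k \<G>) (coloring_number B ?C)" for k
  define b where "b x = col_height B (Suc x)" for x
  define a where "a y = col_height (B\<inverse>) (Suc y)" for y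
  have bM: "b x \<le> M" and aM: "a y \<le> M" for x y
    using col_height_le[OF B] col_height_le[OF diagram_converse[OF B]] by (auto simp: a_def b_def)
  have col: "(Suc x, j) \<in> B \<longleftrightarrow> 1 \<le> j \<and> j \<le> b x" for x j
    using diagram_column[OF B] by (simp add: b_def)
  have row: "(i, Suc y) \<in> B \<longleftrightarrow> 1 \<le> i \<and> i \<le> a y" for y i
    using diagram_row[OF B] by (simp add: a_def)
  have b_eq: "pairing \<G> (zop (psi B ?C (cutoff x t) (cutoff (b x) 0))) =
      (\<Sum>k<K. c k * (t - (real (b x) - real x)) ^ k)" if "x < ?C" for x t
  proof -
    have "pairing \<G> (zop (psi B ?C (cutoff x t) (cutoff (b x) 0))) = boundary x (b x) t"
      using that col by (intro horizontal_step) auto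
    also have "\<dots> = boundary x (b x) (t + real x - real (b x) - (real x - real (b x)))" by simp
    also have "\<dots> = boundary M 0 (t + real x - real (b x) - real M)"
    proof (rule boundary_poly_path)
      show "x = 0 \<or> b x = 0 \<or> (x, b x) \<in> B"
        using col[of x "b x"] diagram_down[OF B, of "Suc x" "b x" x "b x"] by auto
    qed (use that bM col in auto)
    finally show ?thesis
      unfolding boundary_poly_far c_def[symmetric] by (simp add: algebra_simps)
  qed
  have a_eq: "pairing \<G> (zop (psi B ?C (cutoff (a y) 0) (cutoff y t))) =
      (\<Sum>k<K. c k * ((real (a y) - real y) - t) ^ k)" if "y < ?C" for y t
  proof -
    have "pairing \<G> (zop (psi B ?C (cutoff (a y) 0) (cutoff y t))) = boundary (a y) y (- t)"
      using that row by (intro vertical_step) auto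
    also have "\<dots> = boundary (a y) y (real (a y) - real y - t - (real (a y) - real y))" by simp
    also have "\<dots> = boundary M 0 (real (a y) - real y - t - real M)"
    proof (rule boundary_poly_path)
      show "a y = 0 \<or> y = 0 \<or> (a y, y) \<in> B"
        using row[of "a y" y] diagram_down[OF B, of "a y" "Suc y" "a y" y] by (cases y) auto
    qed (use that aM row in auto)
    finally show ?thesis
      unfolding boundary_poly_far c_def[symmetric] by (simp add: algebra_simps)
  qed
  have "((\<lambda>t. \<Sum>x<?C. real (b x) * pairing \<G> (zop (psi B ?C (cutoff x t) (cutoff (b x) 0))))
      has_integral pairing \<G> (\<lambda>G. real (card (black G)) * coloring_number B ?C G)) {0..1}"
  proof -
    have "((\<lambda>t. pairing \<G> (\<lambda>G. \<Sum>x<?C. real (b x) * zop (psi B ?C (cutoff x t) (cutoff (b x) 0)) G))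
      has_integral pairing \<G> (\<lambda>G. real (card (black G)) * coloring_number B ?C G)) {0..1}"
      unfolding pairing_def b_def using graphs
      by (intro has_integral_sum has_integral_mult_right column_integral[OF _ _ B]) auto
    then show ?thesis by (simp only: pairing_fun_sum pairing_fun_scale)
  qed
  moreover have "((\<lambda>t. \<Sum>x<?C. real (b x) * pairing \<G> (zop (psi B ?C (cutoff x t) (cutoff (b x) 0))))
      has_integral (\<Sum>x<?C. real (b x) * (\<Sum>k<K. c k * (((1 - (real (b x) - real x)) ^ Suc k
        - (0 - (real (b x) - real x)) ^ Suc k) / real (Suc k))))) {0..1}"
  proof (intro has_integral_sum has_integral_mult_right)
    fix x assume "x \<in> {..<?C}"
    then have *: "x < ?C" by simp
    show "((\<lambda>t. pairing \<G> (zop (psi B ?C (cutoff x t) (cutoff (b x) 0)))) has_integral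
      (\<Sum>k<K. c k * (((1 - (real (b x) - real x)) ^ Suc k
        - (0 - (real (b x) - real x)) ^ Suc k) / real (Suc k)))) {0..1}"
      unfolding b_eq[OF *] by (intro has_integral_sum has_integral_mult_right has_integral_power_diff1) auto
  qed simp
  ultimately have black: "pairing \<G> (\<lambda>G. real (card (black G)) * coloring_number B ?C G) =
      (\<Sum>x<?C. real (b x) * (\<Sum>k<K. c k * (((1 - (real (b x) - real x)) ^ Suc k
        - (0 - (real (b x) - real x)) ^ Suc k) / real (Suc k))))"
    by (rule has_integral_unique)
  have "((\<lambda>t. \<Sum>y<?C. real (a y) * pairing \<G> (zop (psi B ?C (cutoff (a y) 0) (cutoff y t))))
      has_integral pairing \<G> (\<lambda>G. real (card (white G)) * coloring_number B ?C G)) {0..1}"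
  proof -
    \<comment> \<open>Transposition turns rows into columns and white vertices into black
      ones.\<close>
    have "((\<lambda>t. \<Sum>y<?C. real (a y) * zop (psi B ?C (cutoff (a y) 0) (cutoff y t)) G)
        has_integral real (card (white G)) * coloring_number B ?C G) {0..1}"
      if "G \<in> Poly_Mapping.keys \<G>" for G
    proof -
      have "finite_bigraph (flip G)" "spanned (flip G)"
        using graphs[OF that] by (auto simp: finite_bigraph_def spanned_def image_image)
      from column_integral[OF this diagram_converse[OF B], of ?C]
      show ?thesis by (simp only: zop_psi_flip coloring_number_flip a_def flip_sel le_SucI order_refl)
    qed
    then have "((\<lambda>t. pairing \<G> (\<lambda>G. \<Sum>y<?C. real (a y) * zop (psi B ?C (cutoff (a y) 0) (cutoff y t)) G))
      has_integral pairing \<G> (\<lambda>G. real (card (white G)) * coloring_number B ?C G)) {0..1}"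
      unfolding pairing_def by (intro has_integral_sum has_integral_mult_right) auto
    then show ?thesis by (simp only: pairing_fun_sum pairing_fun_scale)
  qed
  moreover have "((\<lambda>t. \<Sum>y<?C. real (a y) * pairing \<G> (zop (psi B ?C (cutoff (a y) 0) (cutoff y t))))
      has_integral (\<Sum>y<?C. real (a y) * (\<Sum>k<K. c k * ((((real (a y) - real y) - 0) ^ Suc k
        - ((real (a y) - real y) - 1) ^ Suc k) / real (Suc k))))) {0..1}"
  proof (intro has_integral_sum has_integral_mult_right)
    fix y assume "y \<in> {..<?C}"
    then have *: "y < ?C" by simp
    show "((\<lambda>t. pairing \<G> (zop (psi B ?C (cutoff (a y) 0) (cutoff y t)))) has_integral
      (\<Sum>k<K. c k * ((((real (a y) - real y) - 0) ^ Suc k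
        - ((real (a y) - real y) - 1) ^ Suc k) / real (Suc k)))) {0..1}"
      unfolding a_eq[OF *] by (intro has_integral_sum has_integral_mult_right has_integral_power_diff2) auto
  qed simp
  ultimately have white: "pairing \<G> (\<lambda>G. real (card (white G)) * coloring_number B ?C G) =
      (\<Sum>y<?C. real (a y) * (\<Sum>k<K. c k * ((((real (a y) - real y) - 0) ^ Suc k
        - ((real (a y) - real y) - 1) ^ Suc k) / real (Suc k))))"
    by (rule has_integral_unique)
  have "pairing \<G> (\<lambda>G. real (vertex_count G) * coloring_number B ?C G) =
      pairing \<G> (\<lambda>G. real (card (black G)) * coloring_number B ?C G)
      + pairing \<G> (\<lambda>G. real (card (white G)) * coloring_number B ?C G)"
    unfolding pairing_fun_add[symmetric] vertex_count_def by (simp add: distrib_right add.commute)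
  also have "\<dots> = (\<Sum>k<K. c k / real (k + 1) *
      ((\<Sum>x<?C. real (b x) * ((real x - real (b x) + 1) ^ Suc k - (real x - real (b x)) ^ Suc k))
      + (\<Sum>y<?C. real (a y) * ((real (a y) - real y) ^ Suc k - (real (a y) - real y - 1) ^ Suc k))))"
  proof -
    have e: "1 - (real (b x) - real x) = real x - real (b x) + 1"
      "0 - (real (b x) - real x) = real x - real (b x)" for x
      by simp_all
    have swap: "(\<Sum>x<?C. r x * (\<Sum>k<K. c k * (d x k / real (Suc k)))) =
        (\<Sum>k<K. c k / real (k + 1) * (\<Sum>x<?C. r x * d x k))" for r and d :: "nat \<Rightarrow> nat \<Rightarrow> real"
      unfolding sum_distrib_left by (subst sum.swap) (simp add: mult_ac)
    show ?thesis
      unfolding black white e diff_zero swap distrib_left sum.distrib ..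
  qed
  also have "\<dots> = (\<Sum>k<K. c k / real (k + 1) * (\<Sum>p\<in>B. box_weight k p))"
    unfolding a_def b_def by (simp only: boundary_sum_eq_box_sum[OF B le_SucI[OF order_refl]])
  finally show ?thesis unfolding c_def .
qed

end


section \<open>Polynomial functions\<close>

lemma polynomial_functions_sum:
  "(\<And>k. k \<in> I \<Longrightarrow> F k \<in> polynomial_functions) \<Longrightarrow> (\<lambda>\<nu>. \<Sum>k\<in>I. F k \<nu>) \<in> polynomial_functions"
  by (induction I rule: infinite_finite_induct)
    (auto intro: polynomial_functions.intros)

lemma polynomial_functions_scale:
  "F \<in> polynomial_functions \<Longrightarrow> (\<lambda>\<nu>. c * F \<nu>) \<in> polynomial_functions"
  by (intro polynomial_functions.mult polynomial_functions.const)

lemma young_diagram: "\<exists>M. diagram M (boxes \<nu>)"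
proof -
  have fin: "finite (boxes \<nu>)" and sub: "boxes \<nu> \<subseteq> {1..} \<times> {1..}"
    and down: "\<forall>(i, j) \<in> boxes \<nu>. {1..i} \<times> {1..j} \<subseteq> boxes \<nu>"
    using boxes[of \<nu>] by auto
  define M where "M = (\<Sum>p\<in>boxes \<nu>. fst p + snd p)"
  have "fst p + snd p \<le> M" if "p \<in> boxes \<nu>" for p
    unfolding M_def using fin that by (intro member_le_sum) auto
  then have "boxes \<nu> \<subseteq> {1..M} \<times> {1..M}" using sub by fastforce
  then show ?thesis using down unfolding diagram_def by blast
qed

lemma diagram_mono: "diagram M B \<Longrightarrow> M \<le> M' \<Longrightarrow> diagram M' B"
  unfolding diagram_def by fastforce

text \<open>The factor \<open>k + 2\<close> comes from expressing the box sum through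
  \<open>S (k + 2)\<close>, and \<open>1 / (k + 1)\<close> from the boundary integral of
  \<open>z ^ k\<close>.\<close>

lemma N_comb_recursion:
  fixes \<G> :: "('w, 'b) bigraph \<Rightarrow>\<^sub>0 real"
  assumes graphs: "\<And>G. G \<in> Poly_Mapping.keys \<G> \<Longrightarrow> finite_bigraph G \<and> graded (int n) G"
    and bal: "xy_balanced \<G>"
  shows "real n * N_comb \<G> \<nu> =
    (\<Sum>k<n. real (k + 2) / real (k + 1) * (N_comb (strip_comb k \<G>) \<nu> * S (k + 2) \<nu>))"
proof -
  obtain M where M: "diagram M (boxes \<nu>)" using young_diagram by blast
  then have M': "diagram (Suc M) (boxes \<nu>)" by (rule diagram_mono) simp
  let ?c = "coloring_number (boxes \<nu>) (Suc M)"
  have N: "N_comb X \<nu> = pairing X ?c"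
    if "\<And>G. G \<in> Poly_Mapping.keys X \<Longrightarrow> finite_bigraph G \<and> graded m G"
    for X :: "('w, 'b) bigraph \<Rightarrow>\<^sub>0 real" and m
    unfolding N_comb_eq_pairing using that M'
    by (intro pairing_cong N_eq_coloring_number) (auto simp: graded_def)
  have N0: "N_comb \<G> \<nu> = pairing \<G> ?c"
    by (rule N) (rule graphs)
  have Nk: "N_comb (strip_comb k \<G>) \<nu> = pairing (strip_comb k \<G>) ?c" for k
    by (rule N) (rule keys_strip_comb[OF graphs])
  have "real n * N_comb \<G> \<nu> = pairing \<G> (\<lambda>G. real (vertex_count G) * ?c G)"
    unfolding N0 pairing_fun_scale[symmetric]
    using graphs by (intro pairing_cong) (auto simp: graded_def)
  also have "\<dots> = (\<Sum>k<n. pairing (strip_comb k \<G>) ?c / real (k + 1) * (\<Sum>p\<in>boxes \<nu>. box_weight k p))"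
  proof (rule vertex_count_pairing[OF _ bal M])
    fix G assume "G \<in> Poly_Mapping.keys \<G>"
    from graphs[OF this] show "finite_bigraph G \<and> spanned G \<and> card (white G) \<le> n \<and> card (black G) \<le> n"
      by (auto simp: graded_def vertex_count_def)
  qed
  also have "\<dots> = (\<Sum>k<n. real (k + 2) / real (k + 1) * (N_comb (strip_comb k \<G>) \<nu> * S (k + 2) \<nu>))"
  proof (intro sum.cong refl)
    fix k
    have S: "(\<Sum>p\<in>boxes \<nu>. box_weight k p) = real (k + 2) * S (k + 2) \<nu>"
      unfolding S_eq_sum by simp
    show "pairing (strip_comb k \<G>) ?c / real (k + 1) * (\<Sum>p\<in>boxes \<nu>. box_weight k p) =
        real (k + 2) / real (k + 1) * (N_comb (strip_comb k \<G>) \<nu> * S (k + 2) \<nu>)"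
      unfolding Nk S by simp
  qed
  finally show ?thesis .
qed

text \<open>Stripping with parameter \<open>k\<close> lowers the degree by \<open>k + 2\<close>, so
  for \<open>n > 0\<close> the recursion can be divided by \<open>n\<close> and refers to smaller
  degrees only.\<close>

lemma N_comb_graded_polynomial:
  assumes "\<And>G. G \<in> Poly_Mapping.keys \<G> \<Longrightarrow> finite_bigraph G \<and> graded (int n) G"
    and "xy_balanced \<G>"
  shows "N_comb \<G> \<in> polynomial_functions"
  using assms
proof (induction n arbitrary: \<G> rule: less_induct)
  case (less n)
  show ?case
  proof (cases "n = 0")
    case True
    \<comment> \<open>In degree 0 there is only the empty graph, with its single empty
      coloring.\<close>
    have "N G \<nu> = 1" if G: "G \<in> Poly_Mapping.keys \<G>" for G \<nu>
    proof -
      have "vertex_count G = 0" "finite (white G)" "finite (black G)"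
        using less.prems(1)[OF G] True by (auto simp: graded_def finite_bigraph_def)
      then have "white G = {}" "black G = {}" by (simp_all add: vertex_count_def)
      moreover have fin: "finite_bigraph G" "spanned G"
        using less.prems(1)[OF G] by (auto simp: graded_def)
      moreover from calculation have "edges G = {}" by (auto simp: finite_bigraph_def)
      moreover obtain M where "diagram M (boxes \<nu>)" using young_diagram by blast
      ultimately have "real (N G \<nu>) = 1"
        by (simp add: N_eq_coloring_number coloring_number_def)
      then show ?thesis by simp
    qed
    then have "N_comb \<G> = (\<lambda>_. \<Sum>G\<in>Poly_Mapping.keys \<G>. Poly_Mapping.lookup \<G> G)"
      by (simp add: fun_eq_iff N_comb_def)
    then show ?thesis by (simp add: polynomial_functions.const)
  next
    case False
    have strip: "N_comb (strip_comb k \<G>) \<in> polynomial_functions" for k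
    proof -
      have keys: "finite_bigraph G \<and> graded (int n - 2 - int k) G"
        if "G \<in> Poly_Mapping.keys (strip_comb k \<G>)" for G
        using keys_strip_comb[OF less.prems(1) that] .
      have bal: "xy_balanced (strip_comb k \<G>)"
        using less.prems by (intro xy_balanced_strip_comb) auto
      show ?thesis
      proof (cases "k + 2 \<le> n")
        case True
        then have "int n - 2 - int k = int (n - 2 - k)" by simp
        from keys[unfolded this] bal show ?thesis
          by (rule less.IH[rotated]) (use \<open>n \<noteq> 0\<close> in simp_all)
      next
        \<comment> \<open>The degree \<open>n - 2 - k\<close> is negative, so no graph survives the
          stripping.\<close>
        case False
        then have "Poly_Mapping.keys (strip_comb k \<G>) = {}"
          using keys by (force simp: graded_def)
        then show ?thesis
          using polynomial_functions.const[of 0] by (simp add: N_comb_def[abs_def])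
      qed
    qed
    have rec: "real n * N_comb \<G> \<nu> =
      (\<Sum>k<n. real (k + 2) / real (k + 1) * (N_comb (strip_comb k \<G>) \<nu> * S (k + 2) \<nu>))" for \<nu>
      by (rule N_comb_recursion) (use less.prems in auto)
    have "N_comb \<G> = (\<lambda>\<nu>. 1 / real n *
        (\<Sum>k<n. real (k + 2) / real (k + 1) * (N_comb (strip_comb k \<G>) \<nu> * S (k + 2) \<nu>)))"
      unfolding rec[symmetric] using False by simp
    moreover have "\<dots> \<in> polynomial_functions"
      by (intro polynomial_functions_scale polynomial_functions_sum polynomial_functions.mult
          polynomial_functions.gen strip) simp
    ultimately show ?thesis by simp
  qed
qed

theorem mainTheorem1:
  fixes \<G> :: "('w, 'b) bigraph \<Rightarrow>\<^sub>0 real"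
  assumes graphs: "\<And>G. G \<in> Poly_Mapping.keys \<G> \<Longrightarrow> finite_bigraph G"
    and deriv: "\<And>k :: nat. k > 0 \<Longrightarrow>
      unlabelled ((deriv_x ^^ k) (deriv_z \<G>) - ((\<lambda>X. - deriv_y X) ^^ k) (deriv_z \<G>)) = 0"
  shows "N_comb \<G> \<in> polynomial_functions"
proof -
  have bal: "xy_balanced \<G>" by (rule xy_balancedI[OF graphs deriv])
  define m where "m = (\<Sum>G\<in>Poly_Mapping.keys \<G>. vertex_count G)"
  have le: "vertex_count G \<le> m" if "G \<in> Poly_Mapping.keys \<G>" for G
    unfolding m_def using that by (intro member_le_sum) auto
  \<comment> \<open>A graph without isolated vertices lies in exactly one graded part of degree at
    most \<open>m\<close>. The other graphs lie in none and have \<open>N\<close> equal to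
    0.\<close>
  have "N_comb \<G> \<nu> = (\<Sum>n\<le>m. N_comb (graded_part (int n) \<G>) \<nu>)" for \<nu>
  proof -
    have "(\<Sum>n\<le>m. N_comb (graded_part (int n) \<G>) \<nu>) =
        pairing \<G> (\<lambda>G. \<Sum>n\<le>m. if graded (int n) G then real (N G \<nu>) else 0)"
      by (simp add: N_comb_eq_pairing pairing_graded_part pairing_fun_sum)
    also have "\<dots> = pairing \<G> (\<lambda>G. real (N G \<nu>))"
    proof (rule pairing_cong)
      fix G assume G: "G \<in> Poly_Mapping.keys \<G>"
      show "(\<Sum>n\<le>m. if graded (int n) G then real (N G \<nu>) else 0) = real (N G \<nu>)"
      proof (cases "spanned G")
        case True
        then have "graded (int n) G \<longleftrightarrow> n = vertex_count G" for n by (auto simp: graded_def)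
        then show ?thesis using le[OF G] by simp
      next
        case False
        then show ?thesis using N_eq_0_if_not_spanned[OF graphs[OF G]] by (simp add: graded_def)
      qed
    qed
    finally show ?thesis by (simp add: N_comb_eq_pairing)
  qed
  then have "N_comb \<G> = (\<lambda>\<nu>. \<Sum>n\<le>m. N_comb (graded_part (int n) \<G>) \<nu>)" by (rule ext)
  moreover have "N_comb (graded_part (int n) \<G>) \<in> polynomial_functions" for n
    using graphs keys_graded_part[of _ "int n" \<G>]
    by (intro N_comb_graded_polynomial[of _ n] xy_balanced_graded_part bal) blast+
  ultimately show ?thesis by (simp add: polynomial_functions_sum)
qed

end
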